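(* Let $E$ be a field of characteristic different from $2$ that is finitely generated of transcendence degree at least one over a subfield. Let $E_0/E$ be a (possibly infinite) Galois extension and assume that $E_0$ is either pythagorean or quadratically closed. Then $E_0$ is hereditarily non-pythagorean.
   Context: A field $K$ is pythagorean if every sum of squares of elements of $K$ is a square in $K$, and quadratically closed if every element of $K$ is a square in $K$. A field $k$ is hereditarily non-pythagorean if every proper finite extension $F/k$ that is not purely inseparable is non-pythagorean (i.e. not pythagorean). *)

theory Defs
  imports "HOL-Algebra.Algebra" "HOL-Algebra.Algebraic_Closure" "HOL-Library.Extended_Nat"
begin

(* A field extension R/K is given by a field R together with a subfield K, a subset of its carrier.
   An intermediate field E is regarded as a field through the record R with carrier E. *)

(* The analogue of CHAR for rings with an explicit carrier; Gcd {0} = 0 gives characteristic 0. *)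
definition field_char :: "('a, 'm) ring_scheme \<Rightarrow> nat" where
  "field_char R = Gcd {n :: nat. add_pow R n \<one>\<^bsub>R\<^esub> = \<zero>\<^bsub>R\<^esub>}"

definition is_square_in :: "('a, 'm) ring_scheme \<Rightarrow> 'a \<Rightarrow> bool" where
  "is_square_in R a \<longleftrightarrow> (\<exists>y\<in>carrier R. a = y [^]\<^bsub>R\<^esub> (2::nat))"

definition pythagorean :: "('a, 'm) ring_scheme \<Rightarrow> bool" where
  "pythagorean R \<longleftrightarrow>
     (\<forall>(n::nat) x. x \<in> {..<n} \<rightarrow> carrier R \<longrightarrow>
        is_square_in R (\<Oplus>\<^bsub>R\<^esub>i\<in>{..<n}. x i [^]\<^bsub>R\<^esub> (2::nat)))"

definition quadratically_closed :: "('a, 'm) ring_scheme \<Rightarrow> bool" where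
  "quadratically_closed R \<longleftrightarrow> (\<forall>a\<in>carrier R. is_square_in R a)"

definition finitely_generated_over :: "('a, 'm) ring_scheme \<Rightarrow> 'a set \<Rightarrow> bool" where
  "finitely_generated_over R K \<longleftrightarrow>
     (\<exists>S. finite S \<and> S \<subseteq> carrier R \<and> carrier R = generate_field R (K \<union> S))"

(* The library's indexed polynomials map each monomial, a multiset of indeterminates, to its
   coefficient, and vanish at all but finitely many monomials. Here the indeterminates are
   elements of R, and every indeterminate is evaluated at itself. *)
definition indexed_value :: "('a, 'm) ring_scheme \<Rightarrow> ('a multiset \<Rightarrow> 'a) \<Rightarrow> 'a" where
  "indexed_value R P =
     (\<Oplus>\<^bsub>R\<^esub>m\<in>{m. P m \<noteq> \<zero>\<^bsub>R\<^esub>}. P m \<otimes>\<^bsub>R\<^esub> (\<Otimes>\<^bsub>R\<^esub>x\<in>set_mset m. x [^]\<^bsub>R\<^esub> count m x))"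

definition algebraically_independent :: "('a, 'm) ring_scheme \<Rightarrow> 'a set \<Rightarrow> 'a set \<Rightarrow> bool" where
  "algebraically_independent R K S \<longleftrightarrow>
     S \<subseteq> carrier R \<and>
     (\<forall>P\<in>ring.indexed_pset R S K. indexed_value R P = \<zero>\<^bsub>R\<^esub> \<longrightarrow> (\<forall>m. P m = \<zero>\<^bsub>R\<^esub>))"

(* Infinite transcendence degrees are not distinguished from one another. *)
definition transcendence_degree :: "('a, 'm) ring_scheme \<Rightarrow> 'a set \<Rightarrow> enat" where
  "transcendence_degree R K =
     (SUP S\<in>{S. finite S \<and> algebraically_independent R K S}. enat (card S))"

definition algebraic_extension :: "('a, 'm) ring_scheme \<Rightarrow> 'a set \<Rightarrow> bool" where
  "algebraic_extension R K \<longleftrightarrow> (\<forall>x\<in>carrier R. ring.algebraic R K x)"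

definition normal_extension :: "('a, 'm) ring_scheme \<Rightarrow> 'a set \<Rightarrow> bool" where
  "normal_extension R K \<longleftrightarrow> algebraic_extension R K \<and>
     (\<forall>p\<in>carrier (univ_poly R K). pirreducible\<^bsub>R\<^esub> K p \<and> (\<exists>x\<in>carrier R. ring.eval R p x = \<zero>\<^bsub>R\<^esub>)
        \<longrightarrow> ring.splitted R p)"

(* A nonzero polynomial over a field K is separable if it has no multiple root in an algebraic
   closure of K; the library embeds K into its algebraic closure by indexed_const. *)
definition separable_poly :: "('a, 'm) ring_scheme \<Rightarrow> 'a list \<Rightarrow> bool" where
  "separable_poly K p \<longleftrightarrow> p \<noteq> [] \<and>
     (\<forall>x\<in>carrier (field.alg_closure K).
        ring.alg_mult (field.alg_closure K) (map (ring.indexed_const K) p) x \<le> 1)"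

definition separable_elem :: "('a, 'm) ring_scheme \<Rightarrow> 'a set \<Rightarrow> 'a \<Rightarrow> bool" where
  "separable_elem R K x \<longleftrightarrow>
     ring.algebraic R K x \<and> separable_poly (R\<lparr>carrier := K\<rparr>) (ring.Irr R K x)"

definition separable_extension :: "('a, 'm) ring_scheme \<Rightarrow> 'a set \<Rightarrow> bool" where
  "separable_extension R K \<longleftrightarrow> (\<forall>x\<in>carrier R. separable_elem R K x)"

definition galois_extension :: "('a, 'm) ring_scheme \<Rightarrow> 'a set \<Rightarrow> bool" where
  "galois_extension R K \<longleftrightarrow>
     field R \<and> subfield K R \<and> normal_extension R K \<and> separable_extension R K"

definition purely_inseparable_extension :: "('a, 'm) ring_scheme \<Rightarrow> 'a set \<Rightarrow> bool" where
  "purely_inseparable_extension R K \<longleftrightarrow> algebraic_extension R K \<and>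
     (\<forall>x\<in>carrier R - K. \<not> separable_elem R K x)"

(* An extension F/k is an embedding h of k into a field F. A definition cannot quantify over types,
   so the type of the elements of F is a parameter; a theorem about TYPE('b) with 'b a
   type variable covers every extension. *)
definition hereditarily_non_pythagorean :: "'b itself \<Rightarrow> ('a, 'm) ring_scheme \<Rightarrow> bool" where
  "hereditarily_non_pythagorean _ k \<longleftrightarrow>
     (\<forall>(F :: 'b ring) h.
        field F \<and> h \<in> ring_hom k F \<and>
        ring.finite_dimension F (h ` carrier k) (carrier F) \<and>
        h ` carrier k \<noteq> carrier F \<and>
        \<not> purely_inseparable_extension F (h ` carrier k)
        \<longrightarrow> \<not> pythagorean F)"

end

theory Submission imports Defs begin

text \<open>Suppose that a finite, not purely inseparable extension \<open>F\<close> of \<open>E0\<close> is pythagorean, and work in an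
  algebraic closure of \<open>F\<close>. Choose \<open>\<alpha> \<in> F - E0\<close> separable over \<open>E0\<close>. In the finite extension
  \<open>F / E0(\<alpha>)\<close> the property descends (Diller and Dress): \<open>1 + x\<^sup>2\<close> is a square in \<open>E0(\<alpha>)\<close> for all
  \<open>x \<in> E0(\<alpha>)\<close>. After translating \<open>\<alpha>\<close> by an element of \<open>E\<close>, its square \<open>\<gamma>\<close> still generates \<open>E0(\<alpha>)\<close>.
  Let \<open>E1\<close> be a finite extension of \<open>E\<close> in \<open>E0\<close> over which \<open>\<gamma>\<close> has the same degree. For \<open>c \<in> E1\<close> the
  element \<open>1 + c\<^sup>2 \<gamma>\<close> is a square in \<open>E0(\<gamma>)\<close>, and as \<open>E0 / E\<close> is Galois, a Kummer argument gives
  \<open>1 + c\<^sup>2 \<gamma> = b l(\<gamma>)\<^sup>2\<close> with \<open>b \<in> E1\<close> and a polynomial \<open>l\<close> over \<open>E1\<close>; the identity persists at all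
  conjugates of \<open>\<gamma>\<close>. Now \<open>E1\<close> is finite over a rational function field \<open>K(t)\<close>. Choose \<open>c \<in> K[t]\<close> and a
  valuation ring containing \<open>K[t]\<close> such that the conjugates of \<open>\<gamma>\<close> are integral and distinct modulo
  the maximal ideal, \<open>\<gamma>\<close> and \<open>c\<close> are units and \<open>1 + c\<^sup>2 \<gamma>\<close> is not. Since \<open>b l\<^sup>2\<close> represents \<open>1 + c\<^sup>2 \<gamma>\<close> at all
  conjugates, \<open>1 + c\<^sup>2 \<gamma>\<close> then has the value of a square of \<open>E1\<close>. Perturbing \<open>c\<close> shows that every
  value of \<open>E1\<close> strictly between \<open>0\<close> and the value of \<open>1 + c\<^sup>2 \<gamma>\<close> is twice a value of \<open>E1\<close>, which is absurd
  since the valuation is discrete on \<open>E1\<close>.\<close>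

section \<open>Valuation rings\<close>

text \<open>A valuation need not be discrete on \<open>E0\<close>, which may be infinite over
  \<open>E\<close>; this is why every identity is pushed down to one finite \<open>E1\<close>, fixed
  by \<gamma> alone and before \<open>c\<close> is chosen. The square makes 1 + c^2 \<gamma> = 1 +
  (c (\<alpha> + j))^2, so the descended property applies to it for all \<open>c\<close> of
  \<open>E1\<close> at once, and \<gamma> still has as many conjugates as \<alpha>. The value group
  of an algebraically closed field is divisible, so being a square there says nothing about values
  on \<open>E1\<close>. The force of the identity is that \<open>l\<close> has only as many
  coefficients as \<gamma> has conjugates, whose residues are distinct: as with a Vandermonde
  system, this fixes the scale of \<open>l\<close> modulo the maximal ideal and makes
  \<open>b\<close> a square of \<open>E1\<close> up to a unit. The value of l(\<gamma>) is attained
  on \<open>E1\<close> as well, because \<gamma> is congruent to the element -1/c^2 of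
  \<open>E1\<close>. All conjugates live in one field, so a single valuation ring of it handles them
  together, and discreteness on \<open>E1\<close> enters as two inequalities for D-th
  powers.\<close>

context field
begin

lemma nonzero_inv:
  assumes "x \<in> carrier R" "x \<noteq> \<zero>"
  shows "inv x \<in> carrier R" "inv x \<noteq> \<zero>" "x \<otimes> inv x = \<one>" "inv x \<otimes> x = \<one>" "inv (inv x) = x"
proof -
  have u: "x \<in> Units R" using assms field_Units by auto
  show "inv x \<in> carrier R" "x \<otimes> inv x = \<one>" "inv x \<otimes> x = \<one>" "inv (inv x) = x" using u by auto
  show "inv x \<noteq> \<zero>" using u assms Units_r_inv[OF u] by (metis one_not_zero r_null)
qed

lemma subring_pow:
  assumes "subring H R" "g \<in> H" shows "g [^] (n::nat) \<in> H"
  by (induction n) (use assms subringE[OF assms(1)] in auto)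

lemma subring_minus:
  assumes "subring H R" "x \<in> H" "y \<in> H" shows "x \<ominus> y \<in> H"
  using assms subringE(5,7)[OF assms(1)] by (auto simp: a_minus_def)

lemma subring_eval:
  assumes "subring H R" "set l \<subseteq> H" "g \<in> H" shows "eval l g \<in> H"
  using assms(2)
  by (induction l) (use subring_pow[OF assms(1,3)] subringE[OF assms(1)] in auto)

text \<open>Synthetic division by X - g. Coefficient lists start with the leading coefficient and
  may begin with zeros, so lengths rather than degrees are tracked. The last clause inverts the
  division: coefficients are recovered from quotient and remainder, so they stay in every
  \<open>I\<close> that behaves like an ideal over \<open>H\<close>. It is applied with
  \<open>I\<close> the set of \<open>small\<close> elements.\<close>

lemma eval_horner_quotient:
  assumes "set l \<subseteq> H" "subring H R" "g \<in> H"
  shows "\<exists>q. length q = length l - 1 \<and> set q \<subseteq> H \<and>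
     (\<forall>x\<in>carrier R. eval l x = (x \<ominus> g) \<otimes> eval q x \<oplus> eval l g) \<and>
     (\<forall>I\<subseteq>carrier R. (\<forall>x\<in>I. \<forall>y\<in>I. x \<ominus> y \<in> I) \<and> (\<forall>x\<in>I. \<forall>h\<in>H. x \<otimes> h \<in> I) \<and>
        set q \<subseteq> I \<and> eval l g \<in> I \<longrightarrow> set l \<subseteq> I)"
  using assms(1)
proof (induction l rule: rev_induct)
  case Nil
  show ?case
    by (rule exI[of _ "[]"]) (use assms(2,3) subringE(1)[OF assms(2)] in \<open>auto simp: a_minus_def\<close>)
next
  case (snoc a l)
  note HR = subringE(1)[OF assms(2)]
  have gR: "g \<in> carrier R" and aR: "a \<in> carrier R" and lR: "set l \<subseteq> carrier R" and lH: "set l \<subseteq> H" and aH: "a \<in> H"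
    using assms HR snoc.prems by auto
  obtain q where q1: "length q = length l - 1" "set q \<subseteq> H"
     and q2: "\<forall>x\<in>carrier R. eval l x = (x \<ominus> g) \<otimes> eval q x \<oplus> eval l g"
     and q3: "\<forall>I\<subseteq>carrier R. (\<forall>x\<in>I. \<forall>y\<in>I. x \<ominus> y \<in> I) \<and> (\<forall>x\<in>I. \<forall>h\<in>H. x \<otimes> h \<in> I) \<and>
        set q \<subseteq> I \<and> eval l g \<in> I \<longrightarrow> set l \<subseteq> I"
    using snoc.IH[OF lH] by (elim exE conjE)
  show ?case
  proof (cases "l = []")
    case True
    show ?thesis
      by (rule exI[of _ "[]"]) (use True assms(3) aR gR in \<open>auto simp: a_minus_def\<close>)
  next
    case False
    \<comment> \<open>Horner's scheme: the next coefficient of the quotient is the remainder of the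
      shorter list.\<close>
    let ?q = "q @ [eval l g]"
    have qR: "set q \<subseteq> carrier R" using q1 HR by auto
    have e: "eval (l @ [a]) x = (x \<ominus> g) \<otimes> eval ?q x \<oplus> eval (l @ [a]) g" if x: "x \<in> carrier R" for x
    proof -
      have c: "eval q x \<in> carrier R" "eval l g \<in> carrier R" using x gR lR qR eval_in_carrier by auto
      have "eval (l @ [a]) x = ((x \<ominus> g) \<otimes> eval q x \<oplus> eval l g) \<otimes> x \<oplus> a"
        using eval_append_aux[OF lR aR x] bspec[OF q2 x] by simp
      also have "\<dots> = (x \<ominus> g) \<otimes> (eval q x \<otimes> x \<oplus> eval l g) \<oplus> (eval l g \<otimes> g \<oplus> a)"
        using x c gR aR by algebra
      finally show ?thesis
        using eval_append_aux[OF lR aR gR] eval_append_aux[OF qR c(2) x] by simp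
    qed
    have i: "set (l @ [a]) \<subseteq> I" if I: "I \<subseteq> carrier R" "\<forall>x\<in>I. \<forall>y\<in>I. x \<ominus> y \<in> I" "\<forall>x\<in>I. \<forall>h\<in>H. x \<otimes> h \<in> I"
        "set ?q \<subseteq> I" "eval (l @ [a]) g \<in> I" for I
    proof -
      have l: "set l \<subseteq> I" using q3 I by simp
      have *: "eval l g \<otimes> g \<in> I" using I assms(3) by auto
      have "a = eval (l @ [a]) g \<ominus> eval l g \<otimes> g"
        using eval_append_aux[OF lR aR gR] gR aR eval_in_carrier[OF lR gR] by algebra
      then have "a \<in> I" using I * by metis
      then show ?thesis using l by auto
    qed
    show ?thesis
    proof (rule exI[of _ ?q], intro conjI ballI allI impI)
      show "length ?q = length (l @ [a]) - 1" "set ?q \<subseteq> H"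
        using q1 False subring_eval[OF assms(2) lH assms(3)] by (auto simp: Suc_leI)
    qed (use e i in blast)+
  qed
qed

end

text \<open>\<open>V\<close> may be the whole carrier. This is the trivial valuation, under which
  every nonzero element is a unit; \<open>vanishing_polynomial\<close> relies on it.\<close>

locale valued_field = field +
  fixes V
  assumes subring: "subring V R"
    and total: "\<lbrakk> x \<in> carrier R; x \<noteq> \<zero> \<rbrakk> \<Longrightarrow> x \<in> V \<or> inv x \<in> V"
begin

text \<open>The value group is not constructed: \<open>x \<preceq> y\<close> means \<open>v(x) \<le> v(y)\<close> for the valuation \<open>v\<close> of \<open>V\<close>.\<close>

definition vle :: "'a \<Rightarrow> 'a \<Rightarrow> bool" (infix "\<preceq>" 50) where
  "x \<preceq> y \<longleftrightarrow> (\<exists>v\<in>V. y = v \<otimes> x)"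

definition veq :: "'a \<Rightarrow> 'a \<Rightarrow> bool" (infix "\<asymp>" 50) where
  "x \<asymp> y \<longleftrightarrow> x \<preceq> y \<and> y \<preceq> x"

text \<open>Positive value: the maximal ideal of \<open>V\<close>. Zero belongs to it, its value
  being infinite.\<close>

definition small :: "'a \<Rightarrow> bool" where
  "small x \<longleftrightarrow> x \<in> carrier R \<and> \<not> x \<preceq> \<one>"

lemma V_carrier: "x \<in> V \<Longrightarrow> x \<in> carrier R"
  using subringE(1)[OF subring] by auto

lemma vle_refl: "x \<in> carrier R \<Longrightarrow> x \<preceq> x"
  using subringE(3)[OF subring] unfolding vle_def by force

lemma vle_trans: "\<lbrakk> x \<preceq> y; y \<preceq> z; x \<in> carrier R \<rbrakk> \<Longrightarrow> x \<preceq> z"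
  using subringE(6)[OF subring] unfolding vle_def by (metis V_carrier m_assoc)

lemma vle_mult: "\<lbrakk> a \<preceq> b; c \<preceq> d; a \<in> carrier R; c \<in> carrier R \<rbrakk> \<Longrightarrow> a \<otimes> c \<preceq> b \<otimes> d"
  unfolding vle_def
proof -
  assume "\<exists>v\<in>V. b = v \<otimes> a" "\<exists>v\<in>V. d = v \<otimes> c" and c: "a \<in> carrier R" "c \<in> carrier R"
  then obtain v w where v: "v \<in> V" "w \<in> V" "b = v \<otimes> a" "d = w \<otimes> c" by auto
  have "b \<otimes> d = (v \<otimes> w) \<otimes> (a \<otimes> c)" using v(3,4) c V_carrier[OF v(1)] V_carrier[OF v(2)] by algebra
  then show "\<exists>v\<in>V. b \<otimes> d = v \<otimes> (a \<otimes> c)" using v subringE(6)[OF subring] by blast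
qed

lemma vle_add: "\<lbrakk> a \<preceq> b; a \<preceq> c; a \<in> carrier R \<rbrakk> \<Longrightarrow> a \<preceq> b \<oplus> c"
  using subringE(7)[OF subring] unfolding vle_def by (metis V_carrier l_distr)

lemma vle_a_inv: "\<lbrakk> a \<preceq> b; a \<in> carrier R \<rbrakk> \<Longrightarrow> a \<preceq> \<ominus> b"
  using subringE(5)[OF subring] unfolding vle_def by (metis V_carrier l_minus)

lemma vle_minus: "\<lbrakk> a \<preceq> b; a \<preceq> c; a \<in> carrier R \<rbrakk> \<Longrightarrow> a \<preceq> b \<ominus> c"
  unfolding a_minus_def by (intro vle_add vle_a_inv)

lemma vle_zero: "a \<in> carrier R \<Longrightarrow> a \<preceq> \<zero>"
  using subringE(2)[OF subring] unfolding vle_def by force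

lemma zero_vle: "\<zero> \<preceq> a \<Longrightarrow> a = \<zero>"
  unfolding vle_def using V_carrier by auto

lemma one_vle_iff: "x \<in> carrier R \<Longrightarrow> \<one> \<preceq> x \<longleftrightarrow> x \<in> V"
  unfolding vle_def using V_carrier by auto

lemma vle_total: "\<lbrakk> x \<in> carrier R; y \<in> carrier R \<rbrakk> \<Longrightarrow> x \<preceq> y \<or> y \<preceq> x"
proof -
  assume c: "x \<in> carrier R" "y \<in> carrier R"
  show ?thesis
  proof (cases "x = \<zero> \<or> y = \<zero>")
    case True then show ?thesis using vle_zero c by auto
  next
    case False
    note ix = nonzero_inv[OF c(1)] and iy = nonzero_inv[OF c(2)]
    have nz: "y \<otimes> inv x \<noteq> \<zero>" using False ix iy c integral_iff by auto
    have *: "inv (y \<otimes> inv x) = x \<otimes> inv y"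
      using False ix iy c by (metis comm_inv_char m_closed m_assoc m_comm r_one)
    consider "y \<otimes> inv x \<in> V" | "x \<otimes> inv y \<in> V" using total[OF _ nz] * c ix(1) False by auto
    then show ?thesis
    proof cases
      case 1
      have "y = (y \<otimes> inv x) \<otimes> x" using c False ix by (simp add: m_assoc)
      then show ?thesis using 1 unfolding vle_def by auto
    next
      case 2
      have "x = (x \<otimes> inv y) \<otimes> y" using c False iy by (simp add: m_assoc)
      then show ?thesis using 2 unfolding vle_def by auto
    qed
  qed
qed

lemma vle_cancel: "\<lbrakk> c \<otimes> a \<preceq> c \<otimes> b; a \<in> carrier R; b \<in> carrier R; c \<in> carrier R; c \<noteq> \<zero> \<rbrakk> \<Longrightarrow> a \<preceq> b"
  unfolding vle_def
proof -
  assume "\<exists>v\<in>V. c \<otimes> b = v \<otimes> (c \<otimes> a)" and c: "a \<in> carrier R" "b \<in> carrier R" "c \<in> carrier R" "c \<noteq> \<zero>"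
  then obtain v where v: "v \<in> V" "c \<otimes> b = v \<otimes> (c \<otimes> a)" by auto
  then have "c \<otimes> b = c \<otimes> (v \<otimes> a)" using c V_carrier by (simp add: m_lcomm)
  then have "b = v \<otimes> a" using c v V_carrier by (metis m_closed m_lcancel)
  then show "\<exists>v\<in>V. b = v \<otimes> a" using v by auto
qed

lemma vle_pow: "\<lbrakk> a \<preceq> b; a \<in> carrier R \<rbrakk> \<Longrightarrow> a [^] (n::nat) \<preceq> b [^] n"
  by (induction n) (auto intro: vle_mult vle_refl)

lemma small_in_V: "small x \<Longrightarrow> x \<in> V"
  using vle_total[of x \<one>] one_vle_iff unfolding small_def by auto

lemma small_carrier: "small x \<Longrightarrow> x \<in> carrier R"
  unfolding small_def by auto

lemma small_zero: "small \<zero>"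
  unfolding small_def using zero_vle[of \<one>] by (metis one_not_zero zero_closed)

lemma small_vle: "\<lbrakk> small a; a \<preceq> b; b \<in> carrier R \<rbrakk> \<Longrightarrow> small b"
  unfolding small_def using vle_trans by blast

lemma small_minus: "\<lbrakk> small a; small b \<rbrakk> \<Longrightarrow> small (a \<ominus> b)"
  using vle_total[of a b] small_vle[of a "a \<ominus> b"] small_vle[of b "a \<ominus> b"] vle_minus vle_refl small_carrier
  by (metis minus_closed)

lemma small_mult: "\<lbrakk> small a; v \<in> V \<rbrakk> \<Longrightarrow> small (a \<otimes> v)"
  using small_vle[of a "a \<otimes> v"] V_carrier small_carrier m_comm unfolding vle_def by (metis m_closed)

lemma not_small_iff: "x \<in> V \<Longrightarrow> \<not> small x \<longleftrightarrow> x \<asymp> \<one>"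
  unfolding small_def veq_def using one_vle_iff V_carrier by auto

lemma small_square: "\<lbrakk> small (x \<otimes> x); x \<in> carrier R \<rbrakk> \<Longrightarrow> small x"
  using vle_mult[of x \<one> x \<one>] unfolding small_def by auto

lemma veq_one_small: "\<lbrakk> x \<asymp> \<one>; small x \<rbrakk> \<Longrightarrow> False"
  unfolding veq_def small_def by auto

lemma veq_refl: "x \<in> carrier R \<Longrightarrow> x \<asymp> x"
  unfolding veq_def using vle_refl by auto

lemma veq_sym: "x \<asymp> y \<Longrightarrow> y \<asymp> x"
  unfolding veq_def by auto

lemma veq_trans: "\<lbrakk> x \<asymp> y; y \<asymp> z; x \<in> carrier R; z \<in> carrier R \<rbrakk> \<Longrightarrow> x \<asymp> z"
  unfolding veq_def using vle_trans by blast

lemma veq_mult: "\<lbrakk> a \<asymp> b; c \<asymp> d; a \<in> carrier R; c \<in> carrier R; b \<in> carrier R; d \<in> carrier R \<rbrakk> \<Longrightarrow> a \<otimes> c \<asymp> b \<otimes> d"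
  unfolding veq_def using vle_mult by auto

lemma unit_V: "\<lbrakk> x \<asymp> \<one>; x \<in> carrier R \<rbrakk> \<Longrightarrow> x \<in> V"
  unfolding veq_def using one_vle_iff by auto

lemma veq_zero: "x \<asymp> y \<Longrightarrow> x = \<zero> \<longleftrightarrow> y = \<zero>"
  unfolding veq_def using zero_vle by auto

lemma unit_inv: "\<lbrakk> x \<asymp> \<one>; x \<in> carrier R \<rbrakk> \<Longrightarrow> inv x \<asymp> \<one>"
proof -
  assume x: "x \<asymp> \<one>" "x \<in> carrier R"
  have nz: "x \<noteq> \<zero>" using veq_zero[OF x(1)] by auto
  have "inv x \<otimes> x \<asymp> inv x \<otimes> \<one>" using x nonzero_inv[OF x(2) nz] by (intro veq_mult veq_refl) auto
  then show ?thesis using nonzero_inv[OF x(2) nz] veq_sym by auto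
qed

lemma unit_iff_inv_V: "\<lbrakk> x \<in> carrier R; x \<noteq> \<zero> \<rbrakk> \<Longrightarrow> x \<asymp> \<one> \<longleftrightarrow> x \<in> V \<and> inv x \<in> V"
proof
  assume x: "x \<in> carrier R" "x \<noteq> \<zero>"
  { assume "x \<asymp> \<one>" then show "x \<in> V \<and> inv x \<in> V" using unit_V unit_inv nonzero_inv x by auto }
  { assume "x \<in> V \<and> inv x \<in> V"
    then show "x \<asymp> \<one>" unfolding veq_def using one_vle_iff x nonzero_inv[OF x] unfolding vle_def by metis }
qed

lemma unit_add_small: "\<lbrakk> x \<asymp> \<one>; small y; x \<in> carrier R \<rbrakk> \<Longrightarrow> x \<oplus> y \<asymp> \<one>"
proof -
  assume x: "x \<asymp> \<one>" "small y" "x \<in> carrier R"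
  have V: "x \<in> V" "y \<in> V" using x unit_V small_in_V by auto
  then have s: "x \<oplus> y \<in> V" using subringE(7)[OF subring] by auto
  have "\<not> small (x \<oplus> y)"
  proof
    assume "small (x \<oplus> y)"
    then have "small ((x \<oplus> y) \<ominus> y)" using x small_minus by auto
    moreover have "(x \<oplus> y) \<ominus> y = x" using V V_carrier by algebra
    ultimately show False using x veq_one_small by auto
  qed
  then show ?thesis using not_small_iff[OF s] by auto
qed

text \<open>Modulo the maximal ideal the points of \<open>G\<close> stay distinct, and a polynomial
  with at most as many coefficients as roots vanishes. Dividing by X - g removes one point: the
  values of the quotient at the other points remain small because each h - g is a unit.\<close>

lemma small_coeffs:
  assumes "finite G" "G \<subseteq> V" "\<And>g h. \<lbrakk> g \<in> G; h \<in> G; g \<noteq> h \<rbrakk> \<Longrightarrow> g \<ominus> h \<asymp> \<one>"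
    and "set l \<subseteq> V" "length l \<le> card G" "\<And>g. g \<in> G \<Longrightarrow> small (eval l g)"
  shows "\<forall>a\<in>set l. small a"
  using assms
proof (induction G arbitrary: l)
  case empty
  then show ?case by auto
next
  case (insert g G)
  have gV: "g \<in> V" using insert by auto
  have gR: "g \<in> carrier R" using gV V_carrier by auto
  obtain q where q1: "length q = length l - 1" "set q \<subseteq> V"
     and q2: "\<forall>x\<in>carrier R. eval l x = (x \<ominus> g) \<otimes> eval q x \<oplus> eval l g"
     and q3: "\<forall>I\<subseteq>carrier R. (\<forall>x\<in>I. \<forall>y\<in>I. x \<ominus> y \<in> I) \<and> (\<forall>x\<in>I. \<forall>h\<in>V. x \<otimes> h \<in> I) \<and>
        set q \<subseteq> I \<and> eval l g \<in> I \<longrightarrow> set l \<subseteq> I"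
    using eval_horner_quotient[OF insert.prems(3) subring gV] by (elim exE conjE)
  have lR: "set l \<subseteq> carrier R" and qR: "set q \<subseteq> carrier R" using insert.prems(3) q1(2) V_carrier by auto
  have sg: "small (eval l g)" using insert.prems by auto
  have "\<forall>a\<in>set q. small a"
  proof (rule insert.IH)
    show "G \<subseteq> V" "\<And>g h. \<lbrakk> g \<in> G; h \<in> G; g \<noteq> h \<rbrakk> \<Longrightarrow> g \<ominus> h \<asymp> \<one>" "set q \<subseteq> V"
      using insert.prems q1 by auto
    show "length q \<le> card G" using insert q1 by auto
    fix h assume h: "h \<in> G"
    then have hR: "h \<in> carrier R" and hg: "h \<ominus> g \<asymp> \<one>" using insert V_carrier by auto
    have c: "eval q h \<in> carrier R" "eval l g \<in> carrier R" "eval l h \<in> carrier R"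
      using eval_in_carrier lR qR hR gR by auto
    have "(h \<ominus> g) \<otimes> eval q h = eval l h \<ominus> eval l g"
      using bspec[OF q2 hR] c hR gR by algebra
    then have s: "small ((h \<ominus> g) \<otimes> eval q h)"
      using sg insert.prems(5)[of h] h small_minus by auto
    have "(h \<ominus> g) \<otimes> eval q h \<asymp> \<one> \<otimes> eval q h" using hg c hR gR by (intro veq_mult veq_refl) auto
    then show "small (eval q h)" using s small_vle c unfolding veq_def by auto
  qed
  then have "set q \<subseteq> Collect small" by auto
  moreover have "\<forall>x\<in>Collect small. \<forall>y\<in>Collect small. x \<ominus> y \<in> Collect small"
    "\<forall>x\<in>Collect small. \<forall>h\<in>V. x \<otimes> h \<in> Collect small" "Collect small \<subseteq> carrier R"
    using small_minus small_mult small_carrier by auto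
  ultimately have "set l \<subseteq> Collect small" using q3 sg by (metis mem_Collect_eq)
  then show ?case by auto
qed

end

section \<open>Chevalley's theorem: valuation rings in which a given non-unit stays a
  non-unit\<close>

context field
begin

lemma eval_smult:
  assumes "k \<in> carrier R" "set l \<subseteq> carrier R" "x \<in> carrier R"
  shows "eval (map (\<lambda>a. k \<otimes> a) l) x = k \<otimes> eval l x"
  using assms(2) by (induction l) (use assms in \<open>auto simp: r_distr m_assoc eval_in_carrier\<close>)

lemma eval_map2_add:
  assumes "length l = length m" "set l \<subseteq> carrier R" "set m \<subseteq> carrier R" "x \<in> carrier R"
  shows "eval (map2 (\<oplus>) l m) x = eval l x \<oplus> eval m x"
  using assms(1-3)
proof (induction l m rule: list_induct2)
  case Nil
  then show ?case by auto
next
  case (Cons a l b m)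
  have c: "a \<in> carrier R" "b \<in> carrier R" "eval l x \<in> carrier R" "eval m x \<in> carrier R" "x [^] length m \<in> carrier R"
    using Cons assms(4) by (auto simp: eval_in_carrier)
  have "(a \<oplus> b) \<otimes> x [^] length m \<oplus> (eval l x \<oplus> eval m x) =
     a \<otimes> x [^] length m \<oplus> eval l x \<oplus> (b \<otimes> x [^] length m \<oplus> eval m x)"
    using c by algebra
  then show ?case using Cons by auto
qed

lemma eval_replicate_zero: "x \<in> carrier R \<Longrightarrow> eval (replicate n \<zero>) x = \<zero>"
  by (induction n) auto

text \<open>With y = 1/x, the terms y, y^2, ... of y l(y) turn into x^(n-1), x^(n-2), ... after
  multiplication by x^n. The result has degree below \<open>n\<close>, which is what lets it replace
  x^n later.\<close>

lemma eval_inverse_reverse: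
  assumes "subring M R" "set l \<subseteq> M" "length l \<le> n" "x \<in> carrier R" "y \<in> carrier R" "x \<otimes> y = \<one>"
  shows "\<exists>r. set r \<subseteq> M \<and> length r = n \<and> eval r x = eval l y \<otimes> y \<otimes> x [^] n"
  using assms(2,3)
proof (induction l arbitrary: n rule: rev_induct)
  case Nil
  then show ?case
    by (intro exI[of _ "replicate n \<zero>"]) (use assms eval_replicate_zero subringE[OF assms(1)] in auto)
next
  case (snoc b l)
  then obtain n' where n: "n = Suc n'" by (cases n) auto
  have lM: "set l \<subseteq> M" "b \<in> M" "length l \<le> n'" using snoc.prems n by auto
  obtain r where r: "set r \<subseteq> M" "length r = n'" "eval r x = eval l y \<otimes> y \<otimes> x [^] n'"
    using snoc.IH[OF lM(1) lM(3)] by auto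
  have MR: "M \<subseteq> carrier R" using subringE[OF assms(1)] by auto
  have c: "b \<in> carrier R" "eval l y \<in> carrier R" "x [^] n' \<in> carrier R"
    using lM MR assms by (auto simp: eval_in_carrier)
  have "eval (l @ [b]) y \<otimes> y \<otimes> x [^] n = (eval l y \<otimes> y \<oplus> b) \<otimes> y \<otimes> (x [^] n' \<otimes> x)"
    using eval_append_aux[of l b y] lM MR c assms n by auto
  also have "\<dots> = (eval l y \<otimes> y \<otimes> x [^] n' \<oplus> b \<otimes> x [^] n') \<otimes> (x \<otimes> y)"
    using c assms(4,5) by algebra
  also have "\<dots> = b \<otimes> x [^] n' \<oplus> eval l y \<otimes> y \<otimes> x [^] n'"
    using c assms(4-6) by algebra
  finally show ?case
    by (intro exI[of _ "b # r"]) (use r lM n in auto)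
qed

lemma eval_clear_denominators:
  assumes "subring M R" "set l \<subseteq> M" "u \<in> M" "v \<in> carrier R" "u \<otimes> v = \<one>"
  shows "u [^] length l \<otimes> eval l v \<in> M"
  using assms(2)
proof (induction l rule: rev_induct)
  case Nil
  then show ?case using assms subringE[OF assms(1)] by auto
next
  case (snoc a l)
  note s = subringE[OF assms(1)]
  have uR: "u \<in> carrier R" "a \<in> carrier R" "set l \<subseteq> carrier R" and aM: "a \<in> M" "set l \<subseteq> M" using snoc.prems s(1) assms by auto
  have c: "u [^] length l \<in> carrier R" "eval l v \<in> carrier R" using uR assms by (auto simp: eval_in_carrier)
  have "u [^] length (l @ [a]) \<otimes> eval (l @ [a]) v = (u [^] length l \<otimes> u) \<otimes> (eval l v \<otimes> v \<oplus> a)"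
    using eval_append_aux[OF uR(3,2) assms(4)] by simp
  also have "\<dots> = (u [^] length l \<otimes> eval l v) \<otimes> (u \<otimes> v) \<oplus> (u [^] length l \<otimes> u) \<otimes> a"
    using c uR assms(4) by algebra
  also have "\<dots> = (u [^] length l \<otimes> eval l v) \<oplus> (u [^] length l \<otimes> u) \<otimes> a"
    using c assms by auto
  also have "\<dots> \<in> M"
    using snoc.IH[OF aM(2)] subring_pow[OF assms(1,3)] aM assms(3) s(6,7) by auto
  finally show ?case .
qed

text \<open>Powers of an element congruent to 1 modulo \<open>w\<close> stay congruent to 1; this
  serves to invert such elements in the maximal subring of Chevalley's argument.\<close>

lemma one_minus_pow:
  assumes "subring M R" "w \<in> M" "b \<in> M"
  shows "\<exists>r\<in>M. (\<one> \<ominus> w \<otimes> b) [^] (n::nat) = \<one> \<ominus> w \<otimes> r"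
proof (induction n)
  case 0
  then show ?case using subringE[OF assms(1)] assms by (intro bexI[of _ \<zero>]) (auto simp: a_minus_def)
next
  case (Suc n)
  note s = subringE[OF assms(1)]
  then obtain r where r: "r \<in> M" "(\<one> \<ominus> w \<otimes> b) [^] n = \<one> \<ominus> w \<otimes> r" using Suc by auto
  have c: "w \<in> carrier R" "b \<in> carrier R" "r \<in> carrier R" using s(1) assms r by auto
  have "(\<one> \<ominus> w \<otimes> r) \<otimes> (\<one> \<ominus> w \<otimes> b) = \<one> \<ominus> w \<otimes> (r \<oplus> b \<ominus> w \<otimes> (r \<otimes> b))"
    using c by algebra
  moreover have "r \<oplus> b \<ominus> w \<otimes> (r \<otimes> b) \<in> M"
    using s(6,7) subring_minus[OF assms(1)] r assms by auto
  ultimately show ?case using r by (auto simp: nat_pow_Suc)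
qed

lemma simple_extension_evalE:
  assumes "subring M R" "x \<in> carrier R" "y \<in> simple_extension M x"
  obtains l where "set l \<subseteq> M" "eval l x = y"
proof -
  have "y \<in> (\<lambda>p. eval p x) ` carrier (M[X])"
    using simple_extension_as_eval_img[OF subringE(1)[OF assms(1)] assms(2)] assms(3) by auto
  then obtain p where "p \<in> carrier (M[X])" "eval p x = y" by auto
  then show thesis using that polynomial_incl[of M p] univ_poly_carrier by blast
qed

text \<open>With \<open>M\<close> maximal among the subrings not containing \<open>inv w\<close>, this is the step of Chevalley's
  argument: representations of \<open>inv w\<close> in \<open>M[x]\<close> and in \<open>M[1/x]\<close> cannot both have minimal length.\<close>

lemma shorten_polynomial:
  assumes "subring M R" "x \<in> carrier R" "y \<in> carrier R" "x \<otimes> y = \<one>"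
    and "w \<in> M" "w \<noteq> \<zero>" "inv w \<notin> M"
    and units: "\<And>b. b \<in> M \<Longrightarrow> \<exists>v\<in>M. (\<one> \<ominus> w \<otimes> b) \<otimes> v = \<one>"
    and p: "set p \<subseteq> M" "eval p x = inv w" and q: "set q \<subseteq> M" "eval q y = inv w"
    and len: "length q \<le> length p"
  shows "\<exists>p'. set p' \<subseteq> M \<and> eval p' x = inv w \<and> length p' < length p"
proof -
  note s = subringE[OF assms(1)]
  have wR: "w \<in> carrier R" using s assms by auto
  note iw = nonzero_inv[OF wR assms(6)]
  have "q \<noteq> []" using q iw by auto
  then obtain q' b where q': "q = q' @ [b]" by (metis rev_exhaust)
  then obtain a p1 where p1: "p = a # p1" using len by (cases p) auto
  have qM: "set q' \<subseteq> M" "b \<in> M" "a \<in> M" "set p1 \<subseteq> M" using q p q' p1 by auto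
  have qR: "set q' \<subseteq> carrier R" "b \<in> carrier R" "a \<in> carrier R" "set p1 \<subseteq> carrier R" using qM s(1) by auto
  let ?n = "length p1"
  obtain v where v: "v \<in> M" "(\<one> \<ominus> w \<otimes> b) \<otimes> v = \<one>" using units[OF qM(2)] by auto
  have vR: "v \<in> carrier R" using v s by auto
  have c: "eval q' y \<in> carrier R" "x [^] ?n \<in> carrier R" "eval p1 x \<in> carrier R" using qR assms by (auto simp: eval_in_carrier)
  obtain r where r: "set r \<subseteq> M" "length r = ?n" "eval r x = eval q' y \<otimes> y \<otimes> x [^] ?n"
    using eval_inverse_reverse[OF assms(1) qM(1) _ assms(2-4), of ?n] len q' p1 by auto
  have rR: "set r \<subseteq> carrier R" using r s by auto
  have "eval q' y \<otimes> y \<oplus> b = inv w" using eval_append_aux[OF qR(1,2) assms(3)] q q' by simp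
  then have "w \<otimes> (eval q' y \<otimes> y \<oplus> b) = \<one>" using iw by simp
  moreover have "w \<otimes> (eval q' y \<otimes> y) = w \<otimes> (eval q' y \<otimes> y \<oplus> b) \<ominus> w \<otimes> b" using c wR qR assms(3) by algebra
  ultimately have e1: "w \<otimes> (eval q' y \<otimes> y) = \<one> \<ominus> w \<otimes> b" by simp
  \<comment> \<open>The relation for \<open>q\<close> expresses the unit 1 - w b through negative
    powers of \<open>x\<close>; scaled by x^n it writes x^n as a polynomial of degree below
    \<open>n\<close> over \<open>M\<close>. Substituting this into the leading term of
    \<open>p\<close> saves one coefficient.\<close>
  have "(v \<otimes> w) \<otimes> eval r x = (w \<otimes> (eval q' y \<otimes> y)) \<otimes> v \<otimes> x [^] ?n"
    unfolding r using c wR assms(3) vR by algebra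
  also have "\<dots> = x [^] ?n" using e1 v c by simp
  finally have e2: "(v \<otimes> w) \<otimes> eval r x = x [^] ?n" .
  let ?k = "a \<otimes> (v \<otimes> w)"
  have kR: "?k \<in> carrier R" using qR vR wR by auto
  let ?p = "map2 (\<oplus>) (map (\<lambda>a. ?k \<otimes> a) r) p1"
  have kM: "?k \<in> M" using qM v assms s(6) by auto
  have mR: "set (map (\<lambda>a. ?k \<otimes> a) r) \<subseteq> carrier R" using rR kR by auto
  have mM: "set (map (\<lambda>a. ?k \<otimes> a) r) \<subseteq> M" using r kM s(6) by auto
  have "eval ?p x = ?k \<otimes> eval r x \<oplus> eval p1 x"
    using eval_map2_add[OF _ mR qR(4) assms(2)] r(2) eval_smult[OF kR rR assms(2)] by simp
  also have "?k \<otimes> eval r x = a \<otimes> x [^] ?n" using e2 qR vR wR eval_in_carrier[OF rR assms(2)] by (simp add: m_assoc)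
  finally have "eval ?p x = inv w" using p p1 by simp
  moreover have "set ?p \<subseteq> M"
  proof
    fix z assume "z \<in> set ?p"
    then have "z \<in> (\<lambda>(s, t). s \<oplus> t) ` set (zip (map (\<lambda>a. ?k \<otimes> a) r) p1)" by (simp only: set_map)
    then obtain st where st: "st \<in> set (zip (map (\<lambda>a. ?k \<otimes> a) r) p1)" "z = (case st of (s, t) \<Rightarrow> s \<oplus> t)"
      by (rule imageE)
    obtain s t where "st = (s, t)" by (cases st)
    then have zst: "(s, t) \<in> set (zip (map (\<lambda>a. ?k \<otimes> a) r) p1)" "z = s \<oplus> t" using st by simp_all
    have "s \<in> M" "t \<in> M"
      using set_zip_leftD[OF zst(1)] set_zip_rightD[OF zst(1)] mM qM(4) by blast+
    then show "z \<in> M" unfolding zst(2) by (rule subringE(7)[OF assms(1)])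
  qed
  moreover have "length ?p < length p" using r p1 by simp
  ultimately show ?thesis by blast
qed

text \<open>A subring maximal among those that contain \<open>S\<close> and avoid
  \<open>inv w\<close> is a valuation ring, since adjoining any element outside it produces
  \<open>inv w\<close>. The single non-unit \<open>w\<close> plays the part of the prime ideal in
  Chevalley's theorem.\<close>

lemma valuation_ring_exists:
  assumes "subring S R" "w \<in> S" "w \<noteq> \<zero>" "inv w \<notin> S"
  obtains V where "valued_field R V" "S \<subseteq> V" "inv w \<notin> V"
proof -
  let ?A = "{T. subring T R \<and> S \<subseteq> T \<and> inv w \<notin> T}"
  have "\<exists>M\<in>?A. (\<forall>T\<in>?A. M \<subseteq> T \<longrightarrow> T = M)"
  proof (rule subset_Zorn_nonempty)
    show "?A \<noteq> {}" using assms by auto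
    fix C assume C: "C \<noteq> {}" "subset.chain ?A C"
    have sub: "T \<in> C \<Longrightarrow> subring T R" for T using C unfolding subset_chain_def by auto
    have cmp: "T \<subseteq> T' \<or> T' \<subseteq> T" if "T \<in> C" "T' \<in> C" for T T'
      using C(2) that unfolding subset_chain_def by auto
    have two: "\<exists>T\<in>C. x \<in> T \<and> y \<in> T" if xy: "x \<in> \<Union>C" "y \<in> \<Union>C" for x y
    proof -
      obtain T T' where "T \<in> C" "x \<in> T" "T' \<in> C" "y \<in> T'" using xy by auto
      then show ?thesis using cmp[of T T'] by auto
    qed
    have "subring (\<Union>C) R"
    proof (rule subringI)
      show "\<Union>C \<subseteq> carrier R" using sub subringE(1) by blast
      show "\<one> \<in> \<Union>C" using C sub subringE(3) by blast
      show "\<And>h. h \<in> \<Union>C \<Longrightarrow> \<ominus> h \<in> \<Union>C" using sub subringE(5) by (metis Union_iff)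
      fix h1 h2 assume "h1 \<in> \<Union>C" "h2 \<in> \<Union>C"
      then obtain T where T: "T \<in> C" "h1 \<in> T" "h2 \<in> T" using two by blast
      then show "h1 \<otimes> h2 \<in> \<Union>C" "h1 \<oplus> h2 \<in> \<Union>C"
        using subringE(6)[OF sub[OF T(1)] T(2,3)] subringE(7)[OF sub[OF T(1)] T(2,3)] T(1) by blast+
    qed
    then show "\<Union>C \<in> ?A" using C unfolding subset_chain_def by auto
  qed
  then obtain M where MA: "M \<in> ?A" and M_max: "\<forall>T\<in>?A. M \<subseteq> T \<longrightarrow> T = M" by (elim bexE)
  have M: "subring M R" "S \<subseteq> M" "inv w \<notin> M" using MA by auto
  have max: "T = M" if T: "subring T R" "M \<subseteq> T" "inv w \<notin> T" for T
  proof -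
    have "T \<in> ?A" using M(2) T by auto
    from bspec[OF M_max this] show "T = M" using T(2) by (rule mp)
  qed
  note s = subringE[OF M(1)]
  have wM: "w \<in> M" and wR: "w \<in> carrier R" using assms M s by auto
  note iw = nonzero_inv[OF wR assms(3)]
  have ext: "\<exists>l. set l \<subseteq> M \<and> eval l x = inv w" if x: "x \<in> carrier R" "x \<notin> M" for x
  proof -
    have "inv w \<in> simple_extension M x"
    proof (rule ccontr)
      assume n: "inv w \<notin> simple_extension M x"
      have "simple_extension M x = M"
        by (rule max[OF simple_extension_is_subring[OF M(1) x(1)] simple_extension_incl[OF s(1) x(1)] n])
      then show False using simple_extension_mem[OF M(1) x(1)] x by auto
    qed
    then show ?thesis using simple_extension_evalE[OF M(1) x(1)] by metis
  qed
  \<comment> \<open>If 1/u were missing, \<open>inv w\<close> would be a polynomial in 1/u, so a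
    power of \<open>u\<close> would carry it into \<open>M\<close>. But that power is 1 modulo
    \<open>w\<close> times \<open>M\<close>, hence changes \<open>inv w\<close> only by an element
    of \<open>M\<close>.\<close>
  have units: "\<exists>v\<in>M. (\<one> \<ominus> w \<otimes> b) \<otimes> v = \<one>" if b: "b \<in> M" for b
  proof -
    let ?u = "\<one> \<ominus> w \<otimes> b"
    have bR: "b \<in> carrier R" using b s by auto
    have uR: "?u \<in> carrier R" and uM: "?u \<in> M"
      using wR bR wM b s subring_minus[OF M(1)] by auto
    have "?u \<noteq> \<zero>"
    proof
      assume "?u = \<zero>"
      moreover have "w \<otimes> b = \<one> \<ominus> (\<one> \<ominus> w \<otimes> b)" using wR bR by algebra
      ultimately have "w \<otimes> b = \<one>" by (simp add: a_minus_def)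
      then have "inv w = b" using wR bR comm_inv_char by auto
      then show False using M b by auto
    qed
    note iu = nonzero_inv[OF uR this]
    have "inv ?u \<in> M"
    proof (rule ccontr)
      assume "inv ?u \<notin> M"
      then obtain l where l: "set l \<subseteq> M" "eval l (inv ?u) = inv w" using ext[OF iu(1)] by auto
      have m: "?u [^] length l \<otimes> inv w \<in> M"
        using eval_clear_denominators[OF M(1) l(1) uM iu(1,3)] l by simp
      obtain r where r: "r \<in> M" "?u [^] length l = \<one> \<ominus> w \<otimes> r" using one_minus_pow[OF M(1) wM b] by blast
      have rR: "r \<in> carrier R" using r s by auto
      have "?u [^] length l \<otimes> inv w = inv w \<ominus> (w \<otimes> inv w) \<otimes> r" unfolding r using wR rR iw(1) by algebra
      also have "\<dots> = inv w \<ominus> r" using iw rR by simp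
      finally have "inv w \<ominus> r \<oplus> r \<in> M" using m r s(7) by metis
      moreover have "inv w \<ominus> r \<oplus> r = inv w" using iw(1) rR by algebra
      ultimately show False using M by auto
    qed
    then show ?thesis using iu by auto
  qed
  have tot: "x \<in> M \<or> inv x \<in> M" if x: "x \<in> carrier R" "x \<noteq> \<zero>" for x
  proof (rule ccontr)
    assume n: "\<not> (x \<in> M \<or> inv x \<in> M)"
    note ix = nonzero_inv[OF x]
    \<comment> \<open>Lengths of representations of \<open>inv w\<close> as polynomials in
      \<open>x\<close> and in 1/x over \<open>M\<close>. Both minima are attained, yet the longer of
      the two minimal representations can be shortened.\<close>
    define P where "P z n \<longleftrightarrow> (\<exists>l. set l \<subseteq> M \<and> eval l z = inv w \<and> length l = n)" for z n
    have ex: "\<exists>n. P x n" "\<exists>n. P (inv x) n" using ext[OF x(1)] ext[OF ix(1)] n unfolding P_def by auto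
    let ?n = "LEAST n. P x n" and ?m = "LEAST n. P (inv x) n"
    obtain p where p: "set p \<subseteq> M" "eval p x = inv w" "length p = ?n" using LeastI_ex[OF ex(1)] unfolding P_def by auto
    obtain q where q: "set q \<subseteq> M" "eval q (inv x) = inv w" "length q = ?m" using LeastI_ex[OF ex(2)] unfolding P_def by auto
    show False
    proof (cases "length q \<le> length p")
      case True
      obtain p' where "set p' \<subseteq> M" "eval p' x = inv w" "length p' < length p"
        using shorten_polynomial[OF M(1) x(1) ix(1,3) wM assms(3) M(3) units p(1,2) q(1,2) True] by auto
      then show False using not_less_Least[of "length p'" "P x"] p unfolding P_def by auto
    next
      case False
      then have F: "length p \<le> length q" by auto
      obtain p' where "set p' \<subseteq> M" "eval p' (inv x) = inv w" "length p' < length q"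
        using shorten_polynomial[OF M(1) ix(1) x(1) ix(4) wM assms(3) M(3) units q(1,2) p(1,2) F] by auto
      then show False using not_less_Least[of "length p'" "P (inv x)"] q unfolding P_def by auto
    qed
  qed
  have "valued_field R M"
    by (rule valued_field.intro[OF field_axioms valued_field_axioms.intro[OF M(1) tot]])
  then show thesis using that M(2,3) by blast
qed

end

section \<open>Values attained on a subfield\<close>

context valued_field
begin

lemma exists_min_value:
  assumes "l \<noteq> []" "set l \<subseteq> carrier R"
  shows "\<exists>a\<in>set l. \<forall>b\<in>set l. a \<preceq> b"
  using assms
proof (induction l rule: list_nonempty_induct)
  case (single x)
  then show ?case using vle_refl by auto
next
  case (cons x xs)
  then obtain a where a: "a \<in> set xs" "\<forall>b\<in>set xs. a \<preceq> b" by auto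
  have c: "x \<in> carrier R" "a \<in> carrier R" using a cons.prems by auto
  show ?case
  proof (cases "a \<preceq> x")
    case True
    then show ?thesis using a by auto
  next
    case False
    then have "x \<preceq> a" using vle_total c by auto
    then have "\<forall>b\<in>set xs. x \<preceq> b" using a vle_trans c by blast
    then show ?thesis using vle_refl c by auto
  qed
qed

lemma unit_mult_veq: "\<lbrakk> u \<asymp> \<one>; u \<in> carrier R; x \<in> carrier R \<rbrakk> \<Longrightarrow> u \<otimes> x \<asymp> x"
  using veq_mult[of u \<one> x x] veq_refl by auto

lemma vle_inv_iff:
  assumes "a \<in> carrier R" "b \<in> carrier R" "a \<noteq> \<zero>"
  shows "a \<preceq> b \<longleftrightarrow> inv a \<otimes> b \<in> V"
proof -
  note ia = nonzero_inv[OF assms(1,3)]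
  have b: "b = a \<otimes> (inv a \<otimes> b)" using ia assms by (simp add: m_assoc[symmetric])
  show ?thesis
  proof
    assume "a \<preceq> b"
    then have "a \<otimes> \<one> \<preceq> a \<otimes> (inv a \<otimes> b)" using b assms by simp
    then have "\<one> \<preceq> inv a \<otimes> b" by (rule vle_cancel) (use assms ia in auto)
    then show "inv a \<otimes> b \<in> V" using one_vle_iff ia assms by auto
  next
    assume "inv a \<otimes> b \<in> V"
    then show "a \<preceq> b" unfolding vle_def using b m_comm assms ia(1) by (metis m_closed)
  qed
qed

text \<open>Scaling by the coefficient \<open>k\<close> of least value makes the list primitive and
  collects the rest in one constant u = b k^2. The distinct residues of \<open>G\<close> force
  \<open>u\<close> to be a unit. Then 1 + c^2 \<gamma> has the value of m^2 with m = l0(\<gamma>),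
  and it remains to find an element of \<open>E\<close> with the value of \<open>m\<close>.\<close>

lemma even_value:
  assumes E: "subfield E R"
    and G: "finite G" "G \<subseteq> V" "\<And>g h. \<lbrakk> g \<in> G; h \<in> G; g \<noteq> h \<rbrakk> \<Longrightarrow> g \<ominus> h \<asymp> \<one>" "2 \<le> card G"
    and gam: "\<gamma> \<in> G"
    and c: "c \<in> E" "c \<asymp> \<one>"
    and rep: "b \<in> E" "set l \<subseteq> E" "length l \<le> card G"
      "\<And>g. g \<in> G \<Longrightarrow> \<one> \<oplus> c \<otimes> c \<otimes> g = b \<otimes> (eval l g \<otimes> eval l g)"
    and w: "small (\<one> \<oplus> c \<otimes> c \<otimes> \<gamma>)" "\<one> \<oplus> c \<otimes> c \<otimes> \<gamma> \<noteq> \<zero>"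
  shows "\<exists>e\<in>E. \<one> \<oplus> c \<otimes> c \<otimes> \<gamma> \<asymp> e \<otimes> e"
proof -
  note sE = subringE[OF subfieldE(1)[OF E]]
  note sV = subringE[OF subring]
  have GR: "g \<in> carrier R" if "g \<in> G" for g using that G(2) sV(1) by blast
  have cR: "c \<in> carrier R" and bR: "b \<in> carrier R" and lR: "set l \<subseteq> carrier R"
    using sE(1) c rep by auto
  have cnz: "c \<noteq> \<zero>" using veq_zero[OF c(2)] by simp
  have ccu: "c \<otimes> c \<asymp> \<one>" using veq_mult[OF c(2) c(2)] cR by simp
  have evR: "eval l g \<in> carrier R" if "g \<in> G" for g using eval_in_carrier lR GR that by blast
  let ?W = "\<lambda>g. \<one> \<oplus> c \<otimes> c \<otimes> g"
  have nz: "eval l \<gamma> \<noteq> \<zero>" "b \<noteq> \<zero>" using rep(4)[OF gam] w(2) bR evR[OF gam] by auto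
  have "l \<noteq> []" using nz by auto
  then obtain k where k: "k \<in> set l" "\<forall>a\<in>set l. k \<preceq> a" using exists_min_value[OF _ lR] by blast
  have kR: "k \<in> carrier R" using k lR by blast
  have kE: "k \<in> E" using k rep by blast
  have knz: "k \<noteq> \<zero>"
  proof
    assume "k = \<zero>"
    then have "\<forall>a\<in>set l. a = \<zero>" using k zero_vle by auto
    then have "l = replicate (length l) \<zero>" by (simp add: replicate_length_same)
    then have "eval l \<gamma> = \<zero>" using eval_replicate_zero GR[OF gam] by metis
    then show False using nz by simp
  qed
  note ik = nonzero_inv[OF kR knz]
  have ikE: "inv k \<in> E" using subfield_m_inv(1)[OF E, of k] kE knz by auto
  define l0 where "l0 = map (\<lambda>a. inv k \<otimes> a) l"
  have l0V: "set l0 \<subseteq> V" unfolding l0_def using k vle_inv_iff[OF kR _ knz] lR by auto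
  have l0E: "set l0 \<subseteq> E" unfolding l0_def using ikE rep(2) sE(6) by auto
  have l0len: "length l0 \<le> card G" unfolding l0_def using rep by simp
  have one_l0: "\<one> \<in> set l0" unfolding l0_def using k(1) ik(4) by (auto simp: image_iff) (metis)
  have l0R: "set l0 \<subseteq> carrier R" using l0E sE(1) by blast
  have ev0R: "eval l0 g \<in> carrier R" if "g \<in> G" for g using eval_in_carrier l0R GR that by blast
  have ev0: "eval l g = k \<otimes> eval l0 g" if "g \<in> G" for g
    unfolding l0_def using eval_smult[OF ik(1) lR GR[OF that]] ik kR evR[OF that] by (simp add: m_assoc[symmetric])
  define u where "u = b \<otimes> (k \<otimes> k)"
  have uE: "u \<in> E" unfolding u_def using rep(1) kE sE(6) by auto
  have uR: "u \<in> carrier R" unfolding u_def using bR kR by auto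
  have unz: "u \<noteq> \<zero>" unfolding u_def using nz knz bR kR by (simp add: integral_iff)
  note iu = nonzero_inv[OF uR unz]
  have rep0: "?W g = u \<otimes> (eval l0 g \<otimes> eval l0 g)" if "g \<in> G" for g
  proof -
    have "b \<otimes> ((k \<otimes> eval l0 g) \<otimes> (k \<otimes> eval l0 g)) = u \<otimes> (eval l0 g \<otimes> eval l0 g)"
      unfolding u_def using bR kR ev0R[OF that] by algebra
    then show ?thesis using rep(4)[OF that] ev0[OF that] by simp
  qed
  have WV: "?W g \<in> V" if "g \<in> G" for g
    using sV(3,6,7) unit_V[OF ccu] cR G(2) that by auto
  have ev0V: "eval l0 g \<in> V" if "g \<in> G" for g
    using subring_eval[OF subring l0V] G(2) that by blast
  \<comment> \<open>A small \<open>u\<close> would make 1 + c^2 g small at all points of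
    \<open>G\<close>, so two of them would have the same residue.\<close>
  have "\<not> small u"
  proof
    assume su: "small u"
    have sW: "small (?W g)" if "g \<in> G" for g
      unfolding rep0[OF that] using small_mult[OF su] ev0V[OF that] sV(6) by blast
    obtain g where g: "g \<in> G" "g \<noteq> \<gamma>"
    proof (rule ccontr)
      assume "\<not> thesis"
      then have "G \<subseteq> {\<gamma>}" using that by blast
      then have "card G \<le> 1" using card_mono[of "{\<gamma>}" G] by simp
      then show False using G(4) by simp
    qed
    have "?W g \<ominus> ?W \<gamma> = (c \<otimes> c) \<otimes> (g \<ominus> \<gamma>)" using cR GR[OF g(1)] GR[OF gam] by algebra
    moreover have "(c \<otimes> c) \<otimes> (g \<ominus> \<gamma>) \<asymp> \<one> \<otimes> \<one>"
      using veq_mult[OF ccu G(3)[OF g(1) gam g(2)]] cR GR[OF g(1)] GR[OF gam] by simp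
    ultimately show False using veq_one_small[of "?W g \<ominus> ?W \<gamma>"] small_minus[OF sW[OF g(1)] w(1)] by simp
  qed
  \<comment> \<open>If 1/u were small, the primitive list would take small values on all of
    \<open>G\<close>, against its coefficient 1.\<close>
  moreover have "\<not> small (inv u)"
  proof
    assume su: "small (inv u)"
    have "small (eval l0 g)" if g: "g \<in> G" for g
    proof -
      have "inv u \<otimes> ?W g = (inv u \<otimes> u) \<otimes> (eval l0 g \<otimes> eval l0 g)"
        unfolding rep0[OF g] using uR iu(1) ev0R[OF g] by algebra
      then have "small (eval l0 g \<otimes> eval l0 g)" using small_mult[OF su WV[OF g]] iu ev0R[OF g] by simp
      then show ?thesis using small_square ev0R[OF g] by blast
    qed
    then have "small \<one>" using small_coeffs[OF G(1-3) l0V l0len] one_l0 by blast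
    then show False using veq_one_small veq_refl by blast
  qed
  moreover have "u \<in> V \<or> inv u \<in> V" using total uR unz by blast
  ultimately have uu: "u \<asymp> \<one>"
    using not_small_iff[of u] not_small_iff[of "inv u"] unit_inv[of "inv u"] iu(1,5) by auto
  define m where "m = eval l0 \<gamma>"
  have mR: "m \<in> carrier R" unfolding m_def using ev0R[OF gam] .
  have wm: "?W \<gamma> = u \<otimes> (m \<otimes> m)" unfolding m_def by (rule rep0[OF gam])
  have wmeq: "?W \<gamma> \<asymp> m \<otimes> m" unfolding wm using unit_mult_veq[OF uu uR] mR by simp
  have "small (m \<otimes> m)" using small_vle[OF w(1)] wmeq mR unfolding veq_def by simp
  then have sm: "small m" using small_square mR by blast
  have icE: "inv c \<in> E" using subfield_m_inv(1)[OF E, of c] c(1) cnz by auto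
  note ic = nonzero_inv[OF cR cnz]
  have icu: "inv c \<asymp> \<one>" using unit_inv c(2) cR by blast
  have icV: "inv c \<in> V" using unit_V[OF icu ic(1)] .
  \<comment> \<open>Modulo the maximal ideal, \<open>\<gamma>\<close> agrees with the element \<open>- 1 / c\<^sup>2\<close> of \<open>E\<close>. The difference is a multiple
    of \<open>m\<^sup>2\<close>, so replacing \<open>\<gamma>\<close> by this element does not change the value of \<open>m\<close>.\<close>
  define s where "s = \<ominus> (inv c \<otimes> inv c)"
  have sEm: "s \<in> E" unfolding s_def using icE sE(5,6) by auto
  have sVm: "s \<in> V" unfolding s_def using icV sV(5,6) by auto
  have sR: "s \<in> carrier R" using sVm sV(1) by blast
  obtain q where q1: "length q = length l0 - 1" "set q \<subseteq> V"
     and q2: "\<forall>x\<in>carrier R. eval l0 x = (x \<ominus> s) \<otimes> eval q x \<oplus> eval l0 s"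
    using eval_horner_quotient[OF l0V subring sVm] by (elim exE conjE)
  define z where "z = eval q \<gamma>"
  have zV: "z \<in> V" unfolding z_def using subring_eval[OF subring q1(2)] gam G(2) by blast
  have zR: "z \<in> carrier R" using zV sV(1) by blast
  define e where "e = eval l0 s"
  have eE: "e \<in> E" unfolding e_def using subring_eval[OF subfieldE(1)[OF E] l0E sEm] .
  have eR: "e \<in> carrier R" using eE sE(1) by blast
  have gR: "\<gamma> \<in> carrier R" using GR[OF gam] .
  have m1: "m = (\<gamma> \<ominus> s) \<otimes> z \<oplus> e" unfolding m_def z_def e_def using q2 gR by blast
  have gs: "\<gamma> \<ominus> s = inv c \<otimes> inv c \<otimes> ?W \<gamma>"
  proof -
    have "inv c \<otimes> inv c \<otimes> ?W \<gamma> = inv c \<otimes> inv c \<oplus> (inv c \<otimes> c) \<otimes> (inv c \<otimes> c) \<otimes> \<gamma>"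
      using ic(1) cR gR by algebra
    also have "\<dots> = \<gamma> \<ominus> s" unfolding s_def using ic gR by (simp add: a_minus_def a_comm)
    finally show ?thesis by simp
  qed
  define v where "v = \<ominus> (inv c \<otimes> inv c \<otimes> u \<otimes> z)"
  have vV: "v \<in> V" unfolding v_def using icV unit_V[OF uu uR] zV sV(5,6) by auto
  have vR: "v \<in> carrier R" using vV sV(1) by blast
  have "e = m \<ominus> (\<gamma> \<ominus> s) \<otimes> z" unfolding m1 using gR sR zR eR by algebra
  also have "\<dots> = m \<ominus> (inv c \<otimes> inv c \<otimes> (u \<otimes> (m \<otimes> m))) \<otimes> z" unfolding gs wm ..
  also have "\<dots> = (\<one> \<oplus> m \<otimes> v) \<otimes> m"
    unfolding v_def using ic(1) uR zR mR by algebra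
  finally have em: "e = (\<one> \<oplus> m \<otimes> v) \<otimes> m" .
  have "\<one> \<oplus> m \<otimes> v \<asymp> \<one>" using unit_add_small[OF veq_refl small_mult[OF sm vV]] by simp
  then have "e \<asymp> m" unfolding em using unit_mult_veq mR vR by simp
  then have "e \<otimes> e \<asymp> m \<otimes> m" using veq_mult eR mR by blast
  then have "?W \<gamma> \<asymp> e \<otimes> e" using veq_trans[OF wmeq veq_sym] cR gR eR by simp
  then show ?thesis using eE by blast
qed

text \<open>Strict case of the ultrametric inequality; \<open>\<not> y \<preceq> x\<close> says that
  \<open>y\<close> has strictly larger value than \<open>x\<close>.\<close>

lemma veq_add_dominant:
  assumes "x \<in> carrier R" "y \<in> carrier R" "\<not> y \<preceq> x"
  shows "y \<oplus> x \<asymp> x"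
proof -
  have xy: "x \<preceq> y" using vle_total assms by blast
  have 1: "x \<preceq> y \<oplus> x" using vle_add[OF xy vle_refl] assms by blast
  have "y \<oplus> x \<preceq> x"
  proof (rule ccontr)
    assume n: "\<not> y \<oplus> x \<preceq> x"
    have "y \<preceq> y \<oplus> x \<or> y \<oplus> x \<preceq> y" using vle_total assms by blast
    then show False
    proof
      assume "y \<preceq> y \<oplus> x"
      then have "y \<preceq> (y \<oplus> x) \<ominus> y" using vle_minus vle_refl assms by blast
      moreover have "(y \<oplus> x) \<ominus> y = x" using assms by algebra
      ultimately show False using assms by simp
    next
      assume "y \<oplus> x \<preceq> y"
      then have "y \<oplus> x \<preceq> (y \<oplus> x) \<ominus> y" using vle_minus vle_refl assms by blast
      moreover have "(y \<oplus> x) \<ominus> y = x" using assms by algebra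
      ultimately show False using n by simp
    qed
  qed
  then show ?thesis using 1 unfolding veq_def by blast
qed

text \<open>Replacing \<open>c\<close> by \<open>c + d\<close> changes \<open>1 + c\<^sup>2 \<gamma>\<close> by \<open>d\<close> times a unit, so by \<open>even\<close> every \<open>d\<close> of positive but
  smaller value has the value of a square, and square roots can be extracted forever. The exponent \<open>D\<close> lets \<open>p\<close>
  uniformize a subfield over which \<open>E\<close> has degree \<open>D\<close>.\<close>

lemma not_all_values_even:
  assumes E: "subfield E R" and g: "\<gamma> \<in> carrier R" "\<gamma> \<asymp> \<one>" and two: "\<one> \<oplus> \<one> \<asymp> \<one>"
    and c: "c \<in> E" "c \<asymp> \<one>" "small (\<one> \<oplus> c \<otimes> c \<otimes> \<gamma>)"
    and nz: "\<And>c. c \<in> E \<Longrightarrow> \<one> \<oplus> c \<otimes> c \<otimes> \<gamma> \<noteq> \<zero>"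
    and even: "\<And>c. \<lbrakk> c \<in> E; c \<asymp> \<one>; small (\<one> \<oplus> c \<otimes> c \<otimes> \<gamma>) \<rbrakk> \<Longrightarrow> \<exists>e\<in>E. \<one> \<oplus> c \<otimes> c \<otimes> \<gamma> \<asymp> e \<otimes> e"
    and p: "p \<in> carrier R"
    and low: "\<And>e. \<lbrakk> e \<in> E; e \<noteq> \<zero>; small e \<rbrakk> \<Longrightarrow> p \<preceq> e [^] (D::nat)"
    and high: "\<And>e. \<lbrakk> e \<in> E; e \<noteq> \<zero> \<rbrakk> \<Longrightarrow> \<exists>N::nat. \<not> p [^] N \<preceq> e [^] D"
  shows False
proof -
  note sE = subringE[OF subfieldE(1)[OF E]]
  have cR: "c \<in> carrier R" using c sE by blast
  define w where "w = \<one> \<oplus> c \<otimes> c \<otimes> \<gamma>"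
  have wR: "w \<in> carrier R" unfolding w_def using cR g by simp
  have wnz: "w \<noteq> \<zero>" unfolding w_def using nz c by blast
  have ws: "small w" unfolding w_def using c by blast
  have root: "small e" if "small d" "d \<asymp> e \<otimes> e" "e \<in> carrier R" for d e
    using that small_vle[of d "e \<otimes> e"] small_square[of e] unfolding veq_def by blast
  have sq_vle: "e \<preceq> e \<otimes> e" if "small e" for e
    using that small_in_V unfolding vle_def by blast
  have step: "\<exists>e\<in>E. e \<noteq> \<zero> \<and> small e \<and> d \<asymp> e \<otimes> e \<and> \<not> w \<preceq> e"
    if d: "d \<in> E" "d \<noteq> \<zero>" "small d" "\<not> w \<preceq> d" for d
  proof -
    have dR: "d \<in> carrier R" using d sE by blast
    have c': "c \<oplus> d \<in> E" "c \<oplus> d \<asymp> \<one>" using c d sE(7) unit_add_small cR by auto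
    let ?t = "((\<one> \<oplus> \<one>) \<otimes> c \<oplus> d) \<otimes> \<gamma>"
    have tR: "?t \<in> carrier R" using cR dR g by simp
    have "(\<one> \<oplus> \<one>) \<otimes> c \<asymp> \<one> \<otimes> \<one>" using veq_mult[OF two c(2)] cR by simp
    then have "(\<one> \<oplus> \<one>) \<otimes> c \<oplus> d \<asymp> \<one>" using unit_add_small d(3) cR by simp
    then have "?t \<asymp> \<one> \<otimes> \<one>" using veq_mult[OF _ g(2)] cR dR g by simp
    then have td: "?t \<otimes> d \<asymp> d" using unit_mult_veq tR dR by simp
    \<comment> \<open>The increment is (2 c + d) d \<gamma>, and 2 c + d is a unit because 2 and
      \<open>c\<close> are. Since \<open>d\<close> has smaller value than \<open>w\<close>, the
      increment dominates the sum.\<close>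
    have eq: "\<one> \<oplus> (c \<oplus> d) \<otimes> (c \<oplus> d) \<otimes> \<gamma> = w \<oplus> ?t \<otimes> d"
      unfolding w_def using cR dR g by algebra
    have "\<not> w \<preceq> ?t \<otimes> d" using td d(4) vle_trans wR tR dR unfolding veq_def by blast
    then have "w \<oplus> ?t \<otimes> d \<asymp> ?t \<otimes> d" using veq_add_dominant wR tR dR by simp
    then have wd: "w \<oplus> ?t \<otimes> d \<asymp> d" using veq_trans td wR tR dR by (metis a_closed m_closed)
    have sm: "small (w \<oplus> ?t \<otimes> d)" using small_vle[OF d(3)] wd wR tR dR unfolding veq_def by simp
    obtain e where e: "e \<in> E" "w \<oplus> ?t \<otimes> d \<asymp> e \<otimes> e" using even[OF c'] sm unfolding eq by blast
    have eR: "e \<in> carrier R" using e sE by blast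
    have de: "d \<asymp> e \<otimes> e" using veq_trans[OF veq_sym[OF wd] e(2)] dR eR by simp
    have "e \<noteq> \<zero>" using veq_zero[OF de] d(2) by auto
    moreover have se: "small e" using root[OF d(3) de eR] .
    moreover have "\<not> w \<preceq> e"
    proof
      assume "w \<preceq> e"
      then have "w \<preceq> e \<otimes> e" using vle_trans sq_vle[OF se] wR by blast
      then show False using vle_trans d(4) de wR unfolding veq_def by blast
    qed
    ultimately show ?thesis using e de by blast
  qed
  \<comment> \<open>\<open>w\<close> involves \<gamma>, but its value is that of a square of
    \<open>E\<close>. The root \<open>e1\<close> starts the descent, with value strictly between 0
    and that of \<open>w\<close>.\<close>
  obtain e1 where e1: "e1 \<in> E" "w \<asymp> e1 \<otimes> e1" using even[OF c(1-3)] unfolding w_def by blast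
  have e1R: "e1 \<in> carrier R" using e1 sE by blast
  have e1nz: "e1 \<noteq> \<zero>" using veq_zero[OF e1(2)] wnz by auto
  have e1s: "small e1" using root[OF ws e1(2) e1R] .
  have e1w: "\<not> w \<preceq> e1"
  proof
    assume "w \<preceq> e1"
    then have "e1 \<otimes> e1 \<preceq> e1 \<otimes> \<one>" using vle_trans e1 e1R unfolding veq_def by (metis m_closed r_one)
    then have "e1 \<preceq> \<one>" using vle_cancel e1R e1nz by blast
    then show False using e1s unfolding small_def by blast
  qed
  define P where "P N \<longleftrightarrow> (\<exists>d\<in>E. d \<noteq> \<zero> \<and> small d \<and> \<not> w \<preceq> d \<and> \<not> p [^] N \<preceq> d [^] D)" for N :: nat
  have "\<exists>N. P N" using high[OF e1(1) e1nz] e1 e1nz e1s e1w unfolding P_def by blast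
  define N where "N = (LEAST N. P N)"
  have PN: "P N" unfolding N_def using LeastI_ex[OF \<open>\<exists>N. P N\<close>] .
  then obtain d where d: "d \<in> E" "d \<noteq> \<zero>" "small d" "\<not> w \<preceq> d" "\<not> p [^] N \<preceq> d [^] D" unfolding P_def by blast
  have dR: "d \<in> carrier R" using d sE by blast
  have "N \<noteq> 0"
  proof
    assume "N = 0"
    moreover have "d [^] D \<in> V" using subring_pow[OF subring small_in_V[OF d(3)]] .
    ultimately show False using d(5) one_vle_iff dR by simp
  qed
  then obtain M where M: "N = Suc M" by (cases N) auto
  have "\<not> P M" using not_less_Least[of M P] M unfolding N_def by simp
  obtain e where e: "e \<in> E" "e \<noteq> \<zero>" "small e" "d \<asymp> e \<otimes> e" "\<not> w \<preceq> e" using step[OF d(1-4)] by blast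
  have eR: "e \<in> carrier R" using e sE by blast
  \<comment> \<open>Minimality of \<open>N\<close> bounds D v(e) below by M v(p), and
    \<open>low\<close> bounds it below by v(p). Adding, N v(p) <= 2 D v(e) = D v(d), contrary to the
    choice of \<open>d\<close>.\<close>
  have "p [^] M \<preceq> e [^] D" using \<open>\<not> P M\<close> e unfolding P_def by blast
  then have "p [^] M \<otimes> p \<preceq> e [^] D \<otimes> e [^] D" using vle_mult low[OF e(1-3)] p by simp
  also have "e [^] D \<otimes> e [^] D = (e \<otimes> e) [^] D" using eR by (simp add: nat_pow_distrib)
  finally have "p [^] N \<preceq> (e \<otimes> e) [^] D" using M p by simp
  moreover have "(e \<otimes> e) [^] D \<preceq> d [^] D" using vle_pow e(4) eR unfolding veq_def by simp
  ultimately show False using d(5) vle_trans p by blast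
qed

end

section \<open>Valuation rings containing a given polynomial ring\<close>

lemma (in domain) nat_pow_nonzero: "\<lbrakk> x \<in> carrier R; x \<noteq> \<zero> \<rbrakk> \<Longrightarrow> x [^] (n::nat) \<noteq> \<zero>"
  by (induction n) (auto simp: integral_iff)

context valued_field
begin

lemma vle_carrier: "\<lbrakk> x \<preceq> y; x \<in> carrier R \<rbrakk> \<Longrightarrow> y \<in> carrier R"
  unfolding vle_def using V_carrier by auto

lemma pow_vle_pow: "\<lbrakk> z \<preceq> \<one>; z \<in> carrier R; m \<le> n \<rbrakk> \<Longrightarrow> z [^] (n::nat) \<preceq> z [^] m"
proof -
  assume z: "z \<preceq> \<one>" "z \<in> carrier R" "m \<le> n"
  have "z [^] m \<otimes> z [^] (n - m) \<preceq> z [^] m \<otimes> \<one> [^] (n - m)"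
    using z by (intro vle_mult vle_pow vle_refl) auto
  then show ?thesis using z by (simp add: nat_pow_mult)
qed

text \<open>For \<open>z\<close> of value at most 0 the highest power has the least value, so the
  bound uses \<open>n\<close>, the largest exponent that can occur.\<close>

lemma eval_lower_bound:
  assumes "\<forall>a\<in>set q. b \<preceq> a" "b \<in> carrier R" "z \<preceq> \<one>" "z \<in> carrier R" "length q \<le> Suc n"
  shows "b \<otimes> z [^] n \<preceq> eval q z"
  using assms(1,5)
proof (induction q)
  case Nil
  then show ?case using vle_zero assms by simp
next
  case (Cons a q)
  have aR: "b \<preceq> a" using Cons by simp
  have "z [^] n \<preceq> z [^] length q" using pow_vle_pow assms Cons.prems by simp
  then have "b \<otimes> z [^] n \<preceq> a \<otimes> z [^] length q" using vle_mult aR assms by simp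
  then show ?case using vle_add Cons assms by simp
qed

text \<open>The leading term is minus the rest, and the rest has at least the value of b z^n, where
  \<open>n\<close> is one less than the leading exponent. Cancelling z^n leaves c z.\<close>

lemma root_lower_bound:
  assumes "\<forall>a\<in>set q. b \<preceq> a" "b \<in> carrier R" "b \<preceq> \<one>" "z \<in> carrier R" "z \<noteq> \<zero>"
    and "c \<in> carrier R" "c \<noteq> \<zero>" "eval (c # q) z = \<zero>"
    and zb: "z \<preceq> b"
  shows "b \<preceq> c \<otimes> z"
proof -
  have z1: "z \<preceq> \<one>" using vle_trans zb assms by blast
  have qR: "set q \<subseteq> carrier R" using assms(1,2) vle_carrier by blast
  have e: "c \<otimes> z [^] length q \<oplus> eval q z = \<zero>" using assms by simp
  have eR: "eval q z \<in> carrier R" using eval_in_carrier qR assms by blast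
  have "q \<noteq> []"
  proof
    assume "q = []"
    then show False using e assms by simp
  qed
  then obtain n where n: "length q = Suc n" by (cases q) auto
  have "b \<otimes> z [^] n \<preceq> eval q z" using eval_lower_bound assms z1 n by simp
  then have "b \<otimes> z [^] n \<preceq> \<ominus> eval q z" using vle_a_inv assms by simp
  also have "\<ominus> eval q z = c \<otimes> z [^] length q" using e eR assms
    by (metis m_closed minus_equality nat_pow_closed)
  finally have "z [^] n \<otimes> b \<preceq> z [^] n \<otimes> (c \<otimes> z)" using n assms by (simp add: m_ac)
  then show ?thesis using vle_cancel assms by (simp add: nat_pow_nonzero)
qed

text \<open>Multiplying a root by the leading coefficient makes it integral, and valuation rings are
  integrally closed.\<close>

lemma denominator_clears:
  assumes "set (c # q) \<subseteq> V" "z \<in> carrier R" "c \<noteq> \<zero>" "eval (c # q) z = \<zero>"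
  shows "c \<otimes> z \<in> V"
proof (cases "z \<in> V")
  case True
  then show ?thesis using assms subringE(6)[OF subring] by auto
next
  case False
  then have "\<not> \<one> \<preceq> z" using one_vle_iff assms by simp
  then have "z \<preceq> \<one>" using vle_total assms by blast
  moreover have "z \<noteq> \<zero>" using False subringE(2)[OF subring] by auto
  moreover have "\<forall>a\<in>set q. \<one> \<preceq> a" using assms one_vle_iff V_carrier by auto
  ultimately have "\<one> \<preceq> c \<otimes> z" using root_lower_bound[of q \<one> z c] assms V_carrier vle_refl by auto
  then show ?thesis using one_vle_iff assms V_carrier by auto
qed

text \<open>At a pole \<open>x\<close> of a valuation trivial on \<open>K\<close> the leading term
  has the least value, so it determines the value of the sum.\<close>

lemma eval_large:
  assumes K: "subfield K R" "K \<subseteq> V" and x: "x \<in> carrier R" "x \<notin> V" and l: "set l \<subseteq> K" and nz: "eval l x \<noteq> \<zero>"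
  shows "eval l x \<preceq> \<one>"
  using l nz
proof (induction l)
  case Nil
  then show ?case by simp
next
  case (Cons a l)
  have nx: "\<not> \<one> \<preceq> x" using one_vle_iff x by simp
  then have x1: "x \<preceq> \<one>" using vle_total x by blast
  have xnz: "x \<noteq> \<zero>" using nx vle_zero by auto
  have aK: "a \<in> K" "set l \<subseteq> K" using Cons by auto
  have aR: "a \<in> carrier R" "set l \<subseteq> carrier R" using aK K(2) V_carrier by auto
  have eR: "eval l x \<in> carrier R" using eval_in_carrier aR x by blast
  show ?case
  proof (cases "a = \<zero>")
    case True
    then show ?thesis using Cons x eR by simp
  next
    case False
    have "inv a \<in> K" using subfield_m_inv(1)[OF K(1), of a] aK False by auto
    then have au: "a \<asymp> \<one>" using unit_iff_inv_V[OF aR(1) False] aK K(2) by auto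
    let ?n = "length l"
    have axR: "a \<otimes> x [^] ?n \<in> carrier R" using aR x by simp
    have ax1: "a \<otimes> x [^] ?n \<preceq> \<one>"
      using vle_mult[of a \<one> "x [^] ?n" "\<one> [^] ?n"] vle_pow[OF x1] au aR x unfolding veq_def by simp
    have "\<not> eval l x \<preceq> a \<otimes> x [^] ?n"
    proof (cases l)
      case Nil
      then have "eval l x = \<zero>" by simp
      then show ?thesis using zero_vle[of "a \<otimes> x [^] ?n"] False aR x Nil by auto
    next
      case (Cons b l')
      then obtain n where n: "length l = Suc n" by simp
      have "\<forall>b\<in>set l. \<one> \<preceq> b" using aK K(2) one_vle_iff V_carrier by auto
      then have xe: "x [^] n \<preceq> eval l x" using eval_lower_bound[of l \<one> x n] x1 x n by simp
      show ?thesis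
      proof
        assume "eval l x \<preceq> a \<otimes> x [^] ?n"
        then have "x [^] n \<preceq> a \<otimes> x [^] ?n" using vle_trans xe x by blast
        also have "a \<otimes> x [^] ?n = x [^] n \<otimes> (a \<otimes> x)" using n aR x by (simp add: m_ac)
        finally have "x [^] n \<otimes> \<one> \<preceq> x [^] n \<otimes> (a \<otimes> x)" using x by simp
        then have ax: "\<one> \<preceq> a \<otimes> x" by (rule vle_cancel) (use aR x xnz nat_pow_nonzero in auto)
        have "a \<otimes> x \<preceq> x" using unit_mult_veq[OF au] aR x unfolding veq_def by simp
        then show False using ax nx vle_trans by blast
      qed
    qed
    then have "eval l x \<oplus> a \<otimes> x [^] ?n \<asymp> a \<otimes> x [^] ?n" using veq_add_dominant axR eR by blast
    moreover have "eval (a # l) x = eval l x \<oplus> a \<otimes> x [^] ?n" using axR eR by (simp add: a_comm)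
    moreover have "eval l x \<oplus> a \<otimes> x [^] ?n \<preceq> \<one>"
      using vle_trans[OF _ ax1] calculation(1) a_closed[OF eR axR] unfolding veq_def by blast
    ultimately show ?thesis by metis
  qed
qed

end

section \<open>Simultaneous integrality and the choice of the valuation\<close>

context field
begin

text \<open>Algebraicity over the fraction field of a ring \<open>S\<close>, with denominators
  already cleared.\<close>

definition root_over :: "'a set \<Rightarrow> 'a \<Rightarrow> bool" where
  "root_over S z \<longleftrightarrow> (\<exists>c q. set (c # q) \<subseteq> S \<and> c \<noteq> \<zero> \<and> eval (c # q) z = \<zero>)"

text \<open>The product of the leading coefficients works. It has to be found before the valuation
  ring, which is later chosen in terms of it; hence the quantifier over \<open>V\<close> stands
  inside.\<close>

lemma common_denominator:
  assumes S: "subring S R" and Z: "finite Z" "Z \<subseteq> carrier R" "\<And>z. z \<in> Z \<Longrightarrow> root_over S z"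
  shows "\<exists>d\<in>S. d \<noteq> \<zero> \<and> (\<forall>V. valued_field R V \<longrightarrow> S \<subseteq> V \<longrightarrow> (\<forall>z\<in>Z. d \<otimes> z \<in> V))"
  using Z
proof (induction Z)
  case empty
  then show ?case using subringE(3)[OF S] one_not_zero by blast
next
  case (insert z Z)
  have SR: "S \<subseteq> carrier R" using subringE[OF S] by auto
  obtain d where d: "d \<in> S" "d \<noteq> \<zero>" "\<forall>V. valued_field R V \<longrightarrow> S \<subseteq> V \<longrightarrow> (\<forall>z\<in>Z. d \<otimes> z \<in> V)"
    using insert by auto
  obtain c q where c: "set (c # q) \<subseteq> S" "c \<noteq> \<zero>" "eval (c # q) z = \<zero>"
    using insert.prems(2) unfolding root_over_def by blast
  have cS: "c \<in> S" using c by auto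
  have zR: "z \<in> carrier R" using insert by auto
  have "d \<otimes> c \<otimes> x \<in> V" if V: "valued_field R V" "S \<subseteq> V" and x: "x \<in> insert z Z" for V x
  proof -
    interpret V: valued_field R V by fact
    have xR: "x \<in> carrier R" using x insert by auto
    have dcR: "d \<in> carrier R" "c \<in> carrier R" "d \<in> V" "c \<in> V" using d cS SR V by auto
    show ?thesis
    proof (cases "x = z")
      case True
      have "c \<otimes> z \<in> V" using V.denominator_clears[OF _ zR c(2,3)] c(1) V by auto
      then have "d \<otimes> (c \<otimes> z) \<in> V" using subringE(6)[OF V.subring] dcR by auto
      then show ?thesis using True dcR xR by (simp add: m_assoc)
    next
      case False
      then have "d \<otimes> x \<in> V" using d(3) V x by blast
      then have "c \<otimes> (d \<otimes> x) \<in> V" using subringE(6)[OF V.subring] dcR by auto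
      then show ?thesis using dcR xR by (simp add: m_ac)
    qed
  qed
  moreover have "d \<otimes> c \<in> S" using subringE(6)[OF S] d cS by auto
  moreover have "d \<otimes> c \<noteq> \<zero>" using d c cS SR by (auto simp: integral_iff subset_iff)
  ultimately show ?case by blast
qed

text \<open>\<open>N\<close> exceeds the degrees in \<open>t\<close> of all coefficients of a
  relation for \<open>z\<close>, so \<open>root_lower_bound\<close> applies with b = t^N. The
  leading coefficient has value at most 0 at a pole of \<open>t\<close>, so removing it only raises
  the value. Again the constant is uniform in \<open>V\<close>.\<close>

lemma pole_order_bound:
  assumes K: "subfield K R" and t: "t \<in> carrier R" and z: "z \<in> carrier R" "root_over (simple_extension K t) z"
  shows "\<exists>N::nat. \<forall>V. valued_field R V \<longrightarrow> K \<subseteq> V \<longrightarrow> t \<notin> V \<longrightarrow> valued_field.vle R V (t [^] N) z"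
proof -
  note sK = subfieldE(1)[OF K]
  obtain c q where c: "set (c # q) \<subseteq> simple_extension K t" "c \<noteq> \<zero>" "eval (c # q) z = \<zero>"
    using z unfolding root_over_def by blast
  have "\<forall>a. \<exists>l. a \<in> simple_extension K t \<longrightarrow> set l \<subseteq> K \<and> eval l t = a"
    using simple_extension_evalE[OF sK t] by metis
  then obtain L where L: "\<And>a. a \<in> simple_extension K t \<Longrightarrow> set (L a) \<subseteq> K \<and> eval (L a) t = a" by metis
  define N where "N = Max (length ` L ` set (c # q))"
  have len: "length (L a) \<le> N" if "a \<in> set (c # q)" for a
    unfolding N_def using that by (intro Max_ge) auto
  have "valued_field.vle R V (t [^] N) z" if V: "valued_field R V" "K \<subseteq> V" "t \<notin> V" for V
  proof -
    interpret V: valued_field R V by fact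
    have "\<not> V.vle \<one> t" using V.one_vle_iff t V by simp
    then have t1: "V.vle t \<one>" using V.vle_total t by blast
    have b: "V.vle (t [^] N) a" if a: "a \<in> set (c # q)" for a
    proof -
      have La: "set (L a) \<subseteq> K" "eval (L a) t = a" using L a c by auto
      have "\<forall>b\<in>set (L a). V.vle \<one> b" using La V V.one_vle_iff V.V_carrier by auto
      then have "V.vle (\<one> \<otimes> t [^] N) (eval (L a) t)" using V.eval_lower_bound[of "L a" \<one> t N] t1 t len[OF a] by simp
      then show ?thesis using La t by simp
    qed
    have cR: "c \<in> carrier R" using V.vle_carrier b[of c] t by simp
    have tN1: "V.vle (t [^] N) \<one>" using V.vle_pow[OF t1 t, of N] by simp
    show ?thesis
    proof (cases "V.vle z (t [^] N)")
      case True
      show ?thesis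
      proof (cases "z = \<zero>")
        case True
        then show ?thesis using V.vle_zero t by simp
      next
        case False
        have "V.vle (t [^] N) (c \<otimes> z)"
          using V.root_lower_bound[of q "t [^] N" z c] b tN1 t z False cR c True by auto
        moreover have "V.vle c \<one>"
          using V.eval_large[OF K V(2) t V(3), of "L c"] L[of c] c by auto
        then have "V.vle (c \<otimes> z) (\<one> \<otimes> z)" using V.vle_mult[OF _ V.vle_refl[OF z(1)] cR z(1)] by blast
        ultimately show ?thesis using V.vle_trans t z by (metis l_one nat_pow_closed)
      qed
    next
      case False
      then show ?thesis using V.vle_total z t by blast
    qed
  qed
  then show ?thesis by blast
qed

text \<open>Multiplying t = l(1/t) by a power of \<open>t\<close> would give a monic equation for
  \<open>t\<close> over \<open>K\<close>. With Chevalley's theorem this provides a pole of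
  \<open>t\<close>: a valuation ring that contains K[1/t] but not \<open>t\<close>.\<close>

lemma transcendental_no_inverse:
  assumes K: "subfield K R" and t: "t \<in> carrier R" "transcendental K t"
  shows "t \<noteq> \<zero>" "t \<notin> simple_extension K (inv t)"
proof -
  note sK = subringE[OF subfieldE(1)[OF K]]
  show tnz: "t \<noteq> \<zero>" using t zero_is_algebraic[OF subfieldE(1)[OF K]] by (auto simp: over_def)
  note it = nonzero_inv[OF t(1) tnz]
  show "t \<notin> simple_extension K (inv t)"
  proof
    assume "t \<in> simple_extension K (inv t)"
    then obtain l where l: "set l \<subseteq> K" "eval l (inv t) = t"
      using simple_extension_evalE[OF subfieldE(1)[OF K] it(1)] by metis
    let ?n = "length l"
    obtain r where r: "set r \<subseteq> K" "length r = ?n" "eval r t = eval l (inv t) \<otimes> inv t \<otimes> t [^] ?n"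
      using eval_inverse_reverse[OF subfieldE(1)[OF K] l(1) le_refl t(1) it(1,3)] by blast
    have rR: "set r \<subseteq> carrier R" using r sK by auto
    have er: "eval r t = t [^] ?n" using r l it t by simp
    let ?p = "\<one> # map (\<lambda>a. (\<ominus> \<one>) \<otimes> a) r"
    have "eval ?p t = t [^] ?n \<oplus> (\<ominus> \<one>) \<otimes> eval r t"
      using eval_smult[of "\<ominus> \<one>" r t] rR t r(2) by simp
    then have "eval ?p t = \<zero>" unfolding er using t by (simp add: l_minus r_neg)
    moreover have "set ?p \<subseteq> K" using r sK by auto
    then have "?p \<in> carrier (K[X])" using one_not_zero by (auto simp: univ_poly_carrier[symmetric] polynomial_def)
    ultimately have "(algebraic over K) t" using algebraicI[of ?p K t] by auto
    then show False using t(2) unfolding over_def by simp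
  qed
qed

text \<open>With w = 1 + c^2 \<gamma>, the wanted ring contains K[w] and has \<open>w\<close> in its
  maximal ideal. It exists as soon as \<open>w\<close> has a pole, and making every pole of
  \<open>t\<close> a pole of \<open>w\<close> also puts \<open>t\<close>, and with it K[t], into the
  ring.\<close>

lemma exists_adapted_valuation:
  assumes K: "subfield K R" and t: "t \<in> carrier R" "transcendental K t"
    and Z: "finite Z" "Z \<subseteq> carrier R" "\<And>z. z \<in> Z \<Longrightarrow> root_over (simple_extension K t) z"
    and g: "\<gamma> \<in> Z" "inv \<gamma> \<in> Z" "\<gamma> \<noteq> \<zero>"
    and nz: "\<And>c. c \<in> simple_extension K t \<Longrightarrow> \<one> \<oplus> c \<otimes> c \<otimes> \<gamma> \<noteq> \<zero>"
  shows "\<exists>c\<in>simple_extension K t. \<exists>V. valued_field R V \<and> simple_extension K t \<subseteq> V \<and> K \<subseteq> V \<and> Z \<subseteq> V \<and>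
    valued_field.veq R V c \<one> \<and> valued_field.veq R V \<gamma> \<one> \<and> valued_field.small R V (\<one> \<oplus> c \<otimes> c \<otimes> \<gamma>)"
proof -
  note sK = subringE[OF subfieldE(1)[OF K]]
  let ?S = "simple_extension K t"
  have S: "subring ?S R" using simple_extension_is_subring[OF subfieldE(1)[OF K] t(1)] .
  note sS = subringE[OF S]
  have KS: "K \<subseteq> ?S" using simple_extension_incl[OF sK(1) t(1)] .
  have tS: "t \<in> ?S" using simple_extension_mem[OF subfieldE(1)[OF K] t(1)] .
  have gR: "\<gamma> \<in> carrier R" using g Z by auto
  note ig = nonzero_inv[OF gR g(3)]
  obtain d where d: "d \<in> ?S" "d \<noteq> \<zero>" "\<And>V. \<lbrakk> valued_field R V; ?S \<subseteq> V \<rbrakk> \<Longrightarrow> \<forall>z\<in>Z. d \<otimes> z \<in> V"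
    using common_denominator[OF S Z] by blast
  have dR: "d \<in> carrier R" using d sS by auto
  obtain N :: nat where N: "\<And>V. \<lbrakk> valued_field R V; K \<subseteq> V; t \<notin> V \<rbrakk> \<Longrightarrow> valued_field.vle R V (t [^] N) (inv \<gamma>)"
    using pole_order_bound[OF K t(1) ig(1) Z(3)[OF g(2)]] by blast
  \<comment> \<open>The power of \<open>t\<close> makes every pole of \<open>t\<close> a pole of \<open>w = 1 + c\<^sup>2 \<gamma>\<close>; the factor \<open>d\<close> makes the elements of
    \<open>Z\<close> integral wherever \<open>w\<close> vanishes, since \<open>d\<close> is a unit there.\<close>
  define c where "c = d \<otimes> t [^] Suc N"
  have cS: "c \<in> ?S" unfolding c_def using sS(6)[OF d(1) subring_pow[OF S tS]] .
  have cR: "c \<in> carrier R" using cS sS by auto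
  define w where "w = \<one> \<oplus> c \<otimes> c \<otimes> \<gamma>"
  have wR: "w \<in> carrier R" and wnz: "w \<noteq> \<zero>" unfolding w_def using cR gR nz[OF cS] by auto
  note iw = nonzero_inv[OF wR wnz]
  \<comment> \<open>At a pole of \<open>t\<close>, v(d) <= 0 and v(\<gamma>) + N v(t) <= 0, so c^2
    \<gamma> = d^2 t^(2 N + 2) \<gamma> has value at most v(t) < 0.\<close>
  have inf: "w \<notin> V" if V: "valued_field R V" "K \<subseteq> V" "t \<notin> V" for V
  proof
    assume wV: "w \<in> V"
    interpret V: valued_field R V by fact
    have nt: "\<not> V.vle \<one> t" using V.one_vle_iff t V by simp
    then have t1: "V.vle t \<one>" using V.vle_total t by blast
    have "c \<otimes> c \<otimes> \<gamma> = w \<ominus> \<one>" unfolding w_def using cR gR by algebra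
    then have "c \<otimes> c \<otimes> \<gamma> \<in> V" using subring_minus[OF V.subring wV] subringE(3)[OF V.subring] by simp
    then have 1: "V.vle \<one> (c \<otimes> c \<otimes> \<gamma>)" using V.one_vle_iff cR gR by simp
    obtain l where l: "set l \<subseteq> K" "eval l t = d" using simple_extension_evalE[OF subfieldE(1)[OF K] t(1) d(1)] by metis
    have d1: "V.vle d \<one>" using V.eval_large[OF K V(2) t(1) V(3) l(1)] l(2) d(2) by simp
    have "V.vle (\<gamma> \<otimes> t [^] N) (\<gamma> \<otimes> inv \<gamma>)" using N[OF V] V.vle_mult V.vle_refl gR t by simp
    then have 2: "V.vle (\<gamma> \<otimes> t [^] N) \<one>" using ig by simp
    have 3: "V.vle (d \<otimes> (d \<otimes> t [^] (Suc N))) (\<one> \<otimes> (\<one> \<otimes> t))"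
    proof (intro V.vle_mult d1)
      show "V.vle (t [^] Suc N) t" using V.pow_vle_pow[OF t1 t(1), of 1 "Suc N"] t by simp
    qed (use dR t in auto)
    have "V.vle ((\<gamma> \<otimes> t [^] N) \<otimes> (d \<otimes> (d \<otimes> t [^] (Suc N)))) (\<one> \<otimes> (\<one> \<otimes> (\<one> \<otimes> t)))"
      by (intro V.vle_mult 2 3) (use dR t gR in auto)
    then have 4: "V.vle ((\<gamma> \<otimes> t [^] N) \<otimes> (d \<otimes> (d \<otimes> t [^] (Suc N)))) t"
      using t(1) by simp
    have 5: "V.vle (c \<otimes> c \<otimes> \<gamma>) ((\<gamma> \<otimes> t [^] N) \<otimes> (d \<otimes> (d \<otimes> t [^] (Suc N))))"
    proof -
      have "c \<otimes> c \<otimes> \<gamma> = t \<otimes> ((\<gamma> \<otimes> t [^] N) \<otimes> (d \<otimes> (d \<otimes> t [^] (Suc N))))"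
        unfolding c_def nat_pow_Suc using dR t gR nat_pow_closed[OF t(1), of N] by algebra
      moreover have "V.vle (t \<otimes> ((\<gamma> \<otimes> t [^] N) \<otimes> (d \<otimes> (d \<otimes> t [^] (Suc N))))) (\<one> \<otimes> ((\<gamma> \<otimes> t [^] N) \<otimes> (d \<otimes> (d \<otimes> t [^] (Suc N)))))"
        by (intro V.vle_mult V.vle_refl t1) (use dR t gR in auto)
      ultimately show ?thesis using dR t gR by simp
    qed
    have "c \<otimes> c \<otimes> \<gamma> \<in> carrier R" using cR gR by simp
    then have "V.vle (c \<otimes> c \<otimes> \<gamma>) t" by (rule V.vle_trans[OF 5 4])
    then show False using V.vle_trans[OF 1] nt by blast
  qed
  \<comment> \<open>\<open>t\<close> has a pole because it is transcendental, and there
    \<open>w\<close> has negative value. A polynomial expression of 1/w in \<open>w\<close> would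
    have value at most 0 there, but 1/w has positive value.\<close>
  have "inv w \<notin> simple_extension K w"
  proof
    assume "inv w \<in> simple_extension K w"
    then obtain l where l: "set l \<subseteq> K" "eval l w = inv w" using simple_extension_evalE[OF subfieldE(1)[OF K] wR] by metis
    have itR: "inv t \<in> carrier R" "inv t \<noteq> \<zero>" "inv (inv t) = t"
      using nonzero_inv[OF t(1) transcendental_no_inverse(1)[OF K t]] by auto
    obtain V where V: "valued_field R V" "simple_extension K (inv t) \<subseteq> V" "t \<notin> V"
      using valuation_ring_exists[OF simple_extension_is_subring[OF subfieldE(1)[OF K] itR(1)]
          simple_extension_mem[OF subfieldE(1)[OF K] itR(1)] itR(2)] transcendental_no_inverse(2)[OF K t] itR(3) by metis
    have KV: "K \<subseteq> V" using simple_extension_incl[OF sK(1) itR(1)] V(2) by auto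
    have wV: "w \<notin> V" using inf V KV by blast
    interpret V: valued_field R V by fact
    have "V.vle (inv w) \<one>" using V.eval_large[OF K KV wR wV l(1)] l(2) iw by simp
    then have "V.vle (w \<otimes> inv w) (w \<otimes> \<one>)" using V.vle_mult V.vle_refl wR iw by blast
    then have "V.vle \<one> w" using iw wR by simp
    then show False using V.one_vle_iff wR wV by simp
  qed
  then obtain V where V: "valued_field R V" "simple_extension K w \<subseteq> V" "inv w \<notin> V"
    using valuation_ring_exists[OF simple_extension_is_subring[OF subfieldE(1)[OF K] wR]
          simple_extension_mem[OF subfieldE(1)[OF K] wR] wnz] by metis
  interpret V: valued_field R V by fact
  note sV = subringE[OF V.subring]
  have KV: "K \<subseteq> V" using simple_extension_incl[OF sK(1) wR] V(2) by auto
  have wV: "w \<in> V" using simple_extension_mem[OF subfieldE(1)[OF K] wR] V(2) by auto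
  have tV: "t \<in> V" using inf[OF V(1) KV] wV by blast
  have SV: "?S \<subseteq> V" using simple_extension_subring_incl[OF V.subring KV tV] .
  have ws: "V.small w" using V.not_small_iff[OF wV] V.unit_iff_inv_V[OF wR wnz] V(3) by blast
  have dZ: "\<forall>z\<in>Z. d \<otimes> z \<in> V" using d(3)[OF V(1) SV] .
  have dV: "d \<in> V" using d SV by auto
  \<comment> \<open>\<gamma> is not yet known to be integral, but d \<gamma> is. A small
    \<open>d\<close> would therefore make c^2 \<gamma> small, and 1 = w - c^2 \<gamma> with
    it.\<close>
  have "\<not> V.small d"
  proof
    assume sd: "V.small d"
    have "c \<otimes> c \<otimes> \<gamma> = d \<otimes> (t [^] Suc N \<otimes> t [^] Suc N \<otimes> (d \<otimes> \<gamma>))"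
      unfolding c_def using dR gR nat_pow_closed[OF t(1), of "Suc N"] by algebra
    moreover have "t [^] Suc N \<otimes> t [^] Suc N \<otimes> (d \<otimes> \<gamma>) \<in> V"
      using sV(6) subring_pow[OF V.subring tV, of "Suc N"] dZ g by blast
    ultimately have "V.small (c \<otimes> c \<otimes> \<gamma>)" using V.small_mult[OF sd] by simp
    then have "V.small (w \<ominus> c \<otimes> c \<otimes> \<gamma>)" using V.small_minus ws by blast
    moreover have "w \<ominus> c \<otimes> c \<otimes> \<gamma> = \<one>" unfolding w_def using cR gR by algebra
    ultimately show False using V.veq_one_small[OF V.veq_refl[OF one_closed]] by simp
  qed
  then have idV: "inv d \<in> V" using V.not_small_iff[OF dV] V.unit_iff_inv_V[OF dR d(2)] by blast
  have ZV: "Z \<subseteq> V"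
  proof
    fix z assume z: "z \<in> Z"
    then have zR: "z \<in> carrier R" using Z by auto
    have "inv d \<otimes> (d \<otimes> z) \<in> V" using sV(6)[OF idV] dZ z by blast
    then show "z \<in> V" using nonzero_inv[OF dR d(2)] dR zR by (simp add: m_assoc[symmetric])
  qed
  have gu: "V.veq \<gamma> \<one>" using V.unit_iff_inv_V[OF gR g(3)] ZV g by blast
  have cV: "c \<in> V" using cS SV by auto
  have "\<not> V.small c"
  proof
    assume "V.small c"
    then have "V.small (c \<otimes> (c \<otimes> \<gamma>))" using V.small_mult sV(6) cV ZV g by blast
    then have "V.small (w \<ominus> c \<otimes> (c \<otimes> \<gamma>))" using V.small_minus ws by blast
    moreover have "w \<ominus> c \<otimes> (c \<otimes> \<gamma>) = \<one>" unfolding w_def using cR gR by algebra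
    ultimately show False using V.veq_one_small[OF V.veq_refl[OF one_closed]] by simp
  qed
  then have cu: "V.veq c \<one>" using V.not_small_iff[OF cV] by blast
  have "valued_field R V \<and> ?S \<subseteq> V \<and> K \<subseteq> V \<and> Z \<subseteq> V \<and>
    V.veq c \<one> \<and> V.veq \<gamma> \<one> \<and> V.small (\<one> \<oplus> c \<otimes> c \<otimes> \<gamma>)"
    using V(1) SV KV ZV cu gu ws unfolding w_def by blast
  then show ?thesis using cS by blast
qed

section \<open>Discreteness on finite extensions of a rational function field\<close>

text \<open>The elements \<open>x\<close> with b x = a for some nonzero \<open>b\<close> form a
  subfield that contains \<open>K\<close> and \<open>t\<close>; the equation avoids
  division.\<close>

lemma generate_field_fractions:
  assumes K: "subfield K R" and t: "t \<in> carrier R" and x: "x \<in> generate_field R (insert t K)"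
  shows "\<exists>a\<in>simple_extension K t. \<exists>b\<in>simple_extension K t. b \<noteq> \<zero> \<and> b \<otimes> x = a"
proof -
  note sK = subringE[OF subfieldE(1)[OF K]]
  let ?S = "simple_extension K t"
  have S: "subring ?S R" using simple_extension_is_subring[OF subfieldE(1)[OF K] t] .
  note sS = subringE[OF S]
  define F where "F = {x \<in> carrier R. \<exists>a\<in>?S. \<exists>b\<in>?S. b \<noteq> \<zero> \<and> b \<otimes> x = a}"
  have FI: "x \<in> F" if "x \<in> carrier R" "b \<in> ?S" "b \<noteq> \<zero>" "b \<otimes> x \<in> ?S" for x b
    unfolding F_def using that by blast
  have FE: "\<exists>b\<in>?S. b \<noteq> \<zero> \<and> b \<otimes> x \<in> ?S" if "x \<in> F" for x
    using that unfolding F_def by blast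
  have FR: "F \<subseteq> carrier R" unfolding F_def by blast
  have SF: "?S \<subseteq> F"
  proof
    fix x assume x: "x \<in> ?S"
    then have "x \<in> carrier R" using sS(1) by blast
    then show "x \<in> F" using FI[of x \<one>] x sS(3) one_not_zero by simp
  qed
  have sub: "subring F R"
  proof (rule subringI)
    show "F \<subseteq> carrier R" by (rule FR)
    show "\<one> \<in> F" using SF sS(3) by blast
  next
    fix h assume h: "h \<in> F"
    then obtain b where b: "b \<in> ?S" "b \<noteq> \<zero>" "b \<otimes> h \<in> ?S" using FE by blast
    have hR: "h \<in> carrier R" "b \<in> carrier R" using h FR b sS(1) by blast+
    have "b \<otimes> (\<ominus> h) \<in> ?S" using sS(5)[OF b(3)] hR by (simp add: r_minus)
    then show "\<ominus> h \<in> F" using FI[of "\<ominus> h" b] b hR by simp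
  next
    fix x y assume xy: "x \<in> F" "y \<in> F"
    then obtain b c where b: "b \<in> ?S" "b \<noteq> \<zero>" "b \<otimes> x \<in> ?S" and c: "c \<in> ?S" "c \<noteq> \<zero>" "c \<otimes> y \<in> ?S" using FE by metis
    have R: "x \<in> carrier R" "y \<in> carrier R" "b \<in> carrier R" "c \<in> carrier R" using xy FR b c sS(1) by blast+
    have bc: "b \<otimes> c \<in> ?S" "b \<otimes> c \<noteq> \<zero>" using sS(6) b c R by (auto simp: integral_iff)
    have "b \<otimes> c \<otimes> (x \<otimes> y) = (b \<otimes> x) \<otimes> (c \<otimes> y)" using R by algebra
    then show "x \<otimes> y \<in> F" using FI[of "x \<otimes> y" "b \<otimes> c"] bc R sS(6)[OF b(3) c(3)] by simp
    have "b \<otimes> c \<otimes> (x \<oplus> y) = c \<otimes> (b \<otimes> x) \<oplus> b \<otimes> (c \<otimes> y)" using R by algebra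
    then show "x \<oplus> y \<in> F" using FI[of "x \<oplus> y" "b \<otimes> c"] bc R sS(7)[OF sS(6)[OF c(1) b(3)] sS(6)[OF b(1) c(3)]] by simp
  qed
  have "subfield F R"
  proof (rule subfieldI'[OF sub])
    fix x assume x: "x \<in> F - {\<zero>}"
    then obtain b where b: "b \<in> ?S" "b \<noteq> \<zero>" "b \<otimes> x \<in> ?S" using FE by blast
    have R: "x \<in> carrier R" "b \<in> carrier R" "x \<noteq> \<zero>" using x FR b sS(1) by blast+
    note ix = nonzero_inv[OF R(1,3)]
    have "b \<otimes> x \<otimes> inv x = b" using R ix by (simp add: m_assoc)
    then show "inv x \<in> F" using FI[OF ix(1) b(3)] b(1,2) R by (simp add: integral_iff)
  qed
  moreover have "insert t K \<subseteq> F"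
    using SF simple_extension_incl[OF sK(1) t] simple_extension_mem[OF subfieldE(1)[OF K] t] by blast
  ultimately have "generate_field R (insert t K) \<subseteq> F"
    using generate_field_min_subfield1[of "insert t K"] FR by blast
  then show ?thesis using x unfolding F_def by blast
qed

lemma clear_denominators:
  assumes S: "subring S R" and q: "set q \<subseteq> carrier R" "\<And>x. x \<in> set q \<Longrightarrow> \<exists>a\<in>S. \<exists>b\<in>S. b \<noteq> \<zero> \<and> b \<otimes> x = a"
  shows "\<exists>d\<in>S. d \<noteq> \<zero> \<and> (\<forall>x\<in>set q. d \<otimes> x \<in> S)"
  using q
proof (induction q)
  case Nil
  then show ?case using one_not_zero by (intro bexI[of _ \<one>] subringE(3)[OF S]) auto
next
  case (Cons x q)
  note sS = subringE[OF S]
  obtain d where d: "d \<in> S" "d \<noteq> \<zero>" "\<forall>x\<in>set q. d \<otimes> x \<in> S" using Cons by auto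
  obtain b where b: "b \<in> S" "b \<noteq> \<zero>" "b \<otimes> x \<in> S" using Cons.prems(2)[of x] by auto
  have R: "d \<in> carrier R" "b \<in> carrier R" "x \<in> carrier R" using d b sS(1) Cons.prems by auto
  have "d \<otimes> b \<otimes> y \<in> S" if y: "y \<in> set (x # q)" for y
  proof (cases "y = x")
    case True
    then show ?thesis using sS(6)[OF d(1) b(3)] R by (simp add: m_assoc)
  next
    case False
    then have "y \<in> carrier R" "d \<otimes> y \<in> S" using y d Cons.prems by auto
    then show ?thesis using sS(6)[OF b(1), of "d \<otimes> y"] R by (simp add: m_ac)
  qed
  moreover have "d \<otimes> b \<in> S" "d \<otimes> b \<noteq> \<zero>" using sS(6) d b R by (auto simp: integral_iff)
  ultimately show ?case by blast
qed

text \<open>The D + 1 powers 1, e, ..., e^D are dependent. The length is fixed and leading zeros are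
  allowed, so every exponent is at most \<open>D\<close>, uniformly in \<open>e\<close>.\<close>

lemma dimension_relation:
  assumes F: "subfield F R" "dimension D F E" and E: "subring E R" and e: "e \<in> E"
  obtains q where "set q \<subseteq> F" "length q = Suc D" "eval q e = \<zero>" "\<exists>a\<in>set q. a \<noteq> \<zero>"
proof -
  have eR: "e \<in> carrier R" using e subringE(1)[OF E] by blast
  let ?U = "exp_base e (Suc D)"
  have len: "length ?U = Suc D" unfolding exp_base_def by simp
  have UE: "set ?U \<subseteq> E" unfolding exp_base_def using subring_pow[OF E e] by auto
  have "\<not> independent F ?U"
    using independent_length_le_dimension[OF F(1,2) _ UE] len by auto
  then obtain q where q: "length q = length ?U" "combine q ?U = \<zero>" "set q \<subseteq> F" "set q \<noteq> {\<zero>}"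
    using dependent_imp_non_trivial_combine[OF F(1) exp_base_closed[OF eR]] by blast
  have "eval q e = \<zero>" using combine_eq_eval[of q e] q(1,2) len by simp
  moreover have "\<exists>a\<in>set q. a \<noteq> \<zero>"
  proof -
    have "set q \<noteq> {}" using q(1) len by auto
    then show ?thesis using q(4) by (metis equals0I insertCI singleton_iff subsetI subset_antisym empty_subsetI insert_subset ex_in_conv)
  qed
  ultimately show thesis using that q len by simp
qed

lemma integral_dimension_relation:
  assumes K: "subfield K R" and t: "t \<in> carrier R"
    and dim: "dimension D (generate_field R (insert t K)) E" and E: "subring E R" and e: "e \<in> E"
  obtains q where "set q \<subseteq> simple_extension K t" "length q = Suc D" "eval q e = \<zero>" "\<exists>a\<in>set q. a \<noteq> \<zero>"
proof -
  note sK = subringE[OF subfieldE(1)[OF K]]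
  have tK: "insert t K \<subseteq> carrier R" using t sK by auto
  let ?S = "simple_extension K t"
  have S: "subring ?S R" using simple_extension_is_subring[OF subfieldE(1)[OF K] t] .
  note sS = subringE[OF S]
  have eR: "e \<in> carrier R" using e subringE(1)[OF E] by blast
  obtain q where q: "set q \<subseteq> generate_field R (insert t K)" "length q = Suc D" "eval q e = \<zero>" "\<exists>a\<in>set q. a \<noteq> \<zero>"
    using dimension_relation[OF generate_field_is_subfield[OF tK] dim E e] by blast
  have qR: "set q \<subseteq> carrier R" using q(1) generate_field_in_carrier[OF tK] by blast
  have "\<exists>d\<in>?S. d \<noteq> \<zero> \<and> (\<forall>x\<in>set q. d \<otimes> x \<in> ?S)"
    by (rule clear_denominators[OF S qR]) (use generate_field_fractions[OF K t] q(1) in blast)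
  then obtain d where d: "d \<in> ?S" "d \<noteq> \<zero>" "\<forall>x\<in>set q. d \<otimes> x \<in> ?S" by blast
  have dR: "d \<in> carrier R" using d sS by blast
  let ?q = "map (\<lambda>a. d \<otimes> a) q"
  have "eval ?q e = \<zero>" using eval_smult[OF dR qR eR] q(3) dR by simp
  moreover have "set ?q \<subseteq> ?S" using d by auto
  moreover have "\<exists>a\<in>set ?q. a \<noteq> \<zero>"
  proof -
    obtain a where a: "a \<in> set q" "a \<noteq> \<zero>" using q by blast
    then have "d \<otimes> a \<noteq> \<zero>" using d dR qR by (auto simp: integral_iff)
    then show ?thesis using a by auto
  qed
  moreover have "length ?q = Suc D" using q(2) by simp
  ultimately show thesis using that by blast
qed

lemma strip_leading_zeros:
  assumes "eval q x = \<zero>" "\<exists>a\<in>set q. a \<noteq> \<zero>" "set q \<subseteq> carrier R" "x \<in> carrier R"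
  shows "\<exists>c q'. set (c # q') \<subseteq> set q \<and> c \<noteq> \<zero> \<and> eval (c # q') x = \<zero>"
  using assms
proof (induction q)
  case Nil
  then show ?case by simp
next
  case (Cons a q)
  show ?case
  proof (cases "a = \<zero>")
    case True
    then have "eval q x = \<zero>" using Cons.prems eval_in_carrier[of q x] by simp
    then have "\<exists>c q'. set (c # q') \<subseteq> set q \<and> c \<noteq> \<zero> \<and> eval (c # q') x = \<zero>"
      using Cons True by auto
    then show ?thesis by (metis set_subset_Cons subset_trans)
  next
    case False
    then show ?thesis using Cons.prems by blast
  qed
qed

end

context valued_field
begin

text \<open>\<open>p\<close> is the value at \<open>t\<close> of a shortest polynomial over
  \<open>K\<close> with small nonzero value; it generates the prime ideal that the maximal ideal
  cuts out in K[t]. Euclidean division strips off factors \<open>p\<close> until a unit is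
  left.\<close>

lemma exists_uniformizer:
  assumes K: "subfield K R" "K \<subseteq> V" and t: "t \<in> V" "transcendental K t"
    and s0: "s0 \<in> simple_extension K t" "s0 \<noteq> \<zero>" "small s0"
  shows "\<exists>p\<in>carrier R. p \<noteq> \<zero> \<and> small p \<and> (\<forall>s\<in>simple_extension K t. s \<noteq> \<zero> \<longrightarrow> (\<exists>r::nat. s \<asymp> p [^] r))"
proof -
  note sK = subringE[OF subfieldE(1)[OF K(1)]]
  have tR: "t \<in> carrier R" using t V_carrier by blast
  define P where "P n \<longleftrightarrow> (\<exists>l. set l \<subseteq> K \<and> length l = n \<and> eval l t \<noteq> \<zero> \<and> small (eval l t))" for n
  obtain l1 where "set l1 \<subseteq> K" "eval l1 t = s0" using simple_extension_evalE[OF subfieldE(1)[OF K(1)] tR s0(1)] .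
  then have "\<exists>n. P n" using s0 unfolding P_def by blast
  define n where "n = (LEAST n. P n)"
  have "P n" unfolding n_def using LeastI_ex[OF \<open>\<exists>n. P n\<close>] .
  then obtain l0 where l0: "set l0 \<subseteq> K" "length l0 = n" "eval l0 t \<noteq> \<zero>" "small (eval l0 t)" unfolding P_def by blast
  have min: "eval l t = \<zero>" if "set l \<subseteq> K" "length l < n" "small (eval l t)" for l
    using not_less_Least[of "length l" P] that unfolding P_def n_def by blast
  have KR: "K \<subseteq> carrier R" using sK(1) .
  have poly: "polynomial K (normalize l)" "eval (normalize l) t = eval l t" "length (normalize l) \<le> length l" if "set l \<subseteq> K" for l
    using normalize_gives_polynomial[OF that] eval_normalize[OF _ tR] that KR normalize_length_le by auto
  define m where "m = normalize l0"
  have m: "polynomial K m" "eval m t = eval l0 t" "length m \<le> n" unfolding m_def using poly[OF l0(1)] l0(2) by auto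
  have mnil: "m \<noteq> []" using m(2) l0(3) by auto
  have mK: "set m \<subseteq> K" using polynomial_incl m by blast
  define p where "p = eval m t"
  have pR: "p \<in> carrier R" unfolding p_def using eval_in_carrier mK KR tR by blast
  have p: "p \<noteq> \<zero>" "small p" unfolding p_def using m l0 by auto
  \<comment> \<open>Nonzero constants are units, so \<open>m\<close> has positive degree and each
    division by it shortens the list.\<close>
  have deg: "2 \<le> length m"
  proof (rule ccontr)
    assume "\<not> 2 \<le> length m"
    then obtain a where a: "m = [a]" using mnil by (cases m; cases "tl m") auto
    have aK: "a \<in> K" "a \<noteq> \<zero>" using a m mK unfolding polynomial_def by auto
    have aR: "a \<in> carrier R" using aK KR by blast
    have "inv a \<in> V" using subfield_m_inv(1)[OF K(1), of a] aK K(2) by auto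
    then have "a \<asymp> \<one>" using unit_iff_inv_V[OF aR aK(2)] aK K(2) by blast
    moreover have "p = a" unfolding p_def a using aR by simp
    ultimately show False using p veq_one_small by blast
  qed
  have hom: "(\<lambda>p. eval p t) \<in> ring_hom (K[X]) R" using eval_is_hom[OF subfieldE(1)[OF K(1)] tR] .
  have main: "\<exists>r::nat. eval l t \<asymp> p [^] r" if "set l \<subseteq> K" "eval l t \<noteq> \<zero>" for l
    using that
  proof (induction "length l" arbitrary: l rule: less_induct)
    case less
    have elV: "eval l t \<in> V" using subring_eval[OF subring _ t(1)] less.prems K(2) by blast
    show ?case
    proof (cases "small (eval l t)")
      case False
      then have "eval l t \<asymp> p [^] (0::nat)" using not_small_iff[OF elV] by simp
      then show ?thesis by blast
    next
      case True
      let ?l = "normalize l"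
      obtain q r where qr: "polynomial K q" "polynomial K r" "?l = (m \<otimes>\<^bsub>K[X]\<^esub> q) \<oplus>\<^bsub>K[X]\<^esub> r" "r = [] \<or> degree r < degree m"
        using field_long_division_theorem[OF K(1) poly(1)[OF less.prems(1)] m(1) mnil] by blast
      have c: "m \<in> carrier (K[X])" "q \<in> carrier (K[X])" "r \<in> carrier (K[X])" using m qr univ_poly_carrier by blast+
      have set: "set q \<subseteq> K" "set r \<subseteq> K" using qr polynomial_incl by blast+
      have R: "eval q t \<in> carrier R" "eval r t \<in> carrier R" using eval_in_carrier set KR tR by blast+
      have V: "eval q t \<in> V" using subring_eval[OF subring _ t(1)] set K(2) by blast
      interpret UP: ring "K[X]" using univ_poly_is_ring[OF subfieldE(1)[OF K(1)]] .
      have e1: "eval l t = p \<otimes> eval q t \<oplus> eval r t"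
        using poly(2)[OF less.prems(1)] qr(3) ring_hom_add[OF hom UP.m_closed[OF c(1,2)] c(3)] ring_hom_mult[OF hom c(1,2)] p_def by simp
      have "eval r t = eval l t \<ominus> p \<otimes> eval q t" unfolding e1 using R pR by algebra
      then have "small (eval r t)" using small_minus[OF True small_mult[OF p(2) V]] by simp
      moreover have "length r < n" using qr(4) m(3) deg by auto
      \<comment> \<open>The remainder is below the minimal length and has small value, so it
        vanishes at \<open>t\<close>; transcendence then makes it the zero polynomial.\<close>
      ultimately have er: "eval r t = \<zero>" using min[OF set(2)] by blast
      have rn: "r = []"
        using t(2) c(3) er eval_transcendental[of K t r] unfolding over_def by blast
      have lq: "?l = poly_mult m q"
        using qr(3) rn c UP.m_closed[OF c(1,2)] UP.r_zero by (simp add: univ_poly_mult univ_poly_zero)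
      have e2: "eval l t = p \<otimes> eval q t" using e1 er R pR by simp
      have qnz: "eval q t \<noteq> \<zero>" using e2 less.prems(2) pR by auto
      then have qnil: "q \<noteq> []" by auto
      have "degree ?l = degree m + degree q"
        unfolding lq using poly_mult_degree_eq[OF subfieldE(1)[OF K(1)] m(1) qr(1)] mnil qnil by simp
      then have "length q < length ?l" using deg qnil by (cases q) auto
      then have "length q < length l" using poly(3)[OF less.prems(1)] by simp
      then obtain r where r: "eval q t \<asymp> p [^] (r::nat)" using less.hyps set(1) qnz by blast
      have "p \<otimes> eval q t \<asymp> p \<otimes> p [^] r" using veq_mult[OF veq_refl r] R pR by simp
      then have "eval l t \<asymp> p [^] Suc r" unfolding e2 using pR by (simp add: m_comm)
      then show ?thesis by blast
    qed
  qed
  have "\<exists>r::nat. s \<asymp> p [^] r" if s: "s \<in> simple_extension K t" "s \<noteq> \<zero>" for s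
  proof -
    obtain l where "set l \<subseteq> K" "eval l t = s" using simple_extension_evalE[OF subfieldE(1)[OF K(1)] tR s(1)] .
    then show ?thesis using main[of l] s by blast
  qed
  then show ?thesis using pR p by blast
qed

text \<open>An ultrametric alternative, by induction that adds the leading term last. Either the new
  term and a dominant earlier one have equal value, which gives a z^k and b equal value with
  \<open>k\<close> the difference of the exponents, or a single term has the value of the whole sum.
  At a nonzero root the latter is impossible.\<close>

lemma relation_values:
  assumes "set q \<subseteq> carrier R" "z \<in> carrier R" "z \<noteq> \<zero>"
  shows "(\<forall>a\<in>set q. a = \<zero>) \<or>
    (\<exists>k::nat. \<exists>a\<in>set q. \<exists>b\<in>set q. 0 < k \<and> k < length q \<and> a \<noteq> \<zero> \<and> b \<noteq> \<zero> \<and> a \<otimes> z [^] k \<asymp> b) \<or>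
    (\<exists>i<length q. \<exists>a\<in>set q. a \<noteq> \<zero> \<and> eval q z \<asymp> a \<otimes> z [^] i)"
  using assms(1)
proof (induction q)
  case Nil
  then show ?case by simp
next
  case (Cons a q)
  have aR: "a \<in> carrier R" and qR: "set q \<subseteq> carrier R" using Cons.prems by auto
  have eR: "eval q z \<in> carrier R" using eval_in_carrier qR assms by blast
  let ?n = "length q"
  let ?B = "\<lambda>q. \<exists>k::nat. \<exists>a\<in>set q. \<exists>b\<in>set q. 0 < k \<and> k < length q \<and> a \<noteq> \<zero> \<and> b \<noteq> \<zero> \<and> a \<otimes> z [^] k \<asymp> b"
  let ?C = "\<lambda>q. \<exists>i<length q. \<exists>a\<in>set q. a \<noteq> \<zero> \<and> eval q z \<asymp> a \<otimes> z [^] i"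
  have ev: "eval (a # q) z = a \<otimes> z [^] ?n \<oplus> eval q z" by simp
  consider (Z) "\<forall>a\<in>set q. a = \<zero>" | (B) "?B q" | (C) "?C q" using Cons.IH[OF qR] by blast
  then show ?case
  proof cases
    case Z
    have "q = replicate ?n \<zero>" using Z by (simp add: replicate_length_same)
    then have e0: "eval q z = \<zero>" using eval_replicate_zero assms(2) by metis
    show ?thesis
    proof (cases "a = \<zero>")
      case True
      then show ?thesis using Z by simp
    next
      case False
      have "eval (a # q) z = a \<otimes> z [^] ?n" unfolding ev e0 using aR assms by simp
      then have "eval (a # q) z \<asymp> a \<otimes> z [^] ?n" using veq_refl aR assms by simp
      then have "?C (a # q)" using False by (intro exI[of _ ?n]) auto
      then show ?thesis by blast
    qed
  next
    case B
    then have "?B (a # q)" by (metis (no_types, lifting) length_Cons less_SucI list.set_intros(2))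
    then show ?thesis by blast
  next
    case C
    then obtain i b where b: "i < ?n" "b \<in> set q" "b \<noteq> \<zero>" "eval q z \<asymp> b \<otimes> z [^] i" by blast
    have bR: "b \<in> carrier R" using b qR by blast
    have biR: "b \<otimes> z [^] i \<in> carrier R" "a \<otimes> z [^] ?n \<in> carrier R" using bR aR assms by auto
    show ?thesis
    proof (cases "a = \<zero>")
      case True
      then have "eval (a # q) z = eval q z" unfolding ev using eR assms by simp
      then have "?C (a # q)" using b by (intro exI[of _ i]) auto
      then show ?thesis by blast
    next
      case False
      consider (eq) "a \<otimes> z [^] ?n \<preceq> b \<otimes> z [^] i" "b \<otimes> z [^] i \<preceq> a \<otimes> z [^] ?n"
        | (1) "\<not> b \<otimes> z [^] i \<preceq> a \<otimes> z [^] ?n" | (2) "\<not> a \<otimes> z [^] ?n \<preceq> b \<otimes> z [^] i" by blast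
      then show ?thesis
      proof cases
        case eq
        have *: "a \<otimes> z [^] ?n = z [^] i \<otimes> (a \<otimes> z [^] (?n - i))"
          using b(1) aR assms by (simp add: m_lcomm nat_pow_mult)
        have **: "b \<otimes> z [^] i = z [^] i \<otimes> b" using bR assms by (simp add: m_comm)
        have "a \<otimes> z [^] (?n - i) \<asymp> b"
          using eq unfolding * ** veq_def
          using vle_cancel[of "z [^] i"] aR bR assms nat_pow_nonzero by simp
        then have "?B (a # q)" using b False
          by (intro exI[of _ "?n - i"] bexI[of _ a] bexI[of _ b]) auto
        then show ?thesis by blast
      next
        case 1
        have "\<not> eval q z \<preceq> a \<otimes> z [^] ?n"
          using 1 b(4) vle_trans[of "b \<otimes> z [^] i" "eval q z"] biR unfolding veq_def by blast
        then have "eval q z \<oplus> a \<otimes> z [^] ?n \<asymp> a \<otimes> z [^] ?n" using veq_add_dominant biR eR by blast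
        then have "eval (a # q) z \<asymp> a \<otimes> z [^] ?n" unfolding ev using biR eR by (simp add: a_comm)
        then have "?C (a # q)" using False by (intro exI[of _ ?n]) auto
        then show ?thesis by blast
      next
        case 2
        have "\<not> a \<otimes> z [^] ?n \<preceq> eval q z"
          using 2 b(4) vle_trans[of "a \<otimes> z [^] ?n" "eval q z"] biR unfolding veq_def by blast
        then have "a \<otimes> z [^] ?n \<oplus> eval q z \<asymp> eval q z" using veq_add_dominant biR eR by blast
        then have "eval (a # q) z \<asymp> b \<otimes> z [^] i" unfolding ev using veq_trans b(4) biR eR by blast
        then have "?C (a # q)" using b by (intro exI[of _ i]) auto
        then show ?thesis by blast
      qed
    qed
  qed
qed

text \<open>After cancelling powers of \<open>z\<close>, the last nonzero coefficient is a multiple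
  of \<open>z\<close>. This bounds the value of \<open>z\<close> above by that of an element of the
  coefficient ring.\<close>

lemma divides_coefficient:
  assumes "set q \<subseteq> V" "\<exists>a\<in>set q. a \<noteq> \<zero>" "eval q z = \<zero>" "z \<noteq> \<zero>" "z \<in> V"
  shows "\<exists>a\<in>set q. a \<noteq> \<zero> \<and> z \<preceq> a"
  using assms(1-3)
proof (induction q rule: rev_induct)
  case Nil
  then show ?case by simp
next
  case (snoc a q)
  have zR: "z \<in> carrier R" using assms V_carrier by blast
  have aR: "a \<in> carrier R" and qV: "set q \<subseteq> V" and qR: "set q \<subseteq> carrier R" using snoc.prems V_carrier by auto
  have eV: "eval q z \<in> V" using subring_eval[OF subring qV assms(5)] .
  have eR: "eval q z \<in> carrier R" using eV V_carrier by blast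
  have e: "eval q z \<otimes> z \<oplus> a = \<zero>" using eval_append_aux[OF qR aR zR] snoc.prems by simp
  show ?case
  proof (cases "a = \<zero>")
    case True
    then have "eval q z = \<zero>" using e eR zR assms by (simp add: integral_iff)
    moreover have "\<exists>a\<in>set q. a \<noteq> \<zero>" using snoc.prems(2) True by auto
    ultimately show ?thesis using snoc.IH[OF qV] by auto
  next
    case False
    have "z \<preceq> eval q z \<otimes> z" unfolding vle_def using eV by blast
    then have "z \<preceq> \<ominus> (eval q z \<otimes> z)" using vle_a_inv zR by blast
    moreover have "\<ominus> (eval q z \<otimes> z) = a" using e eR zR aR by (metis m_closed minus_equality a_comm)
    ultimately show ?thesis using False by auto
  qed
qed

text \<open>Two terms of equal value in a relation of degree at most \<open>D\<close> give k v(e) =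
  r v(p) with 0 < k <= D, where r > 0 if \<open>e\<close> is small; so D v(e) >= v(p). The last
  nonzero coefficient bounds v(e) above. Using e^D instead of \<open>e\<close> absorbs the
  ramification of \<open>E\<close> over K(t).\<close>

lemma finite_extension_discrete:
  assumes K: "subfield K R" "K \<subseteq> V" and t: "t \<in> V" "transcendental K t"
    and dim: "dimension D (generate_field R (insert t K)) E" and E: "subring E R"
  obtains p where "p \<in> carrier R"
    "\<And>e. \<lbrakk> e \<in> E; e \<noteq> \<zero>; small e \<rbrakk> \<Longrightarrow> p \<preceq> e [^] D"
    "\<And>e. \<lbrakk> e \<in> E; e \<noteq> \<zero> \<rbrakk> \<Longrightarrow> \<exists>N::nat. \<not> p [^] N \<preceq> e [^] D"
proof -
  have tR: "t \<in> carrier R" using t V_carrier by blast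
  let ?S = "simple_extension K t"
  have SV: "?S \<subseteq> V" using simple_extension_subring_incl[OF subring K(2) t(1)] .
  have ER: "e \<in> carrier R" if "e \<in> E" for e using that subringE(1)[OF E] by blast
  have SR: "?S \<subseteq> carrier R" using SV V_carrier by blast
  show thesis
  proof (cases "\<exists>s\<in>?S. s \<noteq> \<zero> \<and> small s")
    case False
    have ns: "\<not> (e \<in> E \<and> e \<noteq> \<zero> \<and> small e)" for e
    proof
      assume e: "e \<in> E \<and> e \<noteq> \<zero> \<and> small e"
      obtain q where q: "set q \<subseteq> ?S" "length q = Suc D" "eval q e = \<zero>" "\<exists>a\<in>set q. a \<noteq> \<zero>"
        using integral_dimension_relation[OF K(1) tR dim E, of e] e by blast
      obtain a where "a \<in> set q" "a \<noteq> \<zero>" "e \<preceq> a"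
        using divides_coefficient[of q e] q SV e small_in_V by blast
      then show False using small_vle[of e a] False q(1) SR e by blast
    qed
    \<comment> \<open>The valuation is trivial on K[t], and \<open>E\<close> has no small nonzero
      element either. The choice p = 0, of infinite value, satisfies both conditions.\<close>
    have "\<not> \<zero> [^] (1::nat) \<preceq> e [^] D" if "e \<in> E" "e \<noteq> \<zero>" for e
      using zero_vle[of "e [^] D"] nat_pow_nonzero[OF ER[OF that(1)] that(2)] by auto
    then show thesis using that[of \<zero>] ns by blast
  next
    case True
    then obtain p where p: "p \<in> carrier R" "p \<noteq> \<zero>" "small p"
      "\<forall>s\<in>?S. s \<noteq> \<zero> \<longrightarrow> (\<exists>r::nat. s \<asymp> p [^] r)"
      using exists_uniformizer[OF K t] by blast
    have p1: "p \<preceq> \<one>" if "p [^] Suc n \<preceq> p [^] n" for n :: nat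
    proof -
      have "p [^] n \<otimes> p \<preceq> p [^] n \<otimes> \<one>" using that p by simp
      then show ?thesis using vle_cancel p nat_pow_nonzero by blast
    qed
    have pV: "\<one> \<preceq> p" using one_vle_iff small_in_V p by blast
    have pmono: "p [^] m \<preceq> p [^] n" if "m \<le> n" for m n :: nat
    proof -
      have "p [^] m \<otimes> \<one> [^] (n - m) \<preceq> p [^] m \<otimes> p [^] (n - m)"
        by (intro vle_mult vle_refl vle_pow pV) (use p in auto)
      then show ?thesis using p that by (simp add: nat_pow_mult)
    qed
    have low: "p \<preceq> e [^] D" if e: "e \<in> E" "e \<noteq> \<zero>" "small e" for e
    proof -
      obtain q where q: "set q \<subseteq> ?S" "length q = Suc D" "eval q e = \<zero>" "\<exists>a\<in>set q. a \<noteq> \<zero>"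
        using integral_dimension_relation[OF K(1) tR dim E e(1)] .
      have eR: "e \<in> carrier R" using ER e by blast
      have qR: "set q \<subseteq> carrier R" using q SR by blast
      have "\<not> (\<exists>i<length q. \<exists>a\<in>set q. a \<noteq> \<zero> \<and> eval q e \<asymp> a \<otimes> e [^] i)"
      proof
        assume "\<exists>i<length q. \<exists>a\<in>set q. a \<noteq> \<zero> \<and> eval q e \<asymp> a \<otimes> e [^] i"
        then obtain i :: nat and a where a: "a \<in> set q" "a \<noteq> \<zero>" "eval q e \<asymp> a \<otimes> e [^] i" by blast
        then have "a \<otimes> e [^] i = \<zero>" using veq_zero q(3) by blast
        moreover have "a \<in> carrier R" using a qR by blast
        ultimately show False using a(2) nat_pow_nonzero[OF eR e(2), of i] eR by (simp add: integral_iff)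
      qed
      then obtain k :: nat and a b where k: "0 < k" "k < length q" "a \<in> set q" "b \<in> set q" "a \<noteq> \<zero>" "b \<noteq> \<zero>" "a \<otimes> e [^] k \<asymp> b"
        using relation_values[OF qR eR e(2)] q(4) by blast
      obtain r1 r2 :: nat where r: "a \<asymp> p [^] r1" "b \<asymp> p [^] r2" using p(4) k q(1) by blast
      have abR: "a \<in> carrier R" "b \<in> carrier R" "e [^] k \<in> carrier R" using k qR eR by auto
      have eV: "e \<in> V" using small_in_V e by blast
      obtain k' where k': "k = Suc k'" using k by (cases k) auto
      have sk: "small (e [^] k)"
        unfolding k' using small_mult[OF e(3) subring_pow[OF subring eV]] eR by (simp add: m_comm)
      have "p [^] r1 \<otimes> e [^] k \<preceq> a \<otimes> e [^] k" using r(1) vle_mult vle_refl abR p(1) unfolding veq_def by simp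
      then have "p [^] r1 \<otimes> e [^] k \<preceq> b" using vle_trans k(7) p(1) abR unfolding veq_def by (meson m_closed nat_pow_closed)
      then have le1: "p [^] r1 \<otimes> e [^] k \<preceq> p [^] r2" using vle_trans r(2) p(1) abR unfolding veq_def by (meson m_closed nat_pow_closed)
      have "a \<otimes> e [^] k \<preceq> p [^] r1 \<otimes> e [^] k" using r(1) vle_mult vle_refl abR p(1) unfolding veq_def by simp
      then have "b \<preceq> p [^] r1 \<otimes> e [^] k" using vle_trans k(7) p(1) abR unfolding veq_def by (meson m_closed nat_pow_closed)
      then have le2: "p [^] r2 \<preceq> p [^] r1 \<otimes> e [^] k" using vle_trans r(2) p(1) abR unfolding veq_def by (meson m_closed nat_pow_closed)
      have "r1 < r2"
      proof (rule ccontr)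
        assume "\<not> r1 < r2"
        then have "p [^] r2 \<preceq> p [^] r1" using pmono by simp
        then have "p [^] r1 \<otimes> e [^] k \<preceq> p [^] r1" using vle_trans[OF le1] p(1) abR by blast
        then have "p [^] r1 \<otimes> e [^] k \<preceq> p [^] r1 \<otimes> \<one>" using p(1) by simp
        then have "e [^] k \<preceq> \<one>" using vle_cancel p(1,2) abR nat_pow_nonzero by blast
        then show False using sk unfolding small_def by blast
      qed
      then have "p [^] r1 \<otimes> p [^] (r2 - r1) \<preceq> p [^] r1 \<otimes> e [^] k" using le2 p(1) by (simp add: nat_pow_mult)
      then have 1: "p [^] (r2 - r1) \<preceq> e [^] k" using vle_cancel p(1,2) abR nat_pow_nonzero by blast
      have "p [^] (1::nat) \<preceq> p [^] (r2 - r1)" using pmono[of 1 "r2 - r1"] \<open>r1 < r2\<close> by simp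
      then have 2: "p \<preceq> p [^] (r2 - r1)" using p(1) by simp
      have "\<one> \<preceq> e [^] (D - k)" using one_vle_iff subring_pow[OF subring eV] eR by simp
      from vle_mult[OF vle_refl this] have "e [^] k \<otimes> \<one> \<preceq> e [^] k \<otimes> e [^] (D - k)" using abR by blast
      then have 3: "e [^] k \<preceq> e [^] D" using k(2) q(2) eR by (simp add: nat_pow_mult)
      show ?thesis using vle_trans[OF vle_trans[OF 2 1] 3] p(1) by blast
    qed
    have high: "\<exists>N::nat. \<not> p [^] N \<preceq> e [^] D" if e: "e \<in> E" "e \<noteq> \<zero>" for e
    proof (cases "e \<in> V")
      case False
      have eR: "e \<in> carrier R" using ER e by blast
      have "\<not> \<one> \<preceq> e" using one_vle_iff eR False by blast
      then have "e \<preceq> \<one>" using vle_total eR by blast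
      then have "e [^] D \<preceq> \<one>" using vle_pow[of e \<one> D] eR by simp
      then have "\<not> p [^] (1::nat) \<preceq> e [^] D" using vle_trans p(1,3) unfolding small_def by (metis nat_pow_eone)
      then show ?thesis by blast
    next
      case True
      have eR: "e \<in> carrier R" using ER e by blast
      obtain q where q: "set q \<subseteq> ?S" "length q = Suc D" "eval q e = \<zero>" "\<exists>a\<in>set q. a \<noteq> \<zero>"
        using integral_dimension_relation[OF K(1) tR dim E e(1)] .
      obtain a where a: "a \<in> set q" "a \<noteq> \<zero>" "e \<preceq> a"
        using divides_coefficient[of q e] q SV e True by blast
      obtain r :: nat where r: "a \<asymp> p [^] r" using p(4) a q(1) by blast
      have "e \<preceq> p [^] r" using vle_trans[OF a(3)] r eR unfolding veq_def by blast
      then have "e [^] D \<preceq> p [^] (r * D)" using vle_pow[of e "p [^] r" D] eR p(1) by (simp add: nat_pow_pow)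
      then have "\<not> p [^] Suc (r * D) \<preceq> e [^] D"
        using vle_trans[of "p [^] Suc (r * D)" "e [^] D" "p [^] (r * D)"] p1[of "r * D"] p(1,3) unfolding small_def by blast
      then show ?thesis by blast
    qed
    show thesis using that[OF p(1) low high] .
  qed
qed

end

section \<open>Extension of homomorphisms\<close>

text \<open>A homomorphism of fields is injective, so applying it to the coefficients creates no
  leading zeros and is compatible with normalization.\<close>

lemma poly_map_hom:
  assumes "field A" "field B" "h \<in> ring_hom A B"
  shows "map h \<in> ring_hom (poly_ring A) (poly_ring B)"
proof -
  interpret A: field A by fact
  interpret B: field B by fact
  interpret H: ring_hom_ring A B h by (rule ring_hom_ringI2[OF A.is_ring B.is_ring assms(3)])
  interpret PA: ring "poly_ring A" using A.univ_poly_is_ring[OF A.carrier_is_subring] .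
  have cl: "map h p \<in> carrier (poly_ring B)" if "p \<in> carrier (poly_ring A)" for p
    using polynomial_hom[OF assms(3,1,2) that] .
  have norm: "B.normalize (map h p) = map h p" if "p \<in> carrier (poly_ring A)" for p
    using B.normalize_polynomial cl[OF that] univ_poly_carrier by blast
  have setA: "set p \<subseteq> carrier A" if "p \<in> carrier (poly_ring A)" for p
    using that A.polynomial_incl univ_poly_carrier by blast
  show ?thesis
  proof (rule ring_hom_memI)
    show "\<And>x. x \<in> carrier (poly_ring A) \<Longrightarrow> map h x \<in> carrier (poly_ring B)" by (rule cl)
    show "map h \<one>\<^bsub>poly_ring A\<^esub> = \<one>\<^bsub>poly_ring B\<^esub>" by (simp add: univ_poly_one)
    fix p q assume pq: "p \<in> carrier (poly_ring A)" "q \<in> carrier (poly_ring A)"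
    show "map h (p \<otimes>\<^bsub>poly_ring A\<^esub> q) = map h p \<otimes>\<^bsub>poly_ring B\<^esub> map h q"
      using H.poly_mult_hom'[OF setA[OF pq(1)] setA[OF pq(2)]] norm[OF PA.m_closed[OF pq]]
      by (simp add: univ_poly_mult)
    show "map h (p \<oplus>\<^bsub>poly_ring A\<^esub> q) = map h p \<oplus>\<^bsub>poly_ring B\<^esub> map h q"
      using H.poly_add_hom'[OF setA[OF pq(1)] setA[OF pq(2)]] norm[OF PA.a_closed[OF pq]]
      by (simp add: univ_poly_add)
  qed
qed

context field
begin

lemma subfield_poly_ring: "subfield K R \<Longrightarrow> poly_ring (R\<lparr>carrier := K\<rparr>) = K[X]"
  using univ_poly_consistent[OF subfieldE(1)] by simp

lemma monic_linear_poly: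
  assumes "subring K R" "x \<in> K" shows "[\<one>, \<ominus> x] \<in> carrier (K[X])"
  using assms subringE[OF assms(1)] one_not_zero
  by (auto simp: univ_poly_carrier[symmetric] polynomial_def)

lemma monic_linear_square:
  assumes "subring K R" "x \<in> K"
  shows "[\<one>, \<ominus> x] [^]\<^bsub>K[X]\<^esub> (2::nat) = [\<one>, \<ominus> x] \<otimes>\<^bsub>K[X]\<^esub> [\<one>, \<ominus> x]"
proof -
  interpret UP: ring "K[X]" using univ_poly_is_ring[OF assms(1)] .
  show ?thesis using UP.nat_pow_Suc monic_linear_poly[OF assms] by (simp add: numeral_2_eq_2)
qed

text \<open>Divisibility by (X - x)^2 does not depend on the field over which it is tested. Testing
  it over \<open>K\<close> allows a double root to be carried along a homomorphism that is defined
  on \<open>K\<close> only.\<close>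

lemma alg_mult_le_one_iff:
  assumes K: "subfield K R" and x: "x \<in> K" and p: "p \<in> carrier (K[X])" "p \<noteq> []"
  shows "alg_mult p x \<le> 1 \<longleftrightarrow> \<not> (\<exists>q\<in>carrier (K[X]). p = ([\<one>, \<ominus> x] \<otimes>\<^bsub>K[X]\<^esub> [\<one>, \<ominus> x]) \<otimes>\<^bsub>K[X]\<^esub> q)"
proof -
  have xR: "x \<in> carrier R" using x subringE(1)[OF subfieldE(1)[OF K]] by blast
  have pR: "p \<in> carrier (poly_ring R)" using carrier_polynomial_shell[OF subfieldE(1)[OF K] p(1)] .
  interpret UP: ring "K[X]" using univ_poly_is_ring[OF subfieldE(1)[OF K]] .
  let ?d = "[\<one>, \<ominus> x]"
  have dK: "?d \<in> carrier (K[X])" using monic_linear_poly[OF subfieldE(1)[OF K] x] .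
  have "alg_mult p x \<le> 1 \<longleftrightarrow> \<not> (?d [^]\<^bsub>poly_ring R\<^esub> (2::nat)) pdivides p"
    using le_alg_mult_imp_pdivides[OF xR pR, of 2] alg_multE(2)[OF xR pR p(2), of 2] by force
  also have "?d [^]\<^bsub>poly_ring R\<^esub> (2::nat) = ?d \<otimes>\<^bsub>K[X]\<^esub> ?d"
    using monic_linear_square[OF carrier_is_subring xR] by (simp add: univ_poly_mult)
  also have "(?d \<otimes>\<^bsub>K[X]\<^esub> ?d) pdivides p \<longleftrightarrow> (?d \<otimes>\<^bsub>K[X]\<^esub> ?d) divides\<^bsub>K[X]\<^esub> p"
    using pdivides_iff_shell[OF K UP.m_closed[OF dK dK] p(1)] .
  finally show ?thesis unfolding factor_def by blast
qed

text \<open>The kernel of evaluation at \<open>x\<close> is generated by the minimal polynomial, so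
  the value at x' of the image of \<open>p\<close> depends only on p(x).\<close>

lemma extend_hom_simple:
  fixes S :: "('c, 'd) ring_scheme"
  assumes S: "field S" and M: "subfield M R" and h: "h \<in> ring_hom (R\<lparr>carrier := M\<rparr>) S"
    and x: "x \<in> carrier R" "(algebraic over M) x"
    and x': "x' \<in> carrier S" "ring.eval S (map h (Irr M x)) x' = \<zero>\<^bsub>S\<^esub>"
  obtains h' where "h' \<in> ring_hom (R\<lparr>carrier := simple_extension M x\<rparr>) S"
    "\<And>m. m \<in> M \<Longrightarrow> h' m = h m" "h' x = x'"
proof -
  interpret S: field S by fact
  note sM = subringE[OF subfieldE(1)[OF M]]
  have FM: "field (R\<lparr>carrier := M\<rparr>)" using subfield_iff(2)[OF M] .
  have H: "map h \<in> ring_hom (M[X]) (poly_ring S)"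
    using poly_map_hom[OF FM S h] unfolding subfield_poly_ring[OF M] .
  have evS: "(\<lambda>p. S.eval p x') \<in> ring_hom (poly_ring S) S"
    using S.eval_is_hom[OF S.carrier_is_subring x'(1)] .
  define \<phi> where "\<phi> p = S.eval (map h p) x'" for p
  have phi: "\<phi> \<in> ring_hom (M[X]) S"
    using ring_hom_trans[OF H evS] unfolding \<phi>_def comp_def .
  have psi: "(\<lambda>p. eval p x) \<in> ring_hom (M[X]) R" using eval_is_hom[OF subfieldE(1)[OF M] x(1)] .
  have UPr: "ring (M[X])" using univ_poly_is_ring[OF subfieldE(1)[OF M]] .
  interpret UP: ring "M[X]" by (rule UPr)
  interpret phi: ring_hom_ring "M[X]" S \<phi> by (rule ring_hom_ringI2[OF UPr S.is_ring phi])
  interpret psi: ring_hom_ring "M[X]" R "\<lambda>p. eval p x" by (rule ring_hom_ringI2[OF UPr is_ring psi])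
  note Irr = IrrE[OF M x]
  have ker: "\<phi> p = \<zero>\<^bsub>S\<^esub>" if p: "p \<in> carrier (M[X])" "eval p x = \<zero>" for p
  proof -
    have "Irr M x pdivides p" using Irr_minimal[OF M x p] .
    then have "Irr M x divides\<^bsub>M[X]\<^esub> p" using pdivides_iff_shell[OF M Irr(1) p(1)] by blast
    then obtain c where c: "c \<in> carrier (M[X])" "p = Irr M x \<otimes>\<^bsub>M[X]\<^esub> c" unfolding factor_def by blast
    have "\<phi> p = \<phi> (Irr M x) \<otimes>\<^bsub>S\<^esub> \<phi> c" unfolding c(2) using phi.hom_mult[OF Irr(1) c(1)] .
    also have "\<phi> (Irr M x) = \<zero>\<^bsub>S\<^esub>" unfolding \<phi>_def using x'(2) .
    finally show ?thesis using phi.hom_closed[OF c(1)] by simp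
  qed
  have wd: "\<phi> p = \<phi> q" if pq: "p \<in> carrier (M[X])" "q \<in> carrier (M[X])" "eval p x = eval q x" for p q
  proof -
    have qm: "\<ominus>\<^bsub>M[X]\<^esub> q \<in> carrier (M[X])" using pq by simp
    have "eval (p \<oplus>\<^bsub>M[X]\<^esub> \<ominus>\<^bsub>M[X]\<^esub> q) x = \<zero>"
      using psi.hom_add[OF pq(1) qm] psi.hom_a_inv[OF pq(2)] pq(3) psi.hom_closed[OF pq(2)] by (simp add: r_neg)
    then have "\<phi> (p \<oplus>\<^bsub>M[X]\<^esub> \<ominus>\<^bsub>M[X]\<^esub> q) = \<zero>\<^bsub>S\<^esub>" using ker UP.a_closed[OF pq(1) qm] by blast
    then have "\<phi> p \<oplus>\<^bsub>S\<^esub> \<ominus>\<^bsub>S\<^esub> \<phi> q = \<zero>\<^bsub>S\<^esub>"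
      using phi.hom_add[OF pq(1) qm] phi.hom_a_inv[OF pq(2)] by simp
    then show ?thesis using phi.hom_closed[OF pq(1)] phi.hom_closed[OF pq(2)]
      by (metis S.a_inv_closed S.minus_equality S.minus_minus S.a_comm)
  qed
  define h' where "h' y = \<phi> (SOME p. p \<in> carrier (M[X]) \<and> eval p x = y)" for y
  have h': "h' (eval p x) = \<phi> p" if p: "p \<in> carrier (M[X])" for p
  proof -
    let ?q = "SOME q. q \<in> carrier (M[X]) \<and> eval q x = eval p x"
    have q: "?q \<in> carrier (M[X]) \<and> eval ?q x = eval p x"
      by (rule someI[of _ p]) (use p in simp)
    show ?thesis unfolding h'_def by (rule wd[OF conjunct1[OF q] p conjunct2[OF q]])
  qed
  have img: "simple_extension M x = (\<lambda>p. eval p x) ` carrier (M[X])" using simple_extension_as_eval_img[OF sM(1) x(1)] .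
  have "h' \<in> ring_hom (R\<lparr>carrier := simple_extension M x\<rparr>) S"
  proof (rule ring_hom_memI)
    fix y assume "y \<in> carrier (R\<lparr>carrier := simple_extension M x\<rparr>)"
    then show "h' y \<in> carrier S" using img h' phi.hom_closed by auto
  next
    fix y z assume yz: "y \<in> carrier (R\<lparr>carrier := simple_extension M x\<rparr>)" "z \<in> carrier (R\<lparr>carrier := simple_extension M x\<rparr>)"
    then obtain p q where pq: "p \<in> carrier (M[X])" "y = eval p x" "q \<in> carrier (M[X])" "z = eval q x" using img by auto
    have "h' (y \<otimes> z) = h' y \<otimes>\<^bsub>S\<^esub> h' z"
      unfolding pq(2,4) using h' pq(1,3) phi.hom_mult psi.hom_mult UP.m_closed by metis
    then show "h' (y \<otimes>\<^bsub>R\<lparr>carrier := simple_extension M x\<rparr>\<^esub> z) = h' y \<otimes>\<^bsub>S\<^esub> h' z" by simp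
    have "h' (y \<oplus> z) = h' y \<oplus>\<^bsub>S\<^esub> h' z"
      unfolding pq(2,4) using h' pq(1,3) phi.hom_add psi.hom_add UP.a_closed by metis
    then show "h' (y \<oplus>\<^bsub>R\<lparr>carrier := simple_extension M x\<rparr>\<^esub> z) = h' y \<oplus>\<^bsub>S\<^esub> h' z" by simp
  next
    have "h' \<one> = \<one>\<^bsub>S\<^esub>" using h'[OF UP.one_closed] psi.hom_one phi.hom_one by simp
    then show "h' \<one>\<^bsub>R\<lparr>carrier := simple_extension M x\<rparr>\<^esub> = \<one>\<^bsub>S\<^esub>" by simp
  qed
  moreover have "h' m = h m" if m: "m \<in> M" for m
  proof (cases "m = \<zero>")
    case True
    have 1: "h' m = \<phi> []" using h'[OF univ_poly_zero_closed] True by simp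
    interpret hh: ring_hom_ring "R\<lparr>carrier := M\<rparr>" S h
      by (rule ring_hom_ringI2[OF _ S.is_ring h]) (use FM in \<open>simp add: field.is_ring\<close>)
    show ?thesis using 1 hh.hom_zero True unfolding \<phi>_def by simp
  next
    case False
    then have c: "[m] \<in> carrier (M[X])" using m by (auto simp: univ_poly_carrier[symmetric] polynomial_def)
    have mR: "m \<in> carrier R" "h m \<in> carrier S" using m sM(1) ring_hom_closed[OF h] by auto
    have "eval [m] x = m" using mR x by simp
    then have "h' m = \<phi> [m]" using h'[OF c] by simp
    also have "\<dots> = h m" unfolding \<phi>_def using mR x' by simp
    finally show ?thesis .
  qed
  moreover have "h' x = x'"
  proof -
    have c: "[\<one>, \<zero>] \<in> carrier (M[X])" using sM one_not_zero by (auto simp: univ_poly_carrier[symmetric] polynomial_def)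
    interpret hh: ring_hom_ring "R\<lparr>carrier := M\<rparr>" S h
      by (rule ring_hom_ringI2[OF _ S.is_ring h]) (use FM in \<open>simp add: field.is_ring\<close>)
    have "h \<one> = \<one>\<^bsub>S\<^esub>" "h \<zero> = \<zero>\<^bsub>S\<^esub>" using hh.hom_one hh.hom_zero by auto
    moreover have "eval [\<one>, \<zero>] x = x" using x by simp
    ultimately have "h' x = S.eval [\<one>\<^bsub>S\<^esub>, \<zero>\<^bsub>S\<^esub>] x'" using h'[OF c] unfolding \<phi>_def by simp
    then show ?thesis using x' by simp
  qed
  ultimately show thesis using that by blast
qed

end

text \<open>The minimal polynomial of \<open>y\<close> divides \<open>p\<close>, so its image
  divides a polynomial that splits; being nonconstant, it has a root. This supplies the x' of
  \<open>extend_hom_simple\<close>.\<close>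

lemma exists_root_image:
  fixes A :: "('a, 'm) ring_scheme" and B :: "('c, 'n) ring_scheme"
  assumes A: "field A" and B: "field B" and M: "subfield M A" and h: "h \<in> ring_hom (A\<lparr>carrier := M\<rparr>) B"
    and y: "y \<in> carrier A" and p: "p \<in> carrier (M[X]\<^bsub>A\<^esub>)" "p \<noteq> []" "ring.eval A p y = \<zero>\<^bsub>A\<^esub>"
    and spl: "ring.splitted B (map h p)"
  shows "\<exists>y'\<in>carrier B. ring.eval B (map h (ring.Irr A M y)) y' = \<zero>\<^bsub>B\<^esub>"
proof -
  interpret A: field A by fact
  interpret B: field B by fact
  have alg: "(A.algebraic over M) y" using A.algebraicI[OF p] .
  note I = A.IrrE[OF M y alg]
  have "A.Irr M y divides\<^bsub>M[X]\<^bsub>A\<^esub>\<^esub> p"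
    using A.Irr_minimal[OF M y alg p(1,3)] A.pdivides_iff_shell[OF M I(1) p(1)] by blast
  then obtain c where c: "c \<in> carrier (M[X]\<^bsub>A\<^esub>)" "p = A.Irr M y \<otimes>\<^bsub>M[X]\<^bsub>A\<^esub>\<^esub> c" unfolding factor_def by blast
  have H: "map h \<in> ring_hom (M[X]\<^bsub>A\<^esub>) (poly_ring B)"
    using poly_map_hom[OF A.subfield_iff(2)[OF M] B h] unfolding A.subfield_poly_ring[OF M] .
  have eq: "map h p = map h (A.Irr M y) \<otimes>\<^bsub>poly_ring B\<^esub> map h c" using ring_hom_mult[OF H I(1) c(1)] c(2) by simp
  have hI: "map h (A.Irr M y) \<in> carrier (poly_ring B)" "map h c \<in> carrier (poly_ring B)" "map h p \<in> carrier (poly_ring B)"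
    using ring_hom_closed[OF H] I(1) c(1) p(1) by blast+
  have "map h (A.Irr M y) pdivides\<^bsub>B\<^esub> map h p" unfolding pdivides_def factor_def using eq hI(2) by blast
  then have s: "B.splitted (map h (A.Irr M y))" using B.pdivides_imp_splitted[OF hI(1,3) _ spl] p(2) by simp
  have "length (map h (A.Irr M y)) - 1 \<ge> 1" using A.pirreducible_degree[OF M I(1,2)] by simp
  then have "B.roots (map h (A.Irr M y)) \<noteq> {#}" using s unfolding B.splitted_def by auto
  then obtain y' where "y' \<in># B.roots (map h (A.Irr M y))" by blast
  then show ?thesis
    using B.roots_mem_iff_is_root[OF hI(1)] unfolding B.is_root_def by blast
qed

section \<open>Split separable elements and extension of partial homomorphisms\<close>

context field
begin

text \<open>\<open>F\<close> confines the roots: required of every element of \<open>F\<close>, the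
  condition makes \<open>F\<close> normal and separable over \<open>K\<close>, while for
  \<open>F\<close> the whole carrier it means separability plus splitting in the ambient field. Any
  \<open>p\<close> is allowed, not only the minimal polynomial, so that the condition passes to
  larger \<open>K\<close>.\<close>

definition split_separable :: "'a set \<Rightarrow> 'a set \<Rightarrow> 'a \<Rightarrow> bool" where
  "split_separable K F x \<longleftrightarrow> (\<exists>p\<in>carrier (K[X]). p \<noteq> [] \<and> eval p x = \<zero> \<and> splitted p \<and>
     (\<forall>y\<in>carrier R. alg_mult p y \<le> 1) \<and> (\<forall>y\<in>carrier R. eval p y = \<zero> \<longrightarrow> y \<in> F))"

lemma carrier_mono_poly: "\<lbrakk> K \<subseteq> M; p \<in> carrier (K[X]) \<rbrakk> \<Longrightarrow> p \<in> carrier (M[X])"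
  unfolding univ_poly_carrier[symmetric] polynomial_def by auto

lemma split_separable_mono: "\<lbrakk> split_separable K F x; K \<subseteq> M; F \<subseteq> H \<rbrakk> \<Longrightarrow> split_separable M H x"
  unfolding split_separable_def using carrier_mono_poly by (meson subsetD)

lemma split_separable_algebraic:
  "split_separable K F x \<Longrightarrow> (algebraic over K) x"
  unfolding split_separable_def using algebraicI by blast

lemma split_separable_Irr:
  assumes K: "subfield K R" and x: "x \<in> carrier R" "split_separable K F x"
  shows "splitted (Irr K x)" "\<And>y. y \<in> carrier R \<Longrightarrow> alg_mult (Irr K x) y \<le> 1"
    "\<And>y. \<lbrakk> y \<in> carrier R; eval (Irr K x) y = \<zero> \<rbrakk> \<Longrightarrow> y \<in> F"
proof -
  obtain p where p: "p \<in> carrier (K[X])" "p \<noteq> []" "eval p x = \<zero>" "splitted p"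
     "\<forall>y\<in>carrier R. alg_mult p y \<le> 1" "\<forall>y\<in>carrier R. eval p y = \<zero> \<longrightarrow> y \<in> F"
    using x(2) unfolding split_separable_def by blast
  have alg: "(algebraic over K) x" using split_separable_algebraic[OF x(2)] .
  note I = IrrE[OF K x(1) alg]
  have dvd: "Irr K x pdivides p" using Irr_minimal[OF K x(1) alg p(1,3)] .
  have pR: "p \<in> carrier (poly_ring R)" and IR: "Irr K x \<in> carrier (poly_ring R)"
    using carrier_polynomial_shell[OF subfieldE(1)[OF K]] p I by blast+
  show "splitted (Irr K x)" using pdivides_imp_splitted[OF IR pR p(2,4) dvd] .
  have incl: "roots (Irr K x) \<subseteq># roots p" using pdivides_imp_roots_incl[OF IR pR p(2) dvd] .
  have inil: "Irr K x \<noteq> []" using pirreducible_degree[OF K I(1,2)] by auto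
  fix y assume y: "y \<in> carrier R"
  have "count (roots (Irr K x)) y \<le> count (roots p) y" using incl by (simp add: mset_subset_eq_count)
  then show "alg_mult (Irr K x) y \<le> 1"
    using alg_mult_eq_count_roots[OF IR] alg_mult_eq_count_roots[OF pR] p(5) y by (metis le_trans)
  assume "eval (Irr K x) y = \<zero>"
  then have "y \<in># roots (Irr K x)" using roots_mem_iff_is_root[OF IR] inil y unfolding is_root_def by blast
  then have "y \<in># roots p" using incl by (meson mset_subset_eqD)
  then show "y \<in> F" using roots_mem_iff_is_root[OF pR] p(6) y unfolding is_root_def by blast
qed

lemma card_simple_roots:
  assumes p: "p \<in> carrier (poly_ring R)" "p \<noteq> []" "splitted p" "\<And>y. y \<in> carrier R \<Longrightarrow> alg_mult p y \<le> 1"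
  shows "finite {y \<in> carrier R. eval p y = \<zero>}" "card {y \<in> carrier R. eval p y = \<zero>} = degree p"
proof -
  have eq: "set_mset (roots p) = {y \<in> carrier R. eval p y = \<zero>}"
    using roots_mem_iff_is_root[OF p(1)] p(2) unfolding is_root_def by auto
  show "finite {y \<in> carrier R. eval p y = \<zero>}" unfolding eq[symmetric] by simp
  have c1: "count (roots p) y = 1" if "y \<in> set_mset (roots p)" for y
  proof -
    have "y \<in> carrier R" using that eq by blast
    then have "count (roots p) y \<le> 1" using p(4) alg_mult_eq_count_roots[OF p(1)] by metis
    moreover have "0 < count (roots p) y" using that unfolding count_greater_zero_iff .
    ultimately show ?thesis by linarith
  qed
  have "degree p = size (roots p)" using p(3) unfolding splitted_def by simp
  also have "\<dots> = (\<Sum>y\<in>set_mset (roots p). count (roots p) y)" by (simp add: size_multiset_overloaded_eq)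
  also have "\<dots> = card (set_mset (roots p))" using c1 by simp
  finally show "card {y \<in> carrier R. eval p y = \<zero>} = degree p" unfolding eq by simp
qed

text \<open>Each \<open>y\<close> is a root of a polynomial over \<open>E\<close> whose coefficients
  the homomorphism fixes and which splits in the ambient field, so every single extension succeeds.
  Such partial homomorphisms take the place of automorphisms.\<close>

lemma extend_hom_list:
  assumes E: "subfield E R" and M: "subfield M R" "E \<subseteq> M"
    and h: "h \<in> ring_hom (R\<lparr>carrier := M\<rparr>) R" "\<And>x. x \<in> E \<Longrightarrow> h x = x"
    and ys: "set ys \<subseteq> carrier R" "\<And>y. y \<in> set ys \<Longrightarrow> split_separable E F y"
  shows "\<exists>M' h'. subfield M' R \<and> M \<subseteq> M' \<and> set ys \<subseteq> M' \<and> h' \<in> ring_hom (R\<lparr>carrier := M'\<rparr>) R \<and> (\<forall>x\<in>M. h' x = h x)"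
  using ys
proof (induction ys)
  case Nil
  show ?case by (intro exI[of _ M] exI[of _ h]) (use M h in simp)
next
  case (Cons y ys)
  obtain M1 h1 where M1: "subfield M1 R" "M \<subseteq> M1" "set ys \<subseteq> M1" "h1 \<in> ring_hom (R\<lparr>carrier := M1\<rparr>) R" "\<forall>x\<in>M. h1 x = h x"
    using Cons by auto
  have yR: "y \<in> carrier R" using Cons.prems by simp
  have EM1: "E \<subseteq> M1" using M M1 by blast
  have fixE: "h1 x = x" if "x \<in> E" for x using M1(5) h(2) M(2) that by (metis subsetD)
  obtain p where p: "p \<in> carrier (E[X])" "p \<noteq> []" "eval p y = \<zero>" "splitted p"
    using Cons.prems(2)[of y] unfolding split_separable_def by auto
  have pM: "p \<in> carrier (M1[X])" using carrier_mono_poly[OF EM1 p(1)] .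
  have alg: "(algebraic over M1) y" using algebraicI[OF pM p(2,3)] .
  have "map h1 p = p" using polynomial_incl[of E p] p(1) fixE unfolding univ_poly_carrier[symmetric] by (meson map_idI subsetD)
  then obtain y' where y': "y' \<in> carrier R" "eval (map h1 (Irr M1 y)) y' = \<zero>"
    using exists_root_image[OF field_axioms field_axioms M1(1,4) yR pM p(2,3)] p(4) by auto
  obtain h' where h': "h' \<in> ring_hom (R\<lparr>carrier := simple_extension M1 y\<rparr>) R" "\<And>m. m \<in> M1 \<Longrightarrow> h' m = h1 m"
    using extend_hom_simple[OF field_axioms M1(1,4) yR alg y'] by blast
  have "subfield (simple_extension M1 y) R" using simple_extension_is_subfield[OF M1(1) yR] alg by blast
  moreover have incl: "M1 \<subseteq> simple_extension M1 y" using simple_extension_incl[OF subringE(1)[OF subfieldE(1)[OF M1(1)]] yR] .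
  moreover have "y \<in> simple_extension M1 y" using simple_extension_mem[OF subfieldE(1)[OF M1(1)] yR] .
  moreover have "\<forall>x\<in>M. h' x = h x" using h'(2) M1(2,5) by (metis subsetD)
  ultimately show ?case using h'(1) M1(2,3)
    by (intro exI[of _ "simple_extension M1 y"] exI[of _ h']) auto
qed

section \<open>Kummer descent\<close>

lemma eval_map_lincomb:
  assumes "set l \<subseteq> carrier R" "x \<in> carrier R" "k \<in> carrier R" "\<And>a. a \<in> set l \<Longrightarrow> f a \<in> carrier R"
  shows "eval (map (\<lambda>a. f a \<ominus> k \<otimes> a) l) x = eval (map f l) x \<ominus> k \<otimes> eval l x"
  using assms(1,4)
proof (induction l)
  case Nil
  then show ?case using assms by (simp add: a_minus_def)
next
  case (Cons a l)
  have c: "a \<in> carrier R" "f a \<in> carrier R" "eval l x \<in> carrier R" "eval (map f l) x \<in> carrier R" "x [^] length l \<in> carrier R"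
    using Cons.prems assms eval_in_carrier[of l x] eval_in_carrier[of "map f l" x] by auto
  have "(f a \<ominus> k \<otimes> a) \<otimes> x [^] length l \<oplus> (eval (map f l) x \<ominus> k \<otimes> eval l x) =
    f a \<otimes> x [^] length l \<oplus> eval (map f l) x \<ominus> k \<otimes> (a \<otimes> x [^] length l \<oplus> eval l x)"
    using c assms(3) by algebra
  then show ?case using Cons by simp
qed

text \<open>A homomorphism over L = E1(\<gamma>) sends the root y = ys(\<gamma>) of an element of
  \<open>L\<close> to y or -y, and uniqueness of coefficients makes it multiply every entry of
  \<open>ys\<close> by the same sign. Ratios and squares of entries are therefore fixed and lie in
  \<open>E1\<close>: for a nonzero entry \<open>k\<close>, take b = k^2 and let \<open>l\<close> be
  \<open>ys\<close> divided by \<open>k\<close>.\<close>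

lemma kummer_descent:
  assumes E: "subfield E R" and E1: "subfield E1 R" and F: "subfield F R" and incl: "E \<subseteq> E1" "E1 \<subseteq> F"
    and gal: "\<And>w. w \<in> F \<Longrightarrow> split_separable E F w"
    and g: "\<gamma> \<in> carrier R" and n: "1 \<le> n"
    and L: "subfield (simple_extension E1 \<gamma>) R"
    and ind: "\<And>l. \<lbrakk> set l \<subseteq> F; length l \<le> n; eval l \<gamma> = \<zero> \<rbrakk> \<Longrightarrow> \<forall>a\<in>set l. a = \<zero>"
    and rep: "\<And>x. x \<in> simple_extension E1 \<gamma> \<Longrightarrow> \<exists>l. set l \<subseteq> E1 \<and> length l = n \<and> eval l \<gamma> = x"
    and ys: "set ys \<subseteq> F" "length ys = n" and y: "eval ys \<gamma> \<otimes> eval ys \<gamma> \<in> simple_extension E1 \<gamma>"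
  shows "\<exists>b\<in>E1. \<exists>l. set l \<subseteq> E1 \<and> length l = n \<and> eval ys \<gamma> \<otimes> eval ys \<gamma> = b \<otimes> (eval l \<gamma> \<otimes> eval l \<gamma>)"
proof -
  note sE = subringE[OF subfieldE(1)[OF E]] and sE1 = subringE[OF subfieldE(1)[OF E1]] and sF = subringE[OF subfieldE(1)[OF F]]
  let ?L = "simple_extension E1 \<gamma>"
  note sL = subringE[OF subfieldE(1)[OF L]]
  have E1L: "E1 \<subseteq> ?L" using simple_extension_incl[OF sE1(1) g] .
  have gL: "\<gamma> \<in> ?L" using simple_extension_mem[OF subfieldE(1)[OF E1] g] .
  have ysR: "set ys \<subseteq> carrier R" using ys sF by blast
  define Y where "Y = eval ys \<gamma>"
  have YR: "Y \<in> carrier R" unfolding Y_def using eval_in_carrier[OF ysR g] .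
  \<comment> \<open>\<open>L\<close> and \<open>F\<close> meet in \<open>E1\<close>: subtracting
    \<open>z\<close> from the constant coefficient of its representation over \<open>E1\<close>
    gives a relation for \<gamma> over \<open>F\<close>, which must be trivial.\<close>
  have LF: "z \<in> E1" if z: "z \<in> ?L" "z \<in> F" for z
  proof -
    obtain l where l: "set l \<subseteq> E1" "length l = n" "eval l \<gamma> = z" using rep[OF z(1)] by blast
    have "l \<noteq> []" using l(2) n by auto
    then obtain l' a where la: "l = l' @ [a]" by (metis rev_exhaust)
    have zR: "z \<in> carrier R" using z sF by blast
    have l'R: "set l' \<subseteq> carrier R" "a \<in> carrier R" "a \<in> E1" using l la sE1 by auto
    have zl: "eval l' \<gamma> \<otimes> \<gamma> \<oplus> a = z" using eval_append_aux[OF l'R(1,2) g] l la by simp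
    have azR: "a \<ominus> z \<in> carrier R" using l'R zR by simp
    have c: "eval l' \<gamma> \<in> carrier R" using eval_in_carrier[OF l'R(1) g] .
    have "eval (l' @ [a \<ominus> z]) \<gamma> = eval l' \<gamma> \<otimes> \<gamma> \<oplus> (a \<ominus> z)" using eval_append_aux[OF l'R(1) azR g] .
    also have "\<dots> = (eval l' \<gamma> \<otimes> \<gamma> \<oplus> a) \<ominus> z" using c g l'R zR by algebra
    also have "\<dots> = \<zero>" unfolding zl using zR by (simp add: a_minus_def r_neg)
    finally have e0: "eval (l' @ [a \<ominus> z]) \<gamma> = \<zero>" .
    have "set (l' @ [a \<ominus> z]) \<subseteq> F" using l la incl z subring_minus[OF subfieldE(1)[OF F]] by auto
    then have "a \<ominus> z = \<zero>" using ind[OF _ _ e0] l(2) la by simp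
    then have "z = a" using l'R zR by (metis a_minus_def minus_equality minus_minus a_inv_closed r_neg add.m_comm)
    then show ?thesis using l'R by simp
  qed
  \<comment> \<open>An element of \<open>F\<close> outside \<open>L\<close> has a second conjugate
    over \<open>L\<close>, and the homomorphism that moves it extends to a field containing
    \<open>ys\<close>. The conditions on \<open>M\<close> are those under which \<open>sign\<close>
    will apply.\<close>
  have fixed: "z \<in> E1" if z: "z \<in> F"
    and fx: "\<And>M h. \<lbrakk> subfield M R; ?L \<subseteq> M; set ys \<subseteq> M; z \<in> M; h \<in> ring_hom (R\<lparr>carrier := M\<rparr>) R; \<forall>x\<in>?L. h x = x \<rbrakk> \<Longrightarrow> h z = z" for z
  proof (rule ccontr)
    assume "z \<notin> E1"
    then have zL: "z \<notin> ?L" using LF z by blast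
    have zR: "z \<in> carrier R" using z sF by blast
    have "split_separable E F z" using gal[OF z] .
    then have sz: "split_separable ?L F z" using split_separable_mono incl(1) E1L by blast
    have alg: "(algebraic over ?L) z" using split_separable_algebraic[OF sz] .
    note I = IrrE[OF L zR alg]
    have IR: "Irr ?L z \<in> carrier (poly_ring R)" using carrier_polynomial_shell[OF subfieldE(1)[OF L] I(1)] .
    have nil: "Irr ?L z \<noteq> []" and dge: "degree (Irr ?L z) \<ge> 1" using pirreducible_degree[OF L I(1,2)] by auto
    have "degree (Irr ?L z) \<noteq> 1"
    proof
      assume "degree (Irr ?L z) = 1"
      then have "length (Irr ?L z) = Suc (Suc 0)" by simp
      then obtain a b where ab: "Irr ?L z = [a, b]" by (metis length_0_conv length_Suc_conv)
      have a1: "a = \<one>" using I(3) ab by simp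
      have bL: "b \<in> ?L" using polynomial_incl[of ?L "Irr ?L z"] I(1) ab unfolding univ_poly_carrier[symmetric] by simp
      have bR: "b \<in> carrier R" using bL sL(1) by blast
      have "z \<oplus> b = \<zero>" using I(4) ab a1 zR bR by simp
      then have "z = \<ominus> b" using zR bR by (metis minus_equality)
      then show False using zL sL(5)[OF bL] by simp
    qed
    then have d2: "degree (Irr ?L z) \<ge> 2" using dge by simp
    note sp = split_separable_Irr[OF L zR sz]
    have "\<exists>z'\<in>{y \<in> carrier R. eval (Irr ?L z) y = \<zero>}. z' \<noteq> z"
    proof (rule ccontr)
      assume "\<not> ?thesis"
      then have "{y \<in> carrier R. eval (Irr ?L z) y = \<zero>} \<subseteq> {z}" by blast
      then have "card {y \<in> carrier R. eval (Irr ?L z) y = \<zero>} \<le> 1" using card_mono[of "{z}"] by simp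
      moreover have "card {y \<in> carrier R. eval (Irr ?L z) y = \<zero>} = degree (Irr ?L z)"
        by (rule card_simple_roots(2)[OF IR nil sp(1) sp(2)])
      ultimately show False using d2 by linarith
    qed
    then obtain z' where z': "z' \<in> carrier R" "eval (Irr ?L z) z' = \<zero>" "z' \<noteq> z" by blast
    have idh: "(\<lambda>x. x) \<in> ring_hom (R\<lparr>carrier := ?L\<rparr>) R" by (rule ring_hom_memI) (use sL(1) in auto)
    have z'2: "eval (map (\<lambda>x. x) (Irr ?L z)) z' = \<zero>" using z' by simp
    obtain h1 where h1: "h1 \<in> ring_hom (R\<lparr>carrier := simple_extension ?L z\<rparr>) R" "\<And>m. m \<in> ?L \<Longrightarrow> h1 m = m" "h1 z = z'"
      using extend_hom_simple[OF field_axioms L idh zR alg z'(1) z'2] by blast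
    let ?M = "simple_extension ?L z"
    have M: "subfield ?M R" using simple_extension_is_subfield[OF L zR] alg by blast
    have LM: "?L \<subseteq> ?M" using simple_extension_incl[OF sL(1) zR] .
    have zM: "z \<in> ?M" using simple_extension_mem[OF subfieldE(1)[OF L] zR] .
    have EM: "E \<subseteq> ?M" "E \<subseteq> ?L" using incl E1L LM by blast+
    have fE: "h1 x = x" if "x \<in> E" for x using h1(2) EM(2) that by blast
    have spy: "split_separable E F y" if "y \<in> set ys" for y using gal ys that by blast
    obtain M' h' where M': "subfield M' R" "?M \<subseteq> M'" "set ys \<subseteq> M'" "h' \<in> ring_hom (R\<lparr>carrier := M'\<rparr>) R" "\<forall>x\<in>?M. h' x = h1 x"
      using extend_hom_list[OF E M EM(1) h1(1) fE ysR spy] by blast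
    have "h' z = z"
    proof (rule fx[OF M'(1) _ M'(3) _ M'(4)])
      show "?L \<subseteq> M'" "z \<in> M'" using LM M'(2) zM by blast+
      show "\<forall>x\<in>?L. h' x = x" using M'(5) LM h1(2) by (metis subsetD)
    qed
    then show False using M'(5) zM h1(3) z'(3) by simp
  qed
  have sign: "\<exists>e\<in>carrier R. e \<otimes> e = \<one> \<and> (\<forall>a\<in>set ys. h a = e \<otimes> a)"
    if M: "subfield M R" "?L \<subseteq> M" "set ys \<subseteq> M" and h: "h \<in> ring_hom (R\<lparr>carrier := M\<rparr>) R" "\<forall>x\<in>?L. h x = x" for M h
  proof -
    note sM = subringE[OF subfieldE(1)[OF M(1)]]
    have rM: "ring (R\<lparr>carrier := M\<rparr>)" using subring_is_ring[OF subfieldE(1)[OF M(1)]] .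
    interpret H: ring_hom_ring "R\<lparr>carrier := M\<rparr>" R h by (rule ring_hom_ringI2[OF rM is_ring h(1)])
    have gM: "\<gamma> \<in> M" using gL M by blast
    have YM: "Y \<in> M" unfolding Y_def using subring_eval[OF subfieldE(1)[OF M(1)] M(3) gM] .
    have hR: "h a \<in> carrier R" if "a \<in> M" for a using ring_hom_closed[OF h(1)] that by simp
    have hg: "h \<gamma> = \<gamma>" using h(2) gL by blast
    have hY: "h Y = eval (map h ys) \<gamma>"
      using H.eval_hom'[of \<gamma> ys] gM M(3) hg eval_consistent[OF subfieldE(1)[OF M(1)]] unfolding Y_def by simp
    have "h Y \<otimes> h Y = h (Y \<otimes> Y)" using H.hom_mult[of Y Y] YM by simp
    also have "\<dots> = Y \<otimes> Y" using h(2) y unfolding Y_def by blast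
    finally have sq: "h Y \<otimes> h Y = Y \<otimes> Y" .
    have hYR: "h Y \<in> carrier R" using hR YM by blast
    have "(h Y \<ominus> Y) \<otimes> (h Y \<oplus> Y) = h Y \<otimes> h Y \<ominus> Y \<otimes> Y" using hYR YR by algebra
    then have "(h Y \<ominus> Y) \<otimes> (h Y \<oplus> Y) = \<zero>" using sq YR by (simp add: a_minus_def r_neg)
    then have "h Y \<ominus> Y = \<zero> \<or> h Y \<oplus> Y = \<zero>" by (rule integral) (use hYR YR in auto)
    then have "\<exists>e\<in>carrier R. e \<otimes> e = \<one> \<and> h Y \<ominus> e \<otimes> Y = \<zero>"
    proof
      assume "h Y \<ominus> Y = \<zero>"
      then show ?thesis using YR by (intro bexI[of _ \<one>]) simp_all
    next
      assume "h Y \<oplus> Y = \<zero>"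
      moreover have "h Y \<oplus> Y = h Y \<ominus> (\<ominus> \<one>) \<otimes> Y" "(\<ominus> \<one>) \<otimes> (\<ominus> \<one>) = \<one>" using hYR YR by algebra+
      ultimately show ?thesis by (intro bexI[of _ "\<ominus> \<one>"]) simp_all
    qed
    then obtain e where e: "e \<in> carrier R" "e \<otimes> e = \<one>" "h Y \<ominus> e \<otimes> Y = \<zero>" by blast
    \<comment> \<open>Normality: \<open>h\<close> fixes the coefficients of a polynomial over
      \<open>E\<close> whose roots all lie in \<open>F\<close>. Staying in \<open>F\<close> is what
      permits comparing coefficients.\<close>
    have hF: "h a \<in> F" if a: "a \<in> set ys" for a
    proof -
      obtain p where p: "p \<in> carrier (E[X])" "eval p a = \<zero>" "\<forall>y\<in>carrier R. eval p y = \<zero> \<longrightarrow> y \<in> F"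
        using gal[of a] a ys(1) unfolding split_separable_def by blast
      have pE: "set p \<subseteq> E" using polynomial_incl p(1) univ_poly_carrier by blast
      have pL: "set p \<subseteq> ?L" using pE incl E1L by blast
      have mp: "map h p = p" using h(2) pL by (meson map_idI subsetD)
      have aM: "a \<in> M" using a M(3) by blast
      have "eval p (h a) = h (eval p a)"
        using H.eval_hom'[of a p] aM pL M(2) mp eval_consistent[OF subfieldE(1)[OF M(1)]] by auto
      then have "eval p (h a) = \<zero>" using p(2) H.hom_zero by simp
      then show ?thesis using p(3) hR[OF aM] by blast
    qed
    have eF: "e \<in> F"
    proof -
      have "(e \<ominus> \<one>) \<otimes> (e \<oplus> \<one>) = e \<otimes> e \<ominus> \<one>" using e(1) by algebra
      then have "(e \<ominus> \<one>) \<otimes> (e \<oplus> \<one>) = \<zero>" using e(2) by (simp add: a_minus_def r_neg)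
      then have "e \<ominus> \<one> = \<zero> \<or> e \<oplus> \<one> = \<zero>" by (rule integral) (use e(1) in auto)
      then have "e = \<one> \<or> e = \<ominus> \<one>" using e(1) by (metis minus_equality minus_minus one_closed r_right_minus_eq)
      then show ?thesis using sF(3,5) by blast
    qed
    have ha: "h a \<in> carrier R" if "a \<in> set ys" for a using hR M(3) that by blast
    have "eval (map (\<lambda>a. h a \<ominus> e \<otimes> a) ys) \<gamma> = \<zero>"
      using eval_map_lincomb[of ys \<gamma> e h] ysR g e ha hY unfolding Y_def by simp
    moreover have "set (map (\<lambda>a. h a \<ominus> e \<otimes> a) ys) \<subseteq> F"
      using hF eF ys(1) sF(6) subring_minus[OF subfieldE(1)[OF F]] by auto
    ultimately have z: "\<forall>b\<in>set (map (\<lambda>a. h a \<ominus> e \<otimes> a) ys). b = \<zero>" using ind[of "map (\<lambda>a. h a \<ominus> e \<otimes> a) ys"] ys(2) by simp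
    have "h a = e \<otimes> a" if a: "a \<in> set ys" for a
    proof -
      have "h a \<ominus> e \<otimes> a = \<zero>" using z a by simp
      moreover have "a \<in> carrier R" using a ysR by blast
      ultimately show ?thesis using ha[OF a] e(1) by simp
    qed
    then show ?thesis using e by blast
  qed
  show ?thesis
  proof (cases "\<exists>k\<in>set ys. k \<noteq> \<zero>")
    case False
    then have "ys = replicate n \<zero>" using ys(2) by (metis replicate_length_same)
    then have Y0: "eval ys \<gamma> = \<zero>" using eval_replicate_zero[OF g] by simp
    have "set (replicate n \<zero>) \<subseteq> E1" using sE1(2) by auto
    then show ?thesis using Y0 eval_replicate_zero[OF g, of n] sE1(2)
      by (intro bexI[of _ \<zero>] exI[of _ "replicate n \<zero>"]) simp_all
  next
    case True
    then obtain k where k: "k \<in> set ys" "k \<noteq> \<zero>" by blast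
    have kF: "k \<in> F" and kR: "k \<in> carrier R" using k ys ysR by blast+
    note ik = nonzero_inv[OF kR k(2)]
    have ikF: "inv k \<in> F" using subfield_m_inv(1)[OF F, of k] kF k by simp
    have q: "inv k \<otimes> a \<in> E1" if a: "a \<in> set ys" for a
    proof (rule fixed)
      have aR: "a \<in> carrier R" and aF: "a \<in> F" using a ysR ys by blast+
      show "inv k \<otimes> a \<in> F" using sF(6)[OF ikF aF] .
      fix M h assume M: "subfield M R" "?L \<subseteq> M" "set ys \<subseteq> M" "inv k \<otimes> a \<in> M" and h: "h \<in> ring_hom (R\<lparr>carrier := M\<rparr>) R" "\<forall>x\<in>?L. h x = x"
      obtain e where e: "e \<in> carrier R" "e \<otimes> e = \<one>" "\<forall>a\<in>set ys. h a = e \<otimes> a" using sign[OF M(1-3) h] by blast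
      have enz: "e \<noteq> \<zero>" using e(2) one_not_zero by auto
      have kM: "k \<in> M" using k M by blast
      have zR: "h (inv k \<otimes> a) \<in> carrier R" using ring_hom_closed[OF h(1)] M(4) by simp
      have eqa: "k \<otimes> (inv k \<otimes> a) = a" using ik kR aR by (simp add: m_assoc[symmetric])
      have "h k \<otimes> h (inv k \<otimes> a) = h (k \<otimes> (inv k \<otimes> a))" using ring_hom_mult[OF h(1), of k "inv k \<otimes> a"] kM M(4) by simp
      then have "(e \<otimes> k) \<otimes> h (inv k \<otimes> a) = e \<otimes> a" using e(3) k a eqa by simp
      also have "\<dots> = (e \<otimes> k) \<otimes> (inv k \<otimes> a)" using eqa e(1) kR ik aR by (simp add: m_assoc)
      finally show "h (inv k \<otimes> a) = inv k \<otimes> a"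
        using m_lcancel[of "e \<otimes> k"] e(1) enz kR k(2) zR ik aR by (simp add: integral_iff)
    qed
    have b: "k \<otimes> k \<in> E1"
    proof (rule fixed)
      show "k \<otimes> k \<in> F" using sF(6)[OF kF kF] .
      fix M h assume M: "subfield M R" "?L \<subseteq> M" "set ys \<subseteq> M" "k \<otimes> k \<in> M" and h: "h \<in> ring_hom (R\<lparr>carrier := M\<rparr>) R" "\<forall>x\<in>?L. h x = x"
      obtain e where e: "e \<in> carrier R" "e \<otimes> e = \<one>" "\<forall>a\<in>set ys. h a = e \<otimes> a" using sign[OF M(1-3) h] by blast
      have kM: "k \<in> M" using k M by blast
      have "h (k \<otimes> k) = h k \<otimes> h k" using ring_hom_mult[OF h(1), of k k] kM by simp
      also have "\<dots> = (e \<otimes> e) \<otimes> (k \<otimes> k)" using e(1,3) k kR by (simp add: m_ac)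
      also have "\<dots> = k \<otimes> k" using e(2) kR by simp
      finally show "h (k \<otimes> k) = k \<otimes> k" .
    qed
    let ?l = "map (\<lambda>a. inv k \<otimes> a) ys"
    have lE: "set ?l \<subseteq> E1" using q by auto
    have le: "eval ?l \<gamma> = inv k \<otimes> Y" unfolding Y_def using eval_smult[OF ik(1) ysR g] .
    have "(k \<otimes> k) \<otimes> (eval ?l \<gamma> \<otimes> eval ?l \<gamma>) = (k \<otimes> inv k) \<otimes> (k \<otimes> inv k) \<otimes> (Y \<otimes> Y)"
      unfolding le using kR ik(1) YR by algebra
    then have "eval ys \<gamma> \<otimes> eval ys \<gamma> = (k \<otimes> k) \<otimes> (eval ?l \<gamma> \<otimes> eval ?l \<gamma>)" using ik YR Y_def by simp
    then show ?thesis using b lE ys(2) by (intro bexI[OF _ b] exI[of _ ?l]) simp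
  qed
qed

section \<open>Conclusion of the valuation argument\<close>

lemma algebraic_root_over:
  assumes K: "subfield K R" and t: "t \<in> carrier R" and z: "z \<in> carrier R" "(algebraic over generate_field R (insert t K)) z"
  shows "root_over (simple_extension K t) z"
proof -
  note sK = subringE[OF subfieldE(1)[OF K]]
  have tK: "insert t K \<subseteq> carrier R" using t sK by auto
  let ?S = "simple_extension K t"
  have S: "subring ?S R" using simple_extension_is_subring[OF subfieldE(1)[OF K] t] .
  note sS = subringE[OF S]
  obtain p where p: "p \<in> carrier ((generate_field R (insert t K))[X])" "p \<noteq> []" "eval p z = \<zero>"
    using algebraicE[OF subfieldE(1)[OF generate_field_is_subfield[OF tK]] z] by blast
  have pG: "set p \<subseteq> generate_field R (insert t K)" using p(1) polynomial_incl univ_poly_carrier by blast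
  have pR: "set p \<subseteq> carrier R" using pG generate_field_in_carrier[OF tK] by blast
  obtain c q where cq: "p = c # q" using p(2) by (cases p) auto
  have cnz: "c \<noteq> \<zero>" using p(1) cq unfolding univ_poly_carrier[symmetric] polynomial_def by simp
  have "\<exists>d\<in>?S. d \<noteq> \<zero> \<and> (\<forall>x\<in>set p. d \<otimes> x \<in> ?S)"
    by (rule clear_denominators[OF S pR]) (use generate_field_fractions[OF K t] pG in blast)
  then obtain d where d: "d \<in> ?S" "d \<noteq> \<zero>" "\<forall>x\<in>set p. d \<otimes> x \<in> ?S" by blast
  have dR: "d \<in> carrier R" using d sS by blast
  have "eval (map (\<lambda>a. d \<otimes> a) p) z = \<zero>" using eval_smult[OF dR pR z(1)] p(3) dR by simp
  moreover have "d \<otimes> c \<noteq> \<zero>" using d cnz dR pR cq by (auto simp: integral_iff)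
  moreover have "set (map (\<lambda>a. d \<otimes> a) p) \<subseteq> ?S" using d by auto
  ultimately show ?thesis unfolding root_over_def cq by (intro exI[of _ "d \<otimes> c"] exI[of _ "map (\<lambda>a. d \<otimes> a) q"]) simp
qed

text \<open>Here \<open>even_value\<close> meets \<open>not_all_values_even\<close>. The valuation
  is adapted to one particular \<open>c\<close>, but \<open>rep\<close> is used for all
  perturbations of it in \<open>E\<close>.\<close>

lemma no_kummer_representation:
  assumes K: "subfield K R" and t: "t \<in> carrier R" "transcendental K t"
    and E: "subfield E R" "K \<subseteq> E" "t \<in> E" and dim: "dimension D (generate_field R (insert t K)) E"
    and two: "\<one> \<oplus> \<one> \<noteq> \<zero>"
    and G: "finite G" "G \<subseteq> carrier R" "2 \<le> card G" and g: "\<gamma> \<in> G" "\<gamma> \<notin> E"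
    and alg: "\<And>g. g \<in> G \<Longrightarrow> (algebraic over generate_field R (insert t K)) g"
    and rep: "\<And>c. c \<in> E \<Longrightarrow> \<exists>b\<in>E. \<exists>l. set l \<subseteq> E \<and> length l \<le> card G \<and>
       (\<forall>g\<in>G. \<one> \<oplus> c \<otimes> c \<otimes> g = b \<otimes> (eval l g \<otimes> eval l g))"
  shows False
proof -
  note sK = subringE[OF subfieldE(1)[OF K]] and sE = subringE[OF subfieldE(1)[OF E(1)]]
  have tK: "insert t K \<subseteq> carrier R" using t sK by auto
  let ?Q = "generate_field R (insert t K)"
  have Q: "subfield ?Q R" using generate_field_is_subfield[OF tK] .
  have A: "subfield {x \<in> carrier R. (algebraic over ?Q) x} R" using subfield_of_algebraics[OF Q] .
  let ?A = "{x \<in> carrier R. (algebraic over ?Q) x}"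
  have GA: "G \<subseteq> ?A" using alg G by blast
  have gR: "\<gamma> \<in> carrier R" and gnz: "\<gamma> \<noteq> \<zero>" using g G sE(2) by auto
  \<comment> \<open>All demands on the valuation become integrality of finitely many elements:
    \<gamma> is a unit once it and its inverse are integral, and residues are distinct once the
    inverses of the differences are integral.\<close>
  define Z where "Z = G \<union> {inv \<gamma>} \<union> (\<lambda>(a, b). inv (a \<ominus> b)) ` {(a, b) \<in> G \<times> G. a \<noteq> b}"
  have finZ: "finite Z"
  proof -
    have "finite {(a, b) \<in> G \<times> G. a \<noteq> b}" by (rule finite_subset[of _ "G \<times> G"]) (use G in auto)
    then show ?thesis unfolding Z_def using G by simp
  qed
  have invA: "inv x \<in> ?A" if "x \<in> ?A" "x \<noteq> \<zero>" for x
    using subfield_m_inv(1)[OF A, of x] that by simp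
  have dA: "inv (a \<ominus> b) \<in> ?A" if "a \<in> G" "b \<in> G" "a \<noteq> b" for a b
  proof (rule invA)
    show "a \<ominus> b \<in> ?A" by (rule subring_minus[OF subfieldE(1)[OF A]]) (use GA that in blast)+
    show "a \<ominus> b \<noteq> \<zero>" using that G r_right_minus_eq[of a b] by blast
  qed
  have ZA: "Z \<subseteq> ?A"
  proof
    fix z assume "z \<in> Z"
    then consider "z \<in> G" | "z = inv \<gamma>" | a b where "z = inv (a \<ominus> b)" "a \<in> G" "b \<in> G" "a \<noteq> b"
      unfolding Z_def by auto
    then show "z \<in> ?A"
    proof cases
      case 1 then show ?thesis using GA by blast
    next
      case 2 then show ?thesis using invA[of \<gamma>] GA g gnz by blast
    next
      case 3 then show ?thesis using dA by blast
    qed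
  qed
  have ZR: "Z \<subseteq> carrier R" using ZA by auto
  have Zr: "root_over (simple_extension K t) z" if "z \<in> Z" for z
    using algebraic_root_over[OF K t(1)] ZA that by blast
  have gZ: "\<gamma> \<in> Z" "inv \<gamma> \<in> Z" unfolding Z_def using g by auto
  have SE: "simple_extension K t \<subseteq> E" using simple_extension_subring_incl[OF subfieldE(1)[OF E(1)] E(2,3)] .
  \<comment> \<open>A zero would give \<gamma> = -1/c^2, an element of \<open>E\<close>.\<close>
  have nz: "\<one> \<oplus> c \<otimes> c \<otimes> \<gamma> \<noteq> \<zero>" if c: "c \<in> E" for c
  proof
    assume z: "\<one> \<oplus> c \<otimes> c \<otimes> \<gamma> = \<zero>"
    have cR: "c \<in> carrier R" using c sE by blast
    have cnz: "c \<noteq> \<zero>"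
    proof
      assume "c = \<zero>"
      then show False using z gR one_not_zero by simp
    qed
    note ic = nonzero_inv[OF cR cnz]
    have icE: "inv c \<in> E" using subfield_m_inv(1)[OF E(1), of c] c cnz by simp
    have "inv c \<otimes> inv c \<otimes> (\<one> \<oplus> c \<otimes> c \<otimes> \<gamma>) = inv c \<otimes> inv c \<oplus> (c \<otimes> inv c) \<otimes> (c \<otimes> inv c) \<otimes> \<gamma>"
      using cR ic(1) gR by algebra
    then have "inv c \<otimes> inv c \<oplus> \<gamma> = \<zero>" using z ic gR by simp
    then have "\<gamma> = \<ominus> (inv c \<otimes> inv c)" using gR ic(1) by (metis m_closed minus_equality a_comm)
    then show False using g(2) sE(5,6) icE by metis
  qed
  obtain c V where c: "c \<in> simple_extension K t" and V: "valued_field R V" "simple_extension K t \<subseteq> V" "K \<subseteq> V" "Z \<subseteq> V"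
    "valued_field.veq R V c \<one>" "valued_field.veq R V \<gamma> \<one>" "valued_field.small R V (\<one> \<oplus> c \<otimes> c \<otimes> \<gamma>)"
    using exists_adapted_valuation[OF K t finZ ZR Zr gZ gnz] nz SE by blast
  interpret V: valued_field R V by fact
  have tV: "t \<in> V" using simple_extension_mem[OF subfieldE(1)[OF K] t(1)] V(2) by blast
  have cE: "c \<in> E" using c SE by blast
  have GV: "G \<subseteq> V" using V(4) unfolding Z_def by blast
  have Gd: "V.veq (a \<ominus> b) \<one>" if ab: "a \<in> G" "b \<in> G" "a \<noteq> b" for a b
  proof -
    have R: "a \<in> carrier R" "b \<in> carrier R" using ab G by blast+
    have n: "a \<ominus> b \<noteq> \<zero>" using ab r_right_minus_eq[OF R] by blast
    have "inv (a \<ominus> b) \<in> Z" unfolding Z_def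
      by (rule UnI2, rule image_eqI[of _ _ "(a, b)"]) (use ab in auto)
    then have "inv (a \<ominus> b) \<in> V" using V(4) by blast
    moreover have "a \<ominus> b \<in> V" using subring_minus[OF V.subring] GV ab by blast
    ultimately show ?thesis using V.unit_iff_inv_V[OF minus_closed[OF R] n] by blast
  qed
  \<comment> \<open>2 is a nonzero element of \<open>K\<close>, and a field contained in
    \<open>V\<close> consists of units apart from zero.\<close>
  have tw: "V.veq (\<one> \<oplus> \<one>) \<one>"
  proof -
    have "\<one> \<oplus> \<one> \<in> K" using sK by blast
    moreover have "inv (\<one> \<oplus> \<one>) \<in> K" using subfield_m_inv(1)[OF K, of "\<one> \<oplus> \<one>"] two calculation by simp
    ultimately show ?thesis using V.unit_iff_inv_V[OF _ two] V(3) by auto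
  qed
  have even: "\<exists>e\<in>E. V.veq (\<one> \<oplus> c \<otimes> c \<otimes> \<gamma>) (e \<otimes> e)"
    if c: "c \<in> E" "V.veq c \<one>" "V.small (\<one> \<oplus> c \<otimes> c \<otimes> \<gamma>)" for c
  proof -
    obtain b l where bl: "b \<in> E" "set l \<subseteq> E" "length l \<le> card G"
       "\<And>g. g \<in> G \<Longrightarrow> \<one> \<oplus> c \<otimes> c \<otimes> g = b \<otimes> (eval l g \<otimes> eval l g)"
      using rep[OF c(1)] by blast
    show ?thesis by (rule V.even_value[OF E(1) G(1) GV Gd G(3) g(1) c(1,2) bl c(3) nz[OF c(1)]])
  qed
  obtain p where p: "p \<in> carrier R"
    "\<And>e. \<lbrakk> e \<in> E; e \<noteq> \<zero>; V.small e \<rbrakk> \<Longrightarrow> V.vle p (e [^] D)"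
    "\<And>e. \<lbrakk> e \<in> E; e \<noteq> \<zero> \<rbrakk> \<Longrightarrow> \<exists>N::nat. \<not> V.vle (p [^] N) (e [^] D)"
    using V.finite_extension_discrete[OF K V(3) tV t(2) dim subfieldE(1)[OF E(1)]] by blast
  show False
    by (rule V.not_all_values_even[OF E(1) gR V(6) tw cE V(5) V(7) nz even p])
qed

section \<open>Simple extensions closed under square roots of $1 + x^2$\<close>

text \<open>If \<open>1 + x\<^sup>2\<close> is not a square in \<open>M\<close> and \<open>\<theta>\<^sup>2 = 1 + x\<^sup>2\<close>, then \<open>1 + (x / (1 + \<theta>))\<^sup>2\<close>
  is not a square in \<open>M(\<theta>)\<close>: multiplied by \<open>(1 + \<theta>)\<^sup>2\<close> it is \<open>2 (\<theta>\<^sup>2 + \<theta>)\<close>, whose norm to \<open>M\<close>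
  is \<open>4 x\<^sup>2 \<theta>\<^sup>2\<close>.\<close>

lemma nonpythagorean_step:
  assumes M: "subfield M R" and two: "\<one> \<oplus> \<one> \<noteq> \<zero>"
    and x: "x \<in> M" "\<not> (\<exists>y\<in>M. \<one> \<oplus> x \<otimes> x = y \<otimes> y)"
    and \<theta>: "\<theta> \<in> carrier R" "\<one> \<oplus> x \<otimes> x = \<theta> \<otimes> \<theta>"
  shows "subfield (simple_extension M \<theta>) R" "\<theta> \<notin> M"
    "\<exists>x'\<in>simple_extension M \<theta>. \<not> (\<exists>y\<in>simple_extension M \<theta>. \<one> \<oplus> x' \<otimes> x' = y \<otimes> y)"
proof -
  note sM = subringE[OF subfieldE(1)[OF M]]
  have xR: "x \<in> carrier R" using x sM by blast
  show tM: "\<theta> \<notin> M" using x(2) \<theta>(2) by blast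
  let ?N = "simple_extension M \<theta>"
  define d where "d = \<one> \<oplus> x \<otimes> x"
  have dM: "d \<in> M" unfolding d_def using sM x by blast
  have dR: "d \<in> carrier R" using dM sM by blast
  have tt: "\<theta> \<otimes> \<theta> = d" using \<theta> d_def by simp
  have poly: "[\<one>, \<zero>, \<ominus> d] \<in> carrier (M[X])"
    using sM dM one_not_zero by (auto simp: univ_poly_carrier[symmetric] polynomial_def)
  have "eval [\<one>, \<zero>, \<ominus> d] \<theta> = \<theta> \<otimes> \<theta> \<oplus> \<ominus> d" using \<theta>(1) dR by (simp add: numeral_2_eq_2)
  then have "eval [\<one>, \<zero>, \<ominus> d] \<theta> = \<zero>" using tt dR by (simp add: r_neg)
  then have "(algebraic over M) \<theta>" using algebraicI[OF poly] by simp
  then show N: "subfield ?N R" using simple_extension_is_subfield[OF M \<theta>(1)] by blast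
  note sN = subringE[OF subfieldE(1)[OF N]]
  have MN: "M \<subseteq> ?N" using simple_extension_incl[OF sM(1) \<theta>(1)] .
  have tN: "\<theta> \<in> ?N" using simple_extension_mem[OF subfieldE(1)[OF M] \<theta>(1)] .
  have form: "\<exists>a\<in>M. \<exists>b\<in>M. z = a \<oplus> b \<otimes> \<theta>" if "z \<in> ?N" for z
    using that
  proof (induction rule: simple_extension.induct)
    case zero
    then show ?case using sM(2) \<theta>(1) by (intro bexI[of _ \<zero>]) auto
  next
    case (lin k1 k2)
    then obtain a b where ab: "a \<in> M" "b \<in> M" "k1 = a \<oplus> b \<otimes> \<theta>" by blast
    have R: "a \<in> carrier R" "b \<in> carrier R" "k2 \<in> carrier R" using ab lin sM(1) by blast+
    have "k1 \<otimes> \<theta> \<oplus> k2 = (b \<otimes> (\<theta> \<otimes> \<theta>) \<oplus> k2) \<oplus> a \<otimes> \<theta>" unfolding ab(3) using R \<theta>(1) by algebra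
    then show ?case unfolding tt using ab(1,2) lin dM sM(6,7) by blast
  qed
  have coeff: "a = \<zero> \<and> b = \<zero>" if ab: "a \<in> M" "b \<in> M" "a \<oplus> b \<otimes> \<theta> = \<zero>" for a b
  proof -
    have R: "a \<in> carrier R" "b \<in> carrier R" using ab sM(1) by blast+
    have b0: "b = \<zero>"
    proof (rule ccontr)
      assume b: "b \<noteq> \<zero>"
      note ib = nonzero_inv[OF R(2) b]
      have "inv b \<in> M" using subfield_m_inv(1)[OF M, of b] ab b by simp
      then have "\<ominus> (inv b \<otimes> a) \<in> M" using ab sM(5,6) by blast
      moreover have "inv b \<otimes> (a \<oplus> b \<otimes> \<theta>) = inv b \<otimes> a \<oplus> (inv b \<otimes> b) \<otimes> \<theta>" using R ib(1) \<theta>(1) by algebra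
      then have "inv b \<otimes> a \<oplus> \<theta> = \<zero>" using ab ib \<theta>(1) by simp
      then have "\<theta> = \<ominus> (inv b \<otimes> a)" using R ib(1) \<theta>(1) by (metis m_closed minus_equality a_comm)
      ultimately show False using tM by simp
    qed
    then show ?thesis using ab R \<theta>(1) by simp
  qed
  have t1: "\<one> \<oplus> \<theta> \<noteq> \<zero>"
  proof
    assume "\<one> \<oplus> \<theta> = \<zero>"
    then have "\<theta> = \<ominus> \<one>" using \<theta>(1) by (metis minus_equality a_comm one_closed)
    then show False using tM sM(3,5) by simp
  qed
  have t1R: "\<one> \<oplus> \<theta> \<in> carrier R" using \<theta>(1) by simp
  note it = nonzero_inv[OF t1R t1]
  have itN: "inv (\<one> \<oplus> \<theta>) \<in> ?N" using subfield_m_inv(1)[OF N, of "\<one> \<oplus> \<theta>"] sN(3,7) tN t1 by simp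
  let ?x = "x \<otimes> inv (\<one> \<oplus> \<theta>)"
  have "\<not> (\<exists>y\<in>?N. \<one> \<oplus> ?x \<otimes> ?x = y \<otimes> y)"
  proof
    assume "\<exists>y\<in>?N. \<one> \<oplus> ?x \<otimes> ?x = y \<otimes> y"
    then obtain y where y: "y \<in> ?N" "\<one> \<oplus> ?x \<otimes> ?x = y \<otimes> y" by blast
    have yR: "y \<in> carrier R" using y sN by blast
    define z where "z = y \<otimes> (\<one> \<oplus> \<theta>)"
    have zN: "z \<in> ?N" unfolding z_def using y sN(3,6,7) tN by blast
    obtain a b where ab: "a \<in> M" "b \<in> M" "z = a \<oplus> b \<otimes> \<theta>" using form[OF zN] by blast
    have R: "a \<in> carrier R" "b \<in> carrier R" using ab sM(1) by blast+
    define i where "i = inv (\<one> \<oplus> \<theta>)"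
    have i: "i \<in> carrier R" "i \<otimes> (\<one> \<oplus> \<theta>) = \<one>" unfolding i_def using it by auto
    have "z \<otimes> z = (y \<otimes> y) \<otimes> ((\<one> \<oplus> \<theta>) \<otimes> (\<one> \<oplus> \<theta>))" unfolding z_def using yR t1R by algebra
    also have "y \<otimes> y = \<one> \<oplus> (x \<otimes> i) \<otimes> (x \<otimes> i)" using y(2) i_def by simp
    also have "(\<one> \<oplus> (x \<otimes> i) \<otimes> (x \<otimes> i)) \<otimes> ((\<one> \<oplus> \<theta>) \<otimes> (\<one> \<oplus> \<theta>)) =
      (\<one> \<oplus> \<theta>) \<otimes> (\<one> \<oplus> \<theta>) \<oplus> x \<otimes> x \<otimes> ((i \<otimes> (\<one> \<oplus> \<theta>)) \<otimes> (i \<otimes> (\<one> \<oplus> \<theta>)))"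
      using xR i(1) \<theta>(1) by algebra
    also have "\<dots> = (\<one> \<oplus> x \<otimes> x) \<oplus> \<theta> \<otimes> \<theta> \<oplus> (\<one> \<oplus> \<one>) \<otimes> \<theta>" unfolding i(2) using xR \<theta>(1) by algebra
    also have "\<dots> = d \<oplus> d \<oplus> (\<one> \<oplus> \<one>) \<otimes> \<theta>" unfolding tt d_def[symmetric] ..
    finally have zz: "z \<otimes> z = d \<oplus> d \<oplus> (\<one> \<oplus> \<one>) \<otimes> \<theta>" .
    have "z \<otimes> z = (a \<otimes> a \<oplus> b \<otimes> b \<otimes> (\<theta> \<otimes> \<theta>)) \<oplus> (\<one> \<oplus> \<one>) \<otimes> (a \<otimes> b) \<otimes> \<theta>" unfolding ab(3) using R \<theta>(1) by algebra
    then have zz2: "z \<otimes> z = (a \<otimes> a \<oplus> b \<otimes> b \<otimes> d) \<oplus> (\<one> \<oplus> \<one>) \<otimes> (a \<otimes> b) \<otimes> \<theta>" unfolding tt .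
    let ?u = "(a \<otimes> a \<oplus> b \<otimes> b \<otimes> d) \<ominus> (d \<oplus> d)" and ?v = "(\<one> \<oplus> \<one>) \<otimes> (a \<otimes> b \<ominus> \<one>)"
    have "?u \<oplus> ?v \<otimes> \<theta> = ((a \<otimes> a \<oplus> b \<otimes> b \<otimes> d) \<oplus> (\<one> \<oplus> \<one>) \<otimes> (a \<otimes> b) \<otimes> \<theta>) \<ominus> (d \<oplus> d \<oplus> (\<one> \<oplus> \<one>) \<otimes> \<theta>)"
      using R dR \<theta>(1) by algebra
    also have "\<dots> = \<zero>" unfolding zz2[symmetric] zz[symmetric] using zN sN(1) by (simp add: a_minus_def r_neg subset_iff)
    finally have uv: "?u \<oplus> ?v \<otimes> \<theta> = \<zero>" .
    have uvM: "?u \<in> M" "?v \<in> M"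
      using subring_minus[OF subfieldE(1)[OF M]] sM(3,6,7) ab dM by simp_all
    have u0: "?u = \<zero>" and v0: "?v = \<zero>" using coeff[OF uvM uv] by auto
    have ab1: "a \<otimes> b = \<one>"
      using v0 two R r_right_minus_eq[of "a \<otimes> b" \<one>] integral_iff[of "\<one> \<oplus> \<one>" "a \<otimes> b \<ominus> \<one>"] by simp
    have sd: "a \<otimes> a \<oplus> b \<otimes> b \<otimes> d = d \<oplus> d" using u0 R dR r_right_minus_eq by simp
    \<comment> \<open>The norm of z = a + b \<theta>. Comparing coefficients in z^2 = 2 d + 2
      \<theta> gave a b = 1 and a^2 + b^2 d = 2 d, so the norm squares to 4 d^2 - 4 d = 4 d x^2, and
      d = (n / (2 x))^2 would be a square in \<open>M\<close>.\<close>
    let ?n = "a \<otimes> a \<ominus> b \<otimes> b \<otimes> d"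
    have "?n \<otimes> ?n = (a \<otimes> a \<oplus> b \<otimes> b \<otimes> d) \<otimes> (a \<otimes> a \<oplus> b \<otimes> b \<otimes> d) \<ominus> (\<one> \<oplus> \<one>) \<otimes> (\<one> \<oplus> \<one>) \<otimes> ((a \<otimes> b) \<otimes> (a \<otimes> b)) \<otimes> d"
      using R dR by algebra
    also have "\<dots> = (\<one> \<oplus> \<one>) \<otimes> (\<one> \<oplus> \<one>) \<otimes> (d \<otimes> (d \<ominus> \<one>))" unfolding sd ab1 using dR by algebra
    also have "d \<ominus> \<one> = x \<otimes> x" unfolding d_def using xR by algebra
    finally have nn: "?n \<otimes> ?n = (\<one> \<oplus> \<one>) \<otimes> (\<one> \<oplus> \<one>) \<otimes> (d \<otimes> (x \<otimes> x))" .
    have xnz: "x \<noteq> \<zero>"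
    proof
      assume "x = \<zero>"
      then have "\<one> \<oplus> x \<otimes> x = \<one> \<otimes> \<one>" by simp
      then show False using x(2) sM(3) by blast
    qed
    have wnz: "(\<one> \<oplus> \<one>) \<otimes> x \<noteq> \<zero>" using two xnz xR by (simp add: integral_iff)
    have wR: "(\<one> \<oplus> \<one>) \<otimes> x \<in> carrier R" using xR by simp
    define j where "j = inv ((\<one> \<oplus> \<one>) \<otimes> x)"
    have j: "j \<in> carrier R" "j \<otimes> ((\<one> \<oplus> \<one>) \<otimes> x) = \<one>" unfolding j_def using nonzero_inv[OF wR wnz] by auto
    have jM: "j \<in> M" unfolding j_def using subfield_m_inv(1)[OF M, of "(\<one> \<oplus> \<one>) \<otimes> x"] wnz x sM(3,6,7) by simp
    have "(?n \<otimes> j) \<otimes> (?n \<otimes> j) = (?n \<otimes> ?n) \<otimes> (j \<otimes> j)" using R dR j(1) by algebra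
    also have "\<dots> = d \<otimes> ((j \<otimes> ((\<one> \<oplus> \<one>) \<otimes> x)) \<otimes> (j \<otimes> ((\<one> \<oplus> \<one>) \<otimes> x)))" unfolding nn using dR xR j(1) by algebra
    also have "\<dots> = d" unfolding j(2) using dR by simp
    finally have "d = (?n \<otimes> j) \<otimes> (?n \<otimes> j)" by simp
    moreover have "?n \<otimes> j \<in> M" using subring_minus[OF subfieldE(1)[OF M]] sM(6) ab dM jM by simp
    ultimately show False using x(2) unfolding d_def[symmetric] by blast
  qed
  moreover have "?x \<in> ?N" using sN(6) MN x(1) itN by blast
  ultimately show "\<exists>x'\<in>?N. \<not> (\<exists>y\<in>?N. \<one> \<oplus> x' \<otimes> x' = y \<otimes> y)" by blast
qed

text \<open>A counterexample \<open>N\<close> would grow forever inside \<open>F\<close>: adjoining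
  the missing root gives, by \<open>nonpythagorean_step\<close>, a strictly larger field with the
  same defect. Recording one new root per stage yields lists of every length that are independent
  over \<open>F0\<close>.\<close>

lemma pythagorean_descends:
  assumes F0: "subfield F0 R" and F: "subfield F R" "finite_dimension F0 F" and two: "\<one> \<oplus> \<one> \<noteq> \<zero>"
    and pyth: "\<And>x. x \<in> F \<Longrightarrow> \<exists>y\<in>F. \<one> \<oplus> x \<otimes> x = y \<otimes> y"
    and N: "subfield N R" "F0 \<subseteq> N" "N \<subseteq> F" and x: "x \<in> N"
  shows "\<exists>y\<in>N. \<one> \<oplus> x \<otimes> x = y \<otimes> y"
proof (rule ccontr)
  assume n: "\<not> (\<exists>y\<in>N. \<one> \<oplus> x \<otimes> x = y \<otimes> y)"
  define bad where "bad M \<longleftrightarrow> subfield M R \<and> F0 \<subseteq> M \<and> M \<subseteq> F \<and> (\<exists>x\<in>M. \<not> (\<exists>y\<in>M. \<one> \<oplus> x \<otimes> x = y \<otimes> y))" for M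
  have "\<exists>M Us. bad M \<and> independent F0 Us \<and> set Us \<subseteq> M \<and> length Us = m" for m
  proof (induction m)
    case 0
    have "bad N" unfolding bad_def using N x n by blast
    then show ?case by (intro exI[of _ N] exI[of _ "[]"]) simp
  next
    case (Suc m)
    then obtain M Us where M: "bad M" "independent F0 Us" "set Us \<subseteq> M" "length Us = m" by blast
    have sub: "subfield M R" "F0 \<subseteq> M" "M \<subseteq> F" using M(1) unfolding bad_def by blast+
    obtain z where z: "z \<in> M" "\<not> (\<exists>y\<in>M. \<one> \<oplus> z \<otimes> z = y \<otimes> y)" using M(1) unfolding bad_def by blast
    obtain \<theta> where th: "\<theta> \<in> F" "\<one> \<oplus> z \<otimes> z = \<theta> \<otimes> \<theta>" using pyth[of z] z(1) sub(3) by blast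
    have thR: "\<theta> \<in> carrier R" using th(1) subringE(1)[OF subfieldE(1)[OF F(1)]] by blast
    note step = nonpythagorean_step[OF sub(1) two z thR th(2)]
    have MR: "M \<subseteq> carrier R" using subringE(1)[OF subfieldE(1)[OF sub(1)]] .
    have incl: "M \<subseteq> simple_extension M \<theta>" using simple_extension_incl[OF MR thR] .
    have mem: "\<theta> \<in> simple_extension M \<theta>" using simple_extension_mem[OF subfieldE(1)[OF sub(1)] thR] .
    have "simple_extension M \<theta> \<subseteq> F" using simple_extension_subring_incl[OF subfieldE(1)[OF F(1)] sub(3) th(1)] .
    then have b: "bad (simple_extension M \<theta>)" unfolding bad_def using step(1,3) sub(2) incl by blast
    have UR: "set Us \<subseteq> carrier R" using M(3) MR by blast
    have "Span F0 Us \<subseteq> M"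
    proof
      fix v assume "v \<in> Span F0 Us"
      then obtain Ks where Ks: "set Ks \<subseteq> F0" "v = combine Ks Us"
        using Span_eq_combine_set[OF F0 UR] by blast
      have "combine Ks Us \<in> M" using Ks(1) M(3)
      proof (induction Ks Us rule: combine.induct)
        case (1 k Ks u Us)
        then show ?case using subringE(6,7)[OF subfieldE(1)[OF sub(1)]] sub(2) by auto
      qed (use subringE(2)[OF subfieldE(1)[OF sub(1)]] in auto)
      then show "v \<in> M" using Ks by simp
    qed
    then have "independent F0 (\<theta> # Us)" using step(2) M(2) thR by (intro li_Cons) auto
    moreover have "set (\<theta> # Us) \<subseteq> simple_extension M \<theta>" using mem incl M(3) by auto
    ultimately show ?case using b M(4) by (intro exI[of _ "simple_extension M \<theta>"] exI[of _ "\<theta> # Us"]) simp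
  qed
  moreover obtain D where D: "dimension D F0 F" using F(2) by blast
  ultimately obtain M Us where M: "bad M" "independent F0 Us" "set Us \<subseteq> M" "length Us = Suc D" by blast
  have "set Us \<subseteq> F" using M(1,3) unfolding bad_def by blast
  then show False using independent_length_le_dimension[OF F0 D M(2)] M(4) by simp
qed

section \<open>Conjugates with distinct squares and representations by powers of one element\<close>

text \<open>The case of \<open>small_coeffs\<close> in which the valuation ring is the whole field:
  small elements are zero, and differences of distinct points are units.\<close>

lemma vanishing_polynomial:
  assumes "finite G" "G \<subseteq> carrier R" "set l \<subseteq> carrier R" "length l \<le> card G" "\<And>g. g \<in> G \<Longrightarrow> eval l g = \<zero>"
  shows "\<forall>a\<in>set l. a = \<zero>"
proof -
  have "valued_field R (carrier R)"
    by (rule valued_field.intro[OF field_axioms valued_field_axioms.intro[OF carrier_is_subring]]) simp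
  then interpret V: valued_field R "carrier R" .
  have unit: "V.veq x \<one>" if "x \<in> carrier R" "x \<noteq> \<zero>" for x
    using V.unit_iff_inv_V[OF that] nonzero_inv[OF that] that by simp
  have "V.veq (g \<ominus> h) \<one>" if "g \<in> G" "h \<in> G" "g \<noteq> h" for g h
  proof (rule unit)
    have gh: "g \<in> carrier R" "h \<in> carrier R" using that assms(2) by blast+
    show "g \<ominus> h \<in> carrier R" using gh by simp
    show "g \<ominus> h \<noteq> \<zero>" using r_right_minus_eq[OF gh] that(3) by simp
  qed
  then have "\<forall>a\<in>set l. V.small a"
    by (rule V.small_coeffs[OF assms(1,2) _ assms(3,4)]) (use assms(5) V.small_zero in simp)+
  moreover have "x = \<zero>" if "V.small x" for x
    using that unit V.veq_one_small V.small_carrier by blast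
  ultimately show ?thesis by blast
qed

lemma transcendental_imp_infinite:
  assumes K: "subfield K R" and t: "t \<in> carrier R" "transcendental K t" and E: "subring E R" "K \<subseteq> E" "t \<in> E"
  shows "infinite E"
proof
  assume fin: "finite E"
  let ?m = "\<lambda>n::nat. monom \<one> n"
  have mK: "?m n \<in> carrier (K[X])" for n
    using monom_is_polynomial[of K \<one> n] subringE(3)[OF subfieldE(1)[OF K]] subfieldE(1)[OF K] one_not_zero univ_poly_carrier by blast
  have "inj ?m"
  proof (rule injI)
    fix a b :: nat assume "monom \<one> a = monom \<one> b"
    then have "length (monom \<one> a) = length (monom \<one> b)" by simp
    then show "a = b" unfolding monom_def by simp
  qed
  then have "infinite (range ?m)" by (rule range_inj_infinite)
  moreover have "inj_on (\<lambda>p. eval p t) (range ?m)"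
    using t(2) mK unfolding transcendental_def by (meson image_subsetI inj_on_subset)
  ultimately have "infinite ((\<lambda>p. eval p t) ` range ?m)" using finite_imageD by blast
  moreover have "(\<lambda>p. eval p t) ` range ?m \<subseteq> E"
  proof
    fix x assume "x \<in> (\<lambda>p. eval p t) ` range ?m"
    then obtain n where x: "x = eval (?m n) t" by auto
    have "set (?m n) \<subseteq> E" using mK[of n] polynomial_incl univ_poly_carrier E(2) by blast
    then show "x \<in> E" using subring_eval[OF E(1) _ E(3)] x by blast
  qed
  ultimately show False using fin finite_subset by blast
qed

text \<open>Two squares agree only if a = b or j = -(a + b) / 2, so finitely many \<open>j\<close>
  are excluded. Applied to the conjugates of \<alpha>, this preserves their number when passing to
  squares.\<close>

lemma exists_squares_distinct:
  assumes A: "finite A" "A \<subseteq> carrier R" and two: "\<one> \<oplus> \<one> \<noteq> \<zero>" and E: "infinite E" "E \<subseteq> carrier R"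
  shows "\<exists>j\<in>E. inj_on (\<lambda>a. (a \<oplus> j) \<otimes> (a \<oplus> j)) A"
proof -
  let ?B = "(\<lambda>(a, b). \<ominus> (inv (\<one> \<oplus> \<one>) \<otimes> (a \<oplus> b))) ` (A \<times> A)"
  have "finite ?B" using A by simp
  then obtain j where j: "j \<in> E" "j \<notin> ?B" using E(1) finite_subset[of E ?B] by blast
  have jR: "j \<in> carrier R" using j E by blast
  have hR: "\<one> \<oplus> \<one> \<in> carrier R" by simp
  note ih = nonzero_inv[OF hR two]
  have "inj_on (\<lambda>a. (a \<oplus> j) \<otimes> (a \<oplus> j)) A"
  proof (rule inj_onI)
    fix a b assume ab: "a \<in> A" "b \<in> A" "(a \<oplus> j) \<otimes> (a \<oplus> j) = (b \<oplus> j) \<otimes> (b \<oplus> j)"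
    have R: "a \<in> carrier R" "b \<in> carrier R" using ab A by blast+
    have "(a \<ominus> b) \<otimes> ((a \<oplus> b) \<oplus> (\<one> \<oplus> \<one>) \<otimes> j) = (a \<oplus> j) \<otimes> (a \<oplus> j) \<ominus> (b \<oplus> j) \<otimes> (b \<oplus> j)" using R jR by algebra
    also have "\<dots> = \<zero>" using ab(3) R jR by (simp add: a_minus_def r_neg)
    finally have "a \<ominus> b = \<zero> \<or> (a \<oplus> b) \<oplus> (\<one> \<oplus> \<one>) \<otimes> j = \<zero>"
      by (rule integral) (use R jR in auto)
    then show "a = b"
    proof
      assume "a \<ominus> b = \<zero>"
      then show ?thesis using r_right_minus_eq[OF R] by simp
    next
      assume z: "(a \<oplus> b) \<oplus> (\<one> \<oplus> \<one>) \<otimes> j = \<zero>"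
      define i where "i = inv (\<one> \<oplus> \<one>)"
      have i: "i \<in> carrier R" "i \<otimes> (\<one> \<oplus> \<one>) = \<one>" unfolding i_def using ih by auto
      have "i \<otimes> ((a \<oplus> b) \<oplus> (\<one> \<oplus> \<one>) \<otimes> j) = i \<otimes> (a \<oplus> b) \<oplus> (i \<otimes> (\<one> \<oplus> \<one>)) \<otimes> j" using R jR i(1) by algebra
      then have "i \<otimes> (a \<oplus> b) \<oplus> j = \<zero>" using z i jR by simp
      then have "j = \<ominus> (i \<otimes> (a \<oplus> b))" using R i(1) jR by (metis m_closed a_closed minus_equality a_comm)
      then have "j \<in> ?B" unfolding i_def using ab(1,2) by (intro image_eqI[of _ _ "(a, b)"]) auto
      then show ?thesis using j by blast
    qed
  qed
  then show ?thesis using j by blast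
qed

lemma power_basis_rep:
  assumes K: "subfield K R" and g: "\<gamma> \<in> carrier R" and dim: "dimension n K N" and N: "subring N R" "\<gamma> \<in> N"
    and ind: "\<And>l. \<lbrakk> set l \<subseteq> K; length l \<le> n; eval l \<gamma> = \<zero> \<rbrakk> \<Longrightarrow> \<forall>a\<in>set l. a = \<zero>"
    and x: "x \<in> N"
  shows "\<exists>l. set l \<subseteq> K \<and> length l = n \<and> eval l \<gamma> = x"
proof -
  let ?U = "exp_base \<gamma> n"
  have UR: "set ?U \<subseteq> carrier R" using exp_base_closed[OF g] .
  have len: "length ?U = n" unfolding exp_base_def by simp
  have UN: "set ?U \<subseteq> N" unfolding exp_base_def using subring_pow[OF N] by auto
  note sK = subringE[OF subfieldE(1)[OF K]]
  have "independent K ?U"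
  proof (rule trivial_combine_imp_independent[OF K UR])
    fix Ks assume Ks: "set Ks \<subseteq> K" "combine Ks ?U = \<zero>"
    \<comment> \<open>The criterion admits lists of any length, and \<open>combine\<close> ignores
      surplus entries on either side; cutting or padding to length \<open>n\<close> makes
      \<open>ind\<close> applicable.\<close>
    let ?Ks = "take n (Ks @ replicate n \<zero>)"
    have "combine ?Ks ?U = combine (Ks @ replicate n \<zero>) ?U" using combine_take[of ?U "Ks @ replicate n \<zero>"] len by simp
    also have "\<dots> = \<zero>" using combine_append_replicate[OF UR] Ks(2) by simp
    finally have "combine ?Ks ?U = \<zero>" .
    moreover have "length ?Ks = n" by simp
    ultimately have e0: "eval ?Ks \<gamma> = \<zero>" using combine_eq_eval[of ?Ks \<gamma>] by metis
    have lk: "length ?Ks \<le> n" by simp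
    have "set ?Ks \<subseteq> K" using Ks(1) sK(2) set_take_subset[of n "Ks @ replicate n \<zero>"] by auto
    then have z: "\<forall>a\<in>set ?Ks. a = \<zero>" by (rule ind[OF _ lk e0])
    have sub: "set (take n Ks) \<subseteq> set ?Ks" by simp
    have "x = \<zero>" if x: "x \<in> set (take n Ks)" for x using bspec[OF z subsetD[OF sub x]] .
    then show "set (take (length ?U) Ks) \<subseteq> {\<zero>}" unfolding len by auto
  qed
  then have "Span K ?U = N" using independent_length_eq_dimension[OF K dim _ UN] len by blast
  then obtain Ks where "x = combine Ks ?U" "length Ks = length ?U" "set Ks \<subseteq> K"
    using Span_eq_combine_set_length_version[OF K UR] x by blast
  then show ?thesis using combine_eq_eval[of Ks \<gamma>] len by auto
qed

text \<open>A relation expressing \<gamma>^n by lower powers reduces every polynomial in \<gamma> to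
  \<open>n\<close> coefficients. Only the coefficients of this one relation must lie in the base
  field, which tells how large \<open>E1\<close> has to be.\<close>

lemma monic_relation_rep:
  assumes E: "subfield E R" and g: "\<gamma> \<in> carrier R" and a: "set a \<subseteq> E" "length a = n" "1 \<le> n" "eval a \<gamma> = \<gamma> [^] n"
    and x: "x \<in> simple_extension E \<gamma>"
  shows "\<exists>l. set l \<subseteq> E \<and> length l = n \<and> eval l \<gamma> = x"
  using x
proof (induction rule: simple_extension.induct)
  case zero
  then show ?case using eval_replicate_zero[OF g, of n] subringE(2)[OF subfieldE(1)[OF E]]
    by (intro exI[of _ "replicate n \<zero>"]) auto
next
  case (lin k1 k2)
  note sE = subringE[OF subfieldE(1)[OF E]]
  obtain l where l: "set l \<subseteq> E" "length l = n" "eval l \<gamma> = k1" using lin by blast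
  obtain b l' where bl: "l = b # l'" using l(2) a(3) by (cases l) auto
  have aR: "set a \<subseteq> carrier R" using a(1) sE(1) by blast
  have R: "b \<in> carrier R" "k2 \<in> carrier R" "set l' \<subseteq> carrier R" using l(1) bl lin sE(1) by auto
  have k1: "k1 = b \<otimes> \<gamma> [^] (n - 1) \<oplus> eval l' \<gamma>" using l bl by auto
  have c: "eval l' \<gamma> \<in> carrier R" using eval_in_carrier[OF R(3) g] .
  have gn: "\<gamma> [^] (n - 1) \<otimes> \<gamma> = \<gamma> [^] n" using a(3) by (metis Suc_diff_1 less_le_trans nat_pow_Suc zero_less_one)
  let ?m = "map (\<lambda>x. b \<otimes> x) a"
  have mR: "set ?m \<subseteq> carrier R" using aR R by auto
  have lk: "length ?m = length (l' @ [k2])" using a(2) l(2) bl by simp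
  have "eval (map2 (\<oplus>) ?m (l' @ [k2])) \<gamma> = b \<otimes> \<gamma> [^] n \<oplus> (eval l' \<gamma> \<otimes> \<gamma> \<oplus> k2)"
    using eval_map2_add[OF lk mR _ g] R eval_smult[OF R(1) aR g] a(4) eval_append_aux[OF R(3,2) g] by simp
  also have "\<dots> = (b \<otimes> \<gamma> [^] (n - 1) \<oplus> eval l' \<gamma>) \<otimes> \<gamma> \<oplus> k2"
    unfolding gn[symmetric] using R c g nat_pow_closed[OF g, of "n - 1"] by algebra
  finally have e: "eval (map2 (\<oplus>) ?m (l' @ [k2])) \<gamma> = k1 \<otimes> \<gamma> \<oplus> k2" unfolding k1 .
  have "set (map2 (\<oplus>) ?m (l' @ [k2])) \<subseteq> E"
  proof
    fix z assume "z \<in> set (map2 (\<oplus>) ?m (l' @ [k2]))"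
    then have "z \<in> (\<lambda>(s, t). s \<oplus> t) ` set (zip ?m (l' @ [k2]))" by (simp only: set_map)
    then obtain st where st: "st \<in> set (zip ?m (l' @ [k2]))" "z = (case st of (s, t) \<Rightarrow> s \<oplus> t)" by (rule imageE)
    obtain s t where "st = (s, t)" by (cases st)
    then have zst: "(s, t) \<in> set (zip ?m (l' @ [k2]))" "z = s \<oplus> t" using st by simp_all
    have bE: "b \<in> E" "set l' \<subseteq> E" using l(1) bl by auto
    have "s \<in> set ?m" using set_zip_leftD[OF zst(1)] .
    then have sE': "s \<in> E" using bE a(1) sE(6) by auto
    have "t \<in> set (l' @ [k2])" using set_zip_rightD[OF zst(1)] .
    then have "t \<in> E" using bE lin(2) by auto
    then show "z \<in> E" unfolding zst(2) using sE(7) sE' by blast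
  qed
  moreover have "length (map2 (\<oplus>) ?m (l' @ [k2])) = n" using lk a(2) by simp
  ultimately show ?case using e by blast
qed

lemma no_pythagorean_simple_extension:
  assumes K: "subfield K R" and t: "t \<in> carrier R" "transcendental K t"
    and E: "subfield E R" "K \<subseteq> E" "t \<in> E" "finite_dimension (generate_field R (insert t K)) E"
    and two: "\<one> \<oplus> \<one> \<noteq> \<zero>"
    and F: "subfield F R" "E \<subseteq> F" and gal: "\<And>w. w \<in> F \<Longrightarrow> split_separable E F w"
    and al: "\<alpha> \<in> carrier R" "\<alpha> \<notin> F" "split_separable F (carrier R) \<alpha>"
    and pyth: "\<And>x. x \<in> simple_extension F \<alpha> \<Longrightarrow> \<exists>y\<in>simple_extension F \<alpha>. \<one> \<oplus> x \<otimes> x = y \<otimes> y"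
  shows False
proof -
  note sE = subringE[OF subfieldE(1)[OF E(1)]] and sF = subringE[OF subfieldE(1)[OF F(1)]]
  let ?Q = "generate_field R (insert t K)"
  have tK: "insert t K \<subseteq> carrier R" using t subringE(1)[OF subfieldE(1)[OF K]] by simp
  have Q: "subfield ?Q R" using generate_field_is_subfield[OF tK] .
  have QE: "?Q \<subseteq> E" using generate_field_min_subfield1[OF tK E(1)] E(2,3) by blast
  let ?N = "simple_extension F \<alpha>"
  have algA: "(algebraic over F) \<alpha>" using split_separable_algebraic[OF al(3)] .
  have N: "subfield ?N R" using simple_extension_is_subfield[OF F(1) al(1)] algA by blast
  note sN = subringE[OF subfieldE(1)[OF N]]
  have FN: "F \<subseteq> ?N" using simple_extension_incl[OF sF(1) al(1)] .
  have aN: "\<alpha> \<in> ?N" using simple_extension_mem[OF subfieldE(1)[OF F(1)] al(1)] .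
  note I = IrrE[OF F(1) al(1) algA]
  define n where "n = degree (Irr F \<alpha>)"
  have dimN: "dimension n F ?N" unfolding n_def using dimension_simple_extension[OF F(1) al(1) algA] .
  have IR: "Irr F \<alpha> \<in> carrier (poly_ring R)" using carrier_polynomial_shell[OF subfieldE(1)[OF F(1)] I(1)] .
  have nil: "Irr F \<alpha> \<noteq> []" and dge: "n \<ge> 1" using pirreducible_degree[OF F(1) I(1,2)] unfolding n_def by auto
  have "n \<noteq> 1"
  proof
    assume "n = 1"
    then have "length (Irr F \<alpha>) = Suc (Suc 0)" unfolding n_def by simp
    then obtain a b where ab: "Irr F \<alpha> = [a, b]" by (metis length_0_conv length_Suc_conv)
    have a1: "a = \<one>" using I(3) ab by simp
    have bF: "b \<in> F" using polynomial_incl[of F "Irr F \<alpha>"] I(1) ab unfolding univ_poly_carrier[symmetric] by simp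
    have bR: "b \<in> carrier R" using bF sF(1) by blast
    have "\<alpha> \<oplus> b = \<zero>" using I(4) ab a1 al(1) bR by simp
    then have "\<alpha> = \<ominus> b" using al(1) bR by (metis minus_equality)
    then show False using al(2) sF(5)[OF bF] by simp
  qed
  then have n2: "2 \<le> n" using dge by simp
  define A where "A = {y \<in> carrier R. eval (Irr F \<alpha>) y = \<zero>}"
  note sp = split_separable_Irr[OF F(1) al(1) al(3)]
  have finA: "finite A" unfolding A_def by (rule card_simple_roots(1)[OF IR nil sp(1) sp(2)])
  have cardA: "card A = n" unfolding A_def n_def by (rule card_simple_roots(2)[OF IR nil sp(1) sp(2)])
  have AR: "A \<subseteq> carrier R" unfolding A_def by blast
  have aA: "\<alpha> \<in> A" unfolding A_def using I(4) al(1) by blast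
  have infE: "infinite E" using transcendental_imp_infinite[OF K t subfieldE(1)[OF E(1)] E(2,3)] .
  obtain j where j: "j \<in> E" "inj_on (\<lambda>a. (a \<oplus> j) \<otimes> (a \<oplus> j)) A"
    using exists_squares_distinct[OF finA AR two infE sE(1)] by blast
  have jR: "j \<in> carrier R" and jF: "j \<in> F" using j sE(1) F(2) by blast+
  define sq where "sq a = (a \<oplus> j) \<otimes> (a \<oplus> j)" for a
  define G where "G = sq ` A"
  define \<gamma> where "\<gamma> = sq \<alpha>"
  have finG: "finite G" and cardG: "card G = n" and GR: "G \<subseteq> carrier R" and gG: "\<gamma> \<in> G"
    using finA cardA AR aA j(2) jR card_image[OF j(2)] unfolding G_def \<gamma>_def sq_def by auto
  have gR: "\<gamma> \<in> carrier R" using gG GR by blast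
  have ajN: "\<alpha> \<oplus> j \<in> ?N" using sN(7)[OF aN] FN jF by blast
  have gN: "\<gamma> \<in> ?N" unfolding \<gamma>_def sq_def using sN(6)[OF ajN ajN] .
  \<comment> \<open>A homomorphism over \<open>F\<close> that sends \<alpha> to \<open>a\<close>
    sends \<gamma> = (\<alpha> + j)^2 to (a + j)^2, as \<open>j\<close> lies in \<open>F\<close>. It
    will carry identities in \<gamma> to all of \<open>G\<close>.\<close>
  have conj: "\<exists>h. h \<in> ring_hom (R\<lparr>carrier := ?N\<rparr>) R \<and> (\<forall>x\<in>F. h x = x) \<and> h \<gamma> = g" if g: "g \<in> G" for g
  proof -
    obtain a where a: "a \<in> A" "g = sq a" using g unfolding G_def by blast
    have aR: "a \<in> carrier R" "eval (map (\<lambda>x. x) (Irr F \<alpha>)) a = \<zero>" using a unfolding A_def by simp_all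
    have idh: "(\<lambda>x. x) \<in> ring_hom (R\<lparr>carrier := F\<rparr>) R" by (rule ring_hom_memI) (use sF(1) in auto)
    obtain h where h: "h \<in> ring_hom (R\<lparr>carrier := ?N\<rparr>) R" "\<And>m. m \<in> F \<Longrightarrow> h m = m" "h \<alpha> = a"
      using extend_hom_simple[OF field_axioms F(1) idh al(1) algA aR] by blast
    have "h (\<alpha> \<oplus> j) = a \<oplus> j" using ring_hom_add[OF h(1), of \<alpha> j] aN FN jF h(2,3) by auto
    then have "h \<gamma> = g" unfolding \<gamma>_def a(2) sq_def using ring_hom_mult[OF h(1), of "\<alpha> \<oplus> j" "\<alpha> \<oplus> j"] ajN by simp
    then show ?thesis using h by blast
  qed
  have transfer: "h (eval l \<gamma>) = eval l (h \<gamma>)"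
    if h: "h \<in> ring_hom (R\<lparr>carrier := ?N\<rparr>) R" "\<forall>x\<in>F. h x = x" and l: "set l \<subseteq> F" for h l
  proof -
    interpret H: ring_hom_ring "R\<lparr>carrier := ?N\<rparr>" R h
      by (rule ring_hom_ringI2[OF subring_is_ring[OF subfieldE(1)[OF N]] is_ring h(1)])
    have "map h l = l" using h(2) l by (meson map_idI subsetD)
    moreover have "set l \<subseteq> ?N" using l FN by blast
    ultimately show ?thesis
      using H.eval_hom'[of \<gamma> l] gN eval_consistent[OF subfieldE(1)[OF N]] by simp
  qed
  have hom0: "h \<zero> = \<zero>" if h: "h \<in> ring_hom (R\<lparr>carrier := ?N\<rparr>) R" for h
  proof -
    interpret H: ring_hom_ring "R\<lparr>carrier := ?N\<rparr>" R h
      by (rule ring_hom_ringI2[OF subring_is_ring[OF subfieldE(1)[OF N]] is_ring h(1)])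
    show ?thesis using H.hom_zero by simp
  qed
  have vanish: "eval l g = \<zero>" if l: "set l \<subseteq> F" "eval l \<gamma> = \<zero>" and g: "g \<in> G" for l g
  proof -
    obtain h where h: "h \<in> ring_hom (R\<lparr>carrier := ?N\<rparr>) R" "\<forall>x\<in>F. h x = x" "h \<gamma> = g" using conj[OF g] by blast
    show ?thesis using transfer[OF h(1,2) l(1)] l(2) h(3) hom0[OF h(1)] by simp
  qed
  \<comment> \<open>A polynomial over \<open>F\<close> that kills \<gamma> kills its
    \<open>n\<close> distinct conjugates. So the first \<open>n\<close> powers of \<gamma> are
    independent over \<open>F\<close> and, by dimension, form a basis of F(\<alpha>).\<close>
  have ind: "\<forall>a\<in>set l. a = \<zero>" if l: "set l \<subseteq> F" "length l \<le> n" "eval l \<gamma> = \<zero>" for l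
    using vanishing_polynomial[OF finG GR _ _ vanish[OF l(1,3)]] l(1,2) sF(1) cardG by blast
  have repF: "\<exists>l. set l \<subseteq> F \<and> length l = n \<and> eval l \<gamma> = x" if "x \<in> ?N" for x
    using power_basis_rep[OF F(1) gR dimN subfieldE(1)[OF N] gN ind that] by blast
  \<comment> \<open>Adjoining these finitely many algebraic coefficients to \<open>E\<close> gives
    the field \<open>E1\<close>, finite over K(t). Elements of E1(\<gamma>) then have
    \<open>n\<close> coefficients over \<open>E1\<close>, and \<gamma> keeps degree \<open>n\<close>
    because \<open>ind\<close> holds even over \<open>F\<close>.\<close>
  obtain a where a: "set a \<subseteq> F" "length a = n" "eval a \<gamma> = \<gamma> [^] n"
    using repF[OF subring_pow[OF subfieldE(1)[OF N] gN, of n]] by blast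
  have aR: "set a \<subseteq> carrier R" using a(1) sF(1) by blast
  have algaE: "(algebraic over E) x" if "x \<in> set a" for x
    using split_separable_algebraic[OF gal] a(1) that by blast
  define E1 where "E1 = finite_extension E a"
  have E1: "subfield E1 R" unfolding E1_def using finite_extension_is_subfield[OF E(1) aR algaE] .
  have finE1: "finite_dimension E E1" unfolding E1_def using finite_extension_finite_dimension(1)[OF E(1) aR algaE] .
  have EE1: "E \<subseteq> E1" unfolding E1_def using finite_extension_incl[OF sE(1) aR] .
  have aE1: "set a \<subseteq> E1" unfolding E1_def using finite_extension_mem[OF subfieldE(1)[OF E(1)] aR] .
  have E1F: "E1 \<subseteq> F" unfolding E1_def using finite_extension_subring_incl[OF subfieldE(1)[OF F(1)] F(2) a(1)] .
  note sE1 = subringE[OF subfieldE(1)[OF E1]]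
  have finQ: "finite_dimension ?Q E1" using telescopic_base_dim(1)[OF Q E(1) E(4) finE1] .
  let ?p = "\<one> # map (\<lambda>x. (\<ominus> \<one>) \<otimes> x) a"
  have pE1: "set ?p \<subseteq> E1" using aE1 sE1(3,5,6) by auto
  have pc: "?p \<in> carrier (E1[X])" using pE1 one_not_zero unfolding univ_poly_carrier[symmetric] polynomial_def by simp
  have pg: "eval ?p \<gamma> = \<zero>"
    using eval_smult[OF _ aR gR, of "\<ominus> \<one>"] a(2,3) gR by (simp add: l_minus r_neg)
  have root: "eval ?p g = \<zero>" if "g \<in> G" for g using vanish[OF _ pg that] pE1 E1F by blast
  have algG1: "(algebraic over E1) g" if "g \<in> G" for g using algebraicI[OF pc _ root[OF that]] by simp
  have algG: "(algebraic over ?Q) g" if g: "g \<in> G" for g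
  proof -
    have R: "g \<in> carrier R" using g GR by blast
    have "finite_dimension E1 (simple_extension E1 g)" using finite_dimension_simple_extension[OF E1 R] algG1[OF g] by blast
    then have "finite_dimension ?Q (simple_extension E1 g)" using telescopic_base_dim(1)[OF Q E1 finQ] by blast
    then show ?thesis
      using finite_dimension_imp_algebraic[OF Q simple_extension_is_subring[OF subfieldE(1)[OF E1] R]]
        simple_extension_mem[OF subfieldE(1)[OF E1] R] by blast
  qed
  let ?L = "simple_extension E1 \<gamma>"
  have L: "subfield ?L R" using simple_extension_is_subfield[OF E1 gR] algG1[OF gG] by blast
  note sL = subringE[OF subfieldE(1)[OF L]]
  have E1L: "E1 \<subseteq> ?L" using simple_extension_incl[OF sE1(1) gR] .
  have gL: "\<gamma> \<in> ?L" using simple_extension_mem[OF subfieldE(1)[OF E1] gR] .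
  have repL: "\<exists>l. set l \<subseteq> E1 \<and> length l = n \<and> eval l \<gamma> = x" if "x \<in> ?L" for x
    using monic_relation_rep[OF E1 gR aE1 a(2) dge a(3) that] .
  have gE1: "\<gamma> \<notin> E1"
  proof
    assume "\<gamma> \<in> E1"
    then have gF: "\<gamma> \<in> F" using E1F by blast
    have "eval [\<one>, \<ominus> \<gamma>] \<gamma> = \<zero>" using gR by (simp add: r_neg)
    moreover have "set [\<one>, \<ominus> \<gamma>] \<subseteq> F" using sF(3,5) gF by simp
    ultimately have "\<forall>a\<in>set [\<one>, \<ominus> \<gamma>]. a = \<zero>" using ind[of "[\<one>, \<ominus> \<gamma>]"] n2 by simp
    then show False using one_not_zero by simp
  qed
  have rep: "\<exists>b\<in>E1. \<exists>l. set l \<subseteq> E1 \<and> length l \<le> card G \<and>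
       (\<forall>g\<in>G. \<one> \<oplus> c \<otimes> c \<otimes> g = b \<otimes> (eval l g \<otimes> eval l g))" if c: "c \<in> E1" for c
  proof -
    have cF: "c \<in> F" and cN: "c \<in> ?N" and cR: "c \<in> carrier R" using c E1F FN sE1(1) by blast+
    \<comment> \<open>The square of this element is c^2 \<gamma>, so \<open>pyth\<close> yields a
      root of 1 + c^2 \<gamma>.\<close>
    have "c \<otimes> (\<alpha> \<oplus> j) \<in> ?N" using sN(6)[OF cN ajN] .
    then obtain y where y: "y \<in> ?N" "\<one> \<oplus> (c \<otimes> (\<alpha> \<oplus> j)) \<otimes> (c \<otimes> (\<alpha> \<oplus> j)) = y \<otimes> y" using pyth by blast
    have "(c \<otimes> (\<alpha> \<oplus> j)) \<otimes> (c \<otimes> (\<alpha> \<oplus> j)) = c \<otimes> c \<otimes> \<gamma>"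
      unfolding \<gamma>_def sq_def using cR al(1) jR by algebra
    then have yy: "y \<otimes> y = \<one> \<oplus> c \<otimes> c \<otimes> \<gamma>" using y(2) by simp
    obtain ys where ys: "set ys \<subseteq> F" "length ys = n" "eval ys \<gamma> = y" using repF[OF y(1)] by blast
    have cL: "c \<in> ?L" using c E1L by blast
    have "\<one> \<oplus> c \<otimes> c \<otimes> \<gamma> \<in> ?L" using sL(7)[OF sL(3) sL(6)[OF sL(6)[OF cL cL] gL]] .
    then have yL: "eval ys \<gamma> \<otimes> eval ys \<gamma> \<in> ?L" unfolding ys(3) yy .
    obtain b l where bl: "b \<in> E1" "set l \<subseteq> E1" "length l = n" "eval ys \<gamma> \<otimes> eval ys \<gamma> = b \<otimes> (eval l \<gamma> \<otimes> eval l \<gamma>)"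
      using kummer_descent[OF E(1) E1 F(1) EE1 E1F gal gR dge L ind repL ys(1,2) yL] by blast
    have eqg: "\<one> \<oplus> c \<otimes> c \<otimes> \<gamma> = b \<otimes> (eval l \<gamma> \<otimes> eval l \<gamma>)" using bl(4) unfolding ys(3) yy .
    have "\<one> \<oplus> c \<otimes> c \<otimes> g = b \<otimes> (eval l g \<otimes> eval l g)" if g: "g \<in> G" for g
    proof -
      obtain h where h: "h \<in> ring_hom (R\<lparr>carrier := ?N\<rparr>) R" "\<forall>x\<in>F. h x = x" "h \<gamma> = g" using conj[OF g] by blast
      have lF: "set l \<subseteq> F" and bF: "b \<in> F" using bl E1F by blast+
      have lN: "eval l \<gamma> \<in> ?N" using subring_eval[OF subfieldE(1)[OF N] _ gN] lF FN by blast
      have bN: "b \<in> ?N" using bF FN by blast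
      note mult = ring_hom_mult[OF h(1), simplified] and add = ring_hom_add[OF h(1), simplified]
      have ccN: "c \<otimes> c \<in> ?N" "c \<otimes> c \<otimes> \<gamma> \<in> ?N" "\<one> \<in> ?N" "eval l \<gamma> \<otimes> eval l \<gamma> \<in> ?N"
        using sN(6)[OF cN cN] sN(6)[OF sN(6)[OF cN cN] gN] sN(3) sN(6)[OF lN lN] by simp_all
      have h1: "h (\<one> \<oplus> c \<otimes> c \<otimes> \<gamma>) = \<one> \<oplus> c \<otimes> c \<otimes> g"
        using add[OF ccN(3,2)] mult[OF ccN(1) gN] mult[OF cN cN] h(2,3) cF sF(3) by simp
      have h2: "h (b \<otimes> (eval l \<gamma> \<otimes> eval l \<gamma>)) = b \<otimes> (eval l g \<otimes> eval l g)"
        using mult[OF bN ccN(4)] mult[OF lN lN] transfer[OF h(1,2) lF] h(2,3) bF by simp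
      show ?thesis using arg_cong[OF eqg, of h] unfolding h1 h2 .
    qed
    then show ?thesis using bl(1,2,3) cardG by (intro bexI[OF _ bl(1)] exI[of _ l]) simp
  qed
  obtain D where D: "dimension D ?Q E1" using finQ by blast
  show False
    by (rule no_kummer_representation[OF K t E1 _ _ D two finG GR _ gG gE1 algG rep])
      (use E(2,3) EE1 cardG n2 in auto)
qed

section \<open>Finitely generated extensions\<close>

lemma eval_as_finsum:
  assumes "set p \<subseteq> carrier R" "x \<in> carrier R"
  shows "eval p x = (\<Oplus>i\<in>{..<length p}. coeff p i \<otimes> x [^] i)"
  using assms(1)
proof (induction p)
  case Nil
  then show ?case by simp
next
  case (Cons a p)
  let ?n = "length p"
  have R: "a \<in> carrier R" "set p \<subseteq> carrier R" using Cons.prems by auto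
  have "(\<Oplus>i\<in>{..<length (a # p)}. coeff (a # p) i \<otimes> x [^] i) =
    (\<Oplus>i\<in>insert ?n {..<?n}. coeff (a # p) i \<otimes> x [^] i)" by (simp add: lessThan_Suc)
  also have "\<dots> = coeff (a # p) ?n \<otimes> x [^] ?n \<oplus> (\<Oplus>i\<in>{..<?n}. coeff (a # p) i \<otimes> x [^] i)"
    using Cons.prems assms(2) by (intro finsum_insert) (auto simp del: coeff.simps)
  also have "(\<Oplus>i\<in>{..<?n}. coeff (a # p) i \<otimes> x [^] i) = (\<Oplus>i\<in>{..<?n}. coeff p i \<otimes> x [^] i)"
    using R assms(2) by (intro finsum_cong') auto
  finally show ?case using Cons.IH[OF R(2)] by simp
qed

text \<open>The univariate \<open>p\<close> in the single indeterminate \<open>x\<close>: multisets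
  supported in {x} are its powers, with the size as exponent.\<close>

definition single_indexed :: "'a \<Rightarrow> 'a list \<Rightarrow> 'a multiset \<Rightarrow> 'a" where
  "single_indexed x p = (\<lambda>m. if set_mset m \<subseteq> {x} then coeff p (size m) else \<zero>)"

text \<open>Appending a coefficient is Horner's rule p X + a, which matches one multiplication by
  the indeterminate and one addition of a constant in the inductive set.\<close>

lemma single_indexed_pset:
  assumes K: "subring K R" and "x \<in> S" "set p \<subseteq> K"
  shows "single_indexed x p \<in> indexed_pset S K"
  using assms(3)
proof (induction p rule: rev_induct)
  case Nil
  have "single_indexed x [] = indexed_const \<zero>" unfolding single_indexed_def indexed_const_def by auto
  then show ?case using indexed_pset.indexed_const[of \<zero> K S] subringE(2)[OF K] by simp
next
  case (snoc a p)
  have R: "set p \<subseteq> carrier R" "a \<in> carrier R" using snoc.prems subringE(1)[OF K] by auto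
  have "single_indexed x (p @ [a]) m = indexed_padd (indexed_pmult (single_indexed x p) x) (indexed_const a) m" for m
  proof (cases "set_mset m \<subseteq> {x}")
    case True
    show ?thesis
    proof (cases "m = {#}")
      case True
      then show ?thesis unfolding single_indexed_def indexed_padd_def indexed_pmult_def indexed_const_def
        using append_coeff[of p "[a]"] R by simp
    next
      case False
      then have x: "x \<in># m" using True by auto
      then have s: "size m = Suc (size (m - {#x#}))" by (simp add: size_Diff_singleton) (metis Suc_pred nonempty_has_size multi_member_split add_mset_not_empty)
      have "set_mset (m - {#x#}) \<subseteq> {x}" using True by (meson in_diffD subset_iff)
      then show ?thesis unfolding single_indexed_def indexed_padd_def indexed_pmult_def indexed_const_def
        using append_coeff[of p "[a]"] R True False x s coeff_in_carrier[OF R(1)] by simp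
    qed
  next
    case False
    then have "m \<noteq> {#}" by auto
    moreover have "\<not> set_mset (m - {#x#}) \<subseteq> {x}" if "x \<in># m"
    proof -
      obtain y where y: "y \<in># m" "y \<noteq> x" using False by auto
      then have "y \<in># m - {#x#}" by (simp add: in_diff_count)
      then show ?thesis using y by auto
    qed
    ultimately show ?thesis using False
      unfolding single_indexed_def indexed_padd_def indexed_pmult_def indexed_const_def by simp
  qed
  then have "single_indexed x (p @ [a]) = indexed_padd (indexed_pmult (single_indexed x p) x) (indexed_const a)" by blast
  then show ?case
    using indexed_pset.indexed_padd[OF indexed_pset.indexed_pmult[OF snoc.IH assms(2)] indexed_pset.indexed_const[of a K S]] snoc.prems by simp
qed

lemma single_indexed_replicate: "single_indexed x p (replicate_mset i x) = coeff p i"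
  unfolding single_indexed_def by (simp add: set_mset_replicate_mset_subset)

lemma single_indexed_value:
  assumes "set p \<subseteq> carrier R" "x \<in> carrier R"
  shows "indexed_value R (single_indexed x p) = eval p x"
proof -
  let ?P = "single_indexed x p" and ?m = "\<lambda>i. replicate_mset i x"
  let ?f = "\<lambda>m. ?P m \<otimes> (\<Otimes>y\<in>set_mset m. y [^] count m y)"
  have Pm: "?P (?m i) = coeff p i" for i by (rule single_indexed_replicate)
  have fm: "?f (?m i) = coeff p i \<otimes> x [^] i" for i
  proof (cases "i = 0")
    case True
    then show ?thesis unfolding Pm using coeff_in_carrier[OF assms(1)] by simp
  next
    case False
    then have "set_mset (?m i) = {x}" by (simp add: set_mset_replicate_mset_subset)
    then have "(\<Otimes>y\<in>set_mset (?m i). y [^] count (?m i) y) = x [^] i" using assms(2) by simp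
    then show ?thesis unfolding Pm by simp
  qed
  have fR: "?f m \<in> carrier R" if "m \<in> ?m ` {..<length p}" for m
  proof -
    from that obtain i where "m = ?m i" by (rule imageE)
    then show ?thesis using fm[of i] coeff_in_carrier[OF assms(1)] assms(2) by simp
  qed
  have sub: "{m. ?P m \<noteq> \<zero>} \<subseteq> ?m ` {..<length p}"
  proof
    fix m assume "m \<in> {m. ?P m \<noteq> \<zero>}"
    then have m: "?P m \<noteq> \<zero>" by simp
    then have s: "set_mset m \<subseteq> {x}" and c: "coeff p (size m) \<noteq> \<zero>" unfolding single_indexed_def by (auto split: if_splits)
    have "size m < length p" using c coeff_length[of p "size m"] by (meson not_less)
    moreover have "m = ?m (size m)" using s by (metis set_mset_subset_singletonD size_replicate_mset)
    ultimately show "m \<in> ?m ` {..<length p}" by blast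
  qed
  have inj: "inj_on ?m {..<length p}" by (rule inj_onI) (metis size_replicate_mset)
  have "indexed_value R ?P = (\<Oplus>m\<in>{m. ?P m \<noteq> \<zero>}. ?f m)" unfolding indexed_value_def ..
  \<comment> \<open>The defining sum runs over the monomials with nonzero coefficient only; the
    added powers of \<open>x\<close> contribute zero.\<close>
  also have "\<dots> = (\<Oplus>m\<in>?m ` {..<length p}. ?f m)"
  proof (rule add.finprod_mono_neutral_cong_left)
    show "finite (?m ` {..<length p})" by simp
    show "{m. ?P m \<noteq> \<zero>} \<subseteq> ?m ` {..<length p}" by (rule sub)
    show "?f m = \<zero>" if "m \<in> ?m ` {..<length p} - {m. ?P m \<noteq> \<zero>}" for m
    proof -
      from DiffD1[OF that] obtain i where i: "m = ?m i" by (rule imageE)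
      have "coeff p i = \<zero>" using that Pm[of i] i by simp
      then show ?thesis using fm[of i] i assms(2) by simp
    qed
    show "?f \<in> ?m ` {..<length p} \<rightarrow> carrier R" using fR by blast
  qed simp
  also have "\<dots> = (\<Oplus>i\<in>{..<length p}. ?f (?m i))"
    by (rule finsum_reindex[OF _ inj]) (use fR in blast)
  also have "\<dots> = (\<Oplus>i\<in>{..<length p}. coeff p i \<otimes> x [^] i)" unfolding fm ..
  finally show ?thesis using eval_as_finsum[OF assms] by simp
qed

text \<open>If every element were algebraic, a univariate relation for any member would refute
  independence. Only the empty set would remain, and the supremum would be 0.\<close>

lemma transcendence_degree_transcendental:
  assumes K: "subfield K R" and deg: "transcendence_degree R K \<ge> 1"
  shows "\<exists>t\<in>carrier R. transcendental K t"
proof (rule ccontr)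
  assume n: "\<not> ?thesis"
  have "S = {}" if S: "finite S" "algebraically_independent R K S" for S
  proof (rule ccontr)
    assume "S \<noteq> {}"
    then obtain x where x: "x \<in> S" by blast
    have xR: "x \<in> carrier R" using x S unfolding algebraically_independent_def by blast
    have "(algebraic over K) x" using n xR unfolding over_def by blast
    then obtain p where p: "p \<in> carrier (K[X])" "p \<noteq> []" "eval p x = \<zero>"
      using algebraicE[OF subfieldE(1)[OF K] xR] by blast
    have pK: "set p \<subseteq> K" and lc: "lead_coeff p \<noteq> \<zero>" using p unfolding univ_poly_carrier[symmetric] polynomial_def by auto
    have pR: "set p \<subseteq> carrier R" using pK subringE(1)[OF subfieldE(1)[OF K]] by blast
    have "single_indexed x p \<in> indexed_pset S K" using single_indexed_pset[OF subfieldE(1)[OF K] x pK] .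
    moreover have "indexed_value R (single_indexed x p) = \<zero>" using single_indexed_value[OF pR xR] p(3) by simp
    ultimately have "single_indexed x p (replicate_mset (degree p) x) = \<zero>"
      using S(2) unfolding algebraically_independent_def by blast
    then have "coeff p (degree p) = \<zero>" unfolding single_indexed_replicate .
    then show False using lead_coeff_simp[OF p(2)] lc by simp
  qed
  then have "transcendence_degree R K \<le> 0"
    unfolding transcendence_degree_def by (intro SUP_least) (auto simp: zero_enat_def)
  then show False using deg by simp
qed

lemma generate_field_insert_union:
  assumes "k \<subseteq> carrier R" "S \<subseteq> carrier R" "x \<in> carrier R"
  shows "generate_field R (generate_field R (insert x k) \<union> S) = generate_field R (k \<union> insert x S)"
proof -
  have xk: "insert x k \<subseteq> carrier R" and u: "k \<union> insert x S \<subseteq> carrier R" using assms by auto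
  have g: "generate_field R (insert x k) \<union> S \<subseteq> carrier R" using generate_field_in_carrier[OF xk] assms by blast
  show ?thesis
  proof
    show "generate_field R (generate_field R (insert x k) \<union> S) \<subseteq> generate_field R (k \<union> insert x S)"
    proof (rule generate_field_min_subfield1[OF g generate_field_is_subfield[OF u]])
      have "generate_field R (insert x k) \<subseteq> generate_field R (k \<union> insert x S)"
        by (rule generate_field_min_subfield1[OF xk generate_field_is_subfield[OF u]]) (auto intro: generate_field.incl)
      then show "generate_field R (insert x k) \<union> S \<subseteq> generate_field R (k \<union> insert x S)" by (auto intro: generate_field.incl)
    qed
    show "generate_field R (k \<union> insert x S) \<subseteq> generate_field R (generate_field R (insert x k) \<union> S)"
      by (rule generate_field_min_subfield1[OF u generate_field_is_subfield[OF g]]) (auto intro: generate_field.incl)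
  qed
qed

lemma finitely_generated_algebraic:
  assumes k: "subfield k R" and S: "finite S" "S \<subseteq> carrier R" and M: "M = generate_field R (k \<union> S)"
    and alg: "\<And>s. s \<in> S \<Longrightarrow> (algebraic over k) s"
  shows "finite_dimension k M"
proof -
  note sk = subringE[OF subfieldE(1)[OF k]]
  obtain xs where xs: "set xs = S" using finite_list[OF S(1)] by blast
  have incl: "k \<union> S \<subseteq> M" unfolding M using generate_field.incl by (rule subsetI)
  have u: "k \<union> S \<subseteq> carrier R" using sk(1) S by blast
  have xR: "set xs \<subseteq> carrier R" using xs S by simp
  have "finite_extension k xs = M"
  proof
    have MS: "subring M R" unfolding M using subfieldE(1)[OF generate_field_is_subfield[OF u]] .
    show "finite_extension k xs \<subseteq> M"
      by (rule finite_extension_subring_incl[OF MS]) (use incl xs in auto)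
    have "k \<union> S \<subseteq> finite_extension k xs"
      using finite_extension_incl[OF sk(1) xR] finite_extension_mem[OF subfieldE(1)[OF k] xR] xs by blast
    then show "M \<subseteq> finite_extension k xs" unfolding M
      using generate_field_min_subfield1[OF u finite_extension_is_subfield[OF k xR]] alg xs by blast
  qed
  then show ?thesis using finite_extension_finite_dimension(1)[OF k xR] alg xs by blast
qed

text \<open>The ground field grows by one generator at a time until the whole field is algebraic
  over it. The generator \<open>x\<close> that achieves this is transcendental over the field before
  it, since otherwise everything would be algebraic already. Thus \<open>K\<close> may be larger
  than the given \<open>k\<close>: it absorbs the other transcendental generators.\<close>

lemma finite_over_rational_function_field:
  assumes "finite S" "subfield k R" "S \<subseteq> carrier R"
    and "\<exists>s\<in>generate_field R (k \<union> S). \<not> (algebraic over k) s"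
  shows "\<exists>K t. subfield K R \<and> K \<subseteq> generate_field R (k \<union> S) \<and> t \<in> generate_field R (k \<union> S) \<and> transcendental K t \<and>
    finite_dimension (generate_field R (insert t K)) (generate_field R (k \<union> S))"
  using assms
proof (induction S arbitrary: k)
  case empty
  note sk = subringE[OF subfieldE(1)[OF empty(1)]]
  have "generate_field R (k \<union> {}) \<subseteq> k" using generate_field_min_subfield1[OF _ empty(1), of "k \<union> {}"] sk by simp
  then obtain s where "s \<in> k" "\<not> (algebraic over k) s" using empty(3) by blast
  then show ?case using algebraic_self[OF subfieldE(1)[OF empty(1)]] by blast
next
  case (insert x S)
  note sk = subringE[OF subfieldE(1)[OF insert.prems(1)]]
  have xR: "x \<in> carrier R" and SR: "S \<subseteq> carrier R" using insert.prems(2) by auto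
  have xk: "insert x k \<subseteq> carrier R" using xR sk(1) by blast
  let ?k = "generate_field R (insert x k)" and ?M = "generate_field R (k \<union> insert x S)"
  have k': "subfield ?k R" using generate_field_is_subfield[OF xk] .
  have kk: "insert x k \<subseteq> ?k" by (auto intro: generate_field.incl)
  have M: "generate_field R (?k \<union> S) = ?M" using generate_field_insert_union[OF sk(1) SR xR] .
  have u: "k \<union> insert x S \<subseteq> carrier R" using sk(1) xR SR by blast
  have sM: "subfield ?M R" using generate_field_is_subfield[OF u] .
  have inM: "k \<union> insert x S \<subseteq> ?M" using generate_field.incl by (rule subsetI)
  show ?case
  proof (cases "\<exists>s\<in>?M. \<not> (algebraic over ?k) s")
    case True
    then show ?thesis using insert.IH[OF k' SR] unfolding M by blast
  next
    case False
    then have fin: "finite_dimension ?k ?M"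
      using finitely_generated_algebraic[OF k' insert.hyps(1) SR M[symmetric]] inM by blast
    have "\<not> (algebraic over k) x"
    proof
      assume ax: "(algebraic over k) x"
      have "finite_dimension k ?k"
        by (rule finitely_generated_algebraic[of k "{x}"]) (use insert.prems(1) xR ax in auto)
      then have "finite_dimension k ?M" using telescopic_base_dim(1)[OF insert.prems(1) k' _ fin] by blast
      then have "(algebraic over k) s" if "s \<in> ?M" for s
        using finite_dimension_imp_algebraic[OF insert.prems(1) subfieldE(1)[OF sM]] that by blast
      then show False using insert.prems(3) by blast
    qed
    then have "transcendental k x" unfolding over_def by blast
    then show ?thesis using insert.prems(1) inM fin by (intro exI[of _ k] exI[of _ x]) blast
  qed
qed

end

section \<open>Transfer to the algebraic closure\<close>

lemma monic_linear_hom: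
  assumes "ring_hom_ring A B h" "x \<in> carrier A"
  shows "map h [\<one>\<^bsub>A\<^esub>, \<ominus>\<^bsub>A\<^esub> x] = [\<one>\<^bsub>B\<^esub>, \<ominus>\<^bsub>B\<^esub> h x]"
proof -
  interpret ring_hom_ring A B h by fact
  show ?thesis using assms(2) by simp
qed

text \<open>A double linear factor over \<open>A\<close> is mapped to a double linear factor over
  \<open>B\<close>.\<close>

lemma alg_mult_le_one_hom:
  fixes A :: "('a, 'm) ring_scheme" and B :: "('c, 'n) ring_scheme"
  assumes A: "field A" and B: "field B" and h: "h \<in> ring_hom A B"
    and p: "p \<in> carrier (poly_ring A)" "p \<noteq> []" and x: "x \<in> carrier A"
    and le: "ring.alg_mult B (map h p) (h x) \<le> 1"
  shows "ring.alg_mult A p x \<le> 1"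
proof -
  interpret A: field A by fact
  interpret B: field B by fact
  interpret h: ring_hom_ring A B h by (rule ring_hom_ringI2[OF A.is_ring B.is_ring h])
  interpret P: ring "poly_ring A" by (rule A.univ_poly_is_ring[OF A.carrier_is_subring])
  have H: "map h \<in> ring_hom (poly_ring A) (poly_ring B)" by (rule poly_map_hom[OF A B h])
  have hx: "h x \<in> carrier B" using x by simp
  let ?d = "[\<one>\<^bsub>A\<^esub>, \<ominus>\<^bsub>A\<^esub> x]"
  have d: "?d \<in> carrier (poly_ring A)" by (rule A.monic_linear_poly[OF A.carrier_is_subring x])
  have hd: "map h ?d = [\<one>\<^bsub>B\<^esub>, \<ominus>\<^bsub>B\<^esub> h x]" by (rule monic_linear_hom[OF h.ring_hom_ring_axioms x])
  have hp: "map h p \<in> carrier (poly_ring B)" "map h p \<noteq> []" using ring_hom_closed[OF H p(1)] p(2) by auto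
  show ?thesis
  proof (rule ccontr)
    assume "\<not> A.alg_mult p x \<le> 1"
    then obtain q where q: "q \<in> carrier (poly_ring A)" "p = (?d \<otimes>\<^bsub>poly_ring A\<^esub> ?d) \<otimes>\<^bsub>poly_ring A\<^esub> q"
      using A.alg_mult_le_one_iff[OF A.carrier_is_subfield x p] by blast
    have "map h p = (map h ?d \<otimes>\<^bsub>poly_ring B\<^esub> map h ?d) \<otimes>\<^bsub>poly_ring B\<^esub> map h q"
      using ring_hom_mult[OF H P.m_closed[OF d d] q(1)] ring_hom_mult[OF H d d] q(2) by simp
    then have "\<not> B.alg_mult (map h p) (h x) \<le> 1"
      using B.alg_mult_le_one_iff[OF B.carrier_is_subfield hx hp] ring_hom_closed[OF H q(1)] unfolding hd by blast
    then show False using le by blast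
  qed
qed

text \<open>Separability is defined in the algebraic closure of \<open>K\<close>, while
  multiplicities are needed in another extension \<open>B\<close>. The embedding of \<open>K\<close>
  into its closure, read on h(K), extends to h(K)(y) and would carry a double root \<open>y\<close>
  to a double root in the closure.\<close>

lemma separable_alg_mult:
  fixes A :: "('a, 'm) ring_scheme" and B :: "('c, 'n) ring_scheme"
  assumes A: "field A" and B: "field B" and h: "h \<in> ring_hom A B" and K: "subfield K A"
    and x: "x \<in> carrier A" "separable_elem A K x" and y: "y \<in> carrier B"
  shows "ring.alg_mult B (map h (ring.Irr A K x)) y \<le> 1"
proof (rule ccontr)
  interpret A: field A by fact
  interpret B: field B by fact
  interpret h: ring_hom_ring A B h by (rule ring_hom_ringI2[OF A.is_ring B.is_ring h])
  let ?p = "A.Irr K x"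
  let ?hp = "map h ?p"
  assume n: "\<not> B.alg_mult ?hp y \<le> 1"
  have alg: "(A.algebraic over K) x" using x(2) unfolding separable_elem_def over_def by blast
  note I = A.IrrE[OF K x(1) alg]
  have nil: "?p \<noteq> []" using A.pirreducible_degree[OF K I(1,2)] by auto
  let ?hK = "h ` K"
  have hK: "subfield ?hK B" and inj: "inj_on h K" using h.img_is_subfield[OF K B.one_not_zero] by blast+
  have hp: "?hp \<in> carrier (?hK[X]\<^bsub>B\<^esub>)" using h.subfield_polynomial_hom[OF K B.one_not_zero I(1)] .
  have hpB: "?hp \<in> carrier (poly_ring B)" using B.carrier_polynomial_shell[OF subfieldE(1)[OF hK] hp] .
  have hnil: "?hp \<noteq> []" using nil by simp
  define KA where "KA = A\<lparr>carrier := K\<rparr>"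
  have KA: "field KA" unfolding KA_def using A.subfield_iff(2)[OF K] .
  interpret KA: field KA by (rule KA)
  define C where "C = KA.alg_closure"
  define i where "i = (ring.indexed_const KA :: 'a \<Rightarrow> ('a list \<times> nat) multiset \<Rightarrow> 'a)"
  have C: "algebraic_closure C (i ` carrier KA)" and i: "i \<in> ring_hom KA C"
    unfolding C_def i_def using KA.alg_closureE by blast+
  have FC: "field C" using C unfolding algebraic_closure_def by blast
  interpret C: field C by (rule FC)
  interpret i: ring_hom_ring KA C i by (rule ring_hom_ringI2[OF KA.is_ring C.is_ring i])
  have pKA: "?p \<in> carrier (carrier KA[X]\<^bsub>KA\<^esub>)" using I(1) A.univ_poly_consistent[OF subfieldE(1)[OF K]] unfolding KA_def by simp
  have spl: "C.splitted (map i ?p)"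
    using algebraic_closure.roots_over_subfield[OF C] i.subfield_polynomial_hom[OF KA.carrier_is_subfield C.one_not_zero pKA] by blast
  have sep: "C.alg_mult (map i ?p) z \<le> 1" if "z \<in> carrier C" for z
    using x(2) that unfolding separable_elem_def separable_poly_def C_def i_def KA_def by blast
  define j where "j = i \<circ> inv_into K h"
  have jh: "j (h a) = i a" if "a \<in> K" for a unfolding j_def using inj that by simp
  note sK = subringE[OF subfieldE(1)[OF K]]
  have cKA: "carrier KA = K" unfolding KA_def by simp
  have j: "j \<in> ring_hom (B\<lparr>carrier := ?hK\<rparr>) C"
  proof (rule ring_hom_memI)
    fix u assume "u \<in> carrier (B\<lparr>carrier := ?hK\<rparr>)"
    then obtain a where a: "a \<in> K" "u = h a" by auto
    show "j u \<in> carrier C" unfolding a(2) jh[OF a(1)] using i.hom_closed a(1) cKA by simp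
    fix v assume "v \<in> carrier (B\<lparr>carrier := ?hK\<rparr>)"
    then obtain b where b: "b \<in> K" "v = h b" by auto
    have R: "a \<in> carrier A" "b \<in> carrier A" using a b sK(1) by blast+
    have "u \<otimes>\<^bsub>B\<^esub> v = h (a \<otimes>\<^bsub>A\<^esub> b)" "u \<oplus>\<^bsub>B\<^esub> v = h (a \<oplus>\<^bsub>A\<^esub> b)" unfolding a(2) b(2) using R by simp_all
    then have "j (u \<otimes>\<^bsub>B\<^esub> v) = i (a \<otimes>\<^bsub>A\<^esub> b)" "j (u \<oplus>\<^bsub>B\<^esub> v) = i (a \<oplus>\<^bsub>A\<^esub> b)"
      using jh sK(6,7) a(1) b(1) by simp_all
    moreover have "i (a \<otimes>\<^bsub>A\<^esub> b) = i a \<otimes>\<^bsub>C\<^esub> i b" "i (a \<oplus>\<^bsub>A\<^esub> b) = i a \<oplus>\<^bsub>C\<^esub> i b"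
      using i.hom_mult[of a b] i.hom_add[of a b] a(1) b(1) unfolding KA_def by simp_all
    ultimately show "j (u \<otimes>\<^bsub>B\<lparr>carrier := ?hK\<rparr>\<^esub> v) = j u \<otimes>\<^bsub>C\<^esub> j v" "j (u \<oplus>\<^bsub>B\<lparr>carrier := ?hK\<rparr>\<^esub> v) = j u \<oplus>\<^bsub>C\<^esub> j v"
      unfolding a(2) b(2) using jh[OF a(1)] jh[OF b(1)] by simp_all
  next
    have "j (h \<one>\<^bsub>A\<^esub>) = i \<one>\<^bsub>A\<^esub>" using jh sK(3) by blast
    moreover have "i \<one>\<^bsub>A\<^esub> = \<one>\<^bsub>C\<^esub>" using i.hom_one unfolding KA_def by simp
    ultimately show "j \<one>\<^bsub>B\<lparr>carrier := ?hK\<rparr>\<^esub> = \<one>\<^bsub>C\<^esub>" by simp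
  qed
  have pK: "set ?p \<subseteq> K" using A.polynomial_incl I(1) univ_poly_carrier by blast
  have mj: "map j ?hp = map i ?p" using jh pK by (simp add: subset_iff)
  have "B.alg_mult ?hp y > 0" using n by simp
  then have ry: "B.eval ?hp y = \<zero>\<^bsub>B\<^esub>" using B.alg_mult_gt_zero_iff_is_root[OF hpB] unfolding B.is_root_def by blast
  have algy: "(B.algebraic over ?hK) y" using B.algebraicI[OF hp hnil ry] .
  obtain y' where y': "y' \<in> carrier C" "C.eval (map j (B.Irr ?hK y)) y' = \<zero>\<^bsub>C\<^esub>"
    using exists_root_image[OF B FC hK j y hp hnil ry] spl unfolding mj by blast
  let ?M = "B.simple_extension ?hK y"
  obtain \<tau> where \<tau>: "\<tau> \<in> ring_hom (B\<lparr>carrier := ?M\<rparr>) C" "\<And>m. m \<in> ?hK \<Longrightarrow> \<tau> m = j m" "\<tau> y = y'"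
    using B.extend_hom_simple[OF FC hK j y algy y'] by blast
  have M: "subfield ?M B" using B.simple_extension_is_subfield[OF hK y] algy by blast
  have yM: "y \<in> ?M" using B.simple_extension_mem[OF subfieldE(1)[OF hK] y] .
  have KM: "?hK \<subseteq> ?M" using B.simple_extension_incl[OF subringE(1)[OF subfieldE(1)[OF hK]] y] .
  have hpM: "?hp \<in> carrier (?M[X]\<^bsub>B\<^esub>)" using B.carrier_mono_poly[OF KM hp] .
  define BM where "BM = B\<lparr>carrier := ?M\<rparr>"
  have BM: "field BM" unfolding BM_def using B.subfield_iff(2)[OF M] .
  interpret BM: field BM by (rule BM)
  have polyM: "poly_ring BM = ?M[X]\<^bsub>B\<^esub>" unfolding BM_def by (rule B.subfield_poly_ring[OF M])
  obtain q where q: "q \<in> carrier (?M[X]\<^bsub>B\<^esub>)"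
    "?hp = ([\<one>\<^bsub>B\<^esub>, \<ominus>\<^bsub>B\<^esub> y] \<otimes>\<^bsub>?M[X]\<^bsub>B\<^esub>\<^esub> [\<one>\<^bsub>B\<^esub>, \<ominus>\<^bsub>B\<^esub> y]) \<otimes>\<^bsub>?M[X]\<^bsub>B\<^esub>\<^esub> q"
    using n B.alg_mult_le_one_iff[OF M yM hpM hnil] by blast
  have H: "map \<tau> \<in> ring_hom (?M[X]\<^bsub>B\<^esub>) (poly_ring C)"
    using poly_map_hom[OF BM FC] \<tau>(1) unfolding polyM BM_def[symmetric] by blast
  have tp: "map \<tau> ?hp = map i ?p" unfolding mj[symmetric] using \<tau>(2) pK by (auto simp: subset_iff)
  interpret P: ring "?M[X]\<^bsub>B\<^esub>" by (rule B.univ_poly_is_ring[OF subfieldE(1)[OF M]])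
  interpret t: ring_hom_ring BM C \<tau> by (rule ring_hom_ringI2[OF BM.is_ring C.is_ring]) (use \<tau>(1) BM_def in simp)
  let ?d = "[\<one>\<^bsub>B\<^esub>, \<ominus>\<^bsub>B\<^esub> y]"
  have d: "?d \<in> carrier (?M[X]\<^bsub>B\<^esub>)" by (rule B.monic_linear_poly[OF subfieldE(1)[OF M] yM])
  have neg: "\<tau> (\<ominus>\<^bsub>B\<^esub> y) = \<ominus>\<^bsub>C\<^esub> y'"
  proof -
    have nM: "\<ominus>\<^bsub>B\<^esub> y \<in> ?M" using subringE(5)[OF subfieldE(1)[OF M] yM] .
    have "\<tau> (y \<oplus>\<^bsub>B\<^esub> \<ominus>\<^bsub>B\<^esub> y) = \<tau> y \<oplus>\<^bsub>C\<^esub> \<tau> (\<ominus>\<^bsub>B\<^esub> y)" using t.hom_add[of y "\<ominus>\<^bsub>B\<^esub> y"] yM nM unfolding BM_def by simp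
    moreover have "\<tau> \<zero>\<^bsub>B\<^esub> = \<zero>\<^bsub>C\<^esub>" using t.hom_zero unfolding BM_def by simp
    moreover have "\<tau> (\<ominus>\<^bsub>B\<^esub> y) \<in> carrier C" using t.hom_closed nM unfolding BM_def by simp
    ultimately show ?thesis using y y'(1) \<tau>(3) by (simp add: B.r_neg) (metis C.minus_equality C.a_comm)
  qed
  have "\<tau> \<one>\<^bsub>B\<^esub> = \<one>\<^bsub>C\<^esub>" using t.hom_one unfolding BM_def by simp
  then have td: "map \<tau> ?d = [\<one>\<^bsub>C\<^esub>, \<ominus>\<^bsub>C\<^esub> y']" using neg by simp
  have "map \<tau> ?hp = (map \<tau> ?d \<otimes>\<^bsub>poly_ring C\<^esub> map \<tau> ?d) \<otimes>\<^bsub>poly_ring C\<^esub> map \<tau> q"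
    using ring_hom_mult[OF H P.m_closed[OF d d] q(1)] ring_hom_mult[OF H d d] q(2) by simp
  then have eq: "map i ?p = ([\<one>\<^bsub>C\<^esub>, \<ominus>\<^bsub>C\<^esub> y'] \<otimes>\<^bsub>poly_ring C\<^esub> [\<one>\<^bsub>C\<^esub>, \<ominus>\<^bsub>C\<^esub> y']) \<otimes>\<^bsub>poly_ring C\<^esub> map \<tau> q"
    unfolding tp td .
  have ip: "map i ?p \<in> carrier (poly_ring C)" using polynomial_hom[OF i KA FC pKA] .
  have inil: "map i ?p \<noteq> []" using nil by simp
  have "\<not> C.alg_mult (map i ?p) y' \<le> 1"
    using C.alg_mult_le_one_iff[OF C.carrier_is_subfield y'(1) ip inil] eq ring_hom_closed[OF H q(1)] by blast
  then show False using sep[OF y'(1)] by blast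
qed

lemma separable_split_separable:
  fixes A :: "('a, 'm) ring_scheme" and B :: "('c, 'n) ring_scheme"
  assumes A: "field A" and B: "field B" and h: "h \<in> ring_hom A B" and K: "subfield K A"
    and x: "x \<in> carrier A" "separable_elem A K x"
    and spl: "ring.splitted B (map h (ring.Irr A K x))"
  shows "field.split_separable B (h ` K) (carrier B) (h x)"
proof -
  interpret A: field A by fact
  interpret B: field B by fact
  interpret h: ring_hom_ring A B h by (rule ring_hom_ringI2[OF A.is_ring B.is_ring h])
  let ?p = "A.Irr K x"
  have alg: "(A.algebraic over K) x" using x(2) unfolding separable_elem_def over_def by blast
  note I = A.IrrE[OF K x(1) alg]
  have nil: "map h ?p \<noteq> []" using A.pirreducible_degree[OF K I(1,2)] by auto
  have hp: "map h ?p \<in> carrier ((h ` K)[X]\<^bsub>B\<^esub>)" using h.subfield_polynomial_hom[OF K B.one_not_zero I(1)] .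
  have ev: "B.eval (map h ?p) (h x) = \<zero>\<^bsub>B\<^esub>" using h.eval_hom[OF subfieldE(1)[OF K] x(1) I(1)] I(4) by simp
  show ?thesis unfolding B.split_separable_def
    using hp nil ev spl separable_alg_mult[OF A B h K x] by blast
qed

text \<open>The minimal polynomial has only simple roots and, by normality, as many in
  \<open>A\<close> as its degree. \<open>B\<close> has no more than that, and \<open>h\<close> is
  injective, so all roots in \<open>B\<close> come from \<open>A\<close>.\<close>

lemma galois_split_separable:
  fixes A :: "('a, 'm) ring_scheme" and B :: "('c, 'n) ring_scheme"
  assumes gal: "galois_extension A K" and B: "field B" and h: "h \<in> ring_hom A B"
    and spl: "\<And>q. q \<in> carrier (poly_ring A) \<Longrightarrow> ring.splitted B (map h q)"
    and x: "x \<in> carrier A"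
  shows "field.split_separable B (h ` K) (h ` carrier A) (h x)"
proof -
  have A: "field A" and K: "subfield K A" and norm: "normal_extension A K" and sep: "separable_elem A K x"
    using gal x unfolding galois_extension_def separable_extension_def by blast+
  interpret A: field A by fact
  interpret B: field B by fact
  interpret h: ring_hom_ring A B h by (rule ring_hom_ringI2[OF A.is_ring B.is_ring h])
  let ?p = "A.Irr K x"
  have alg: "(A.algebraic over K) x" using sep unfolding separable_elem_def over_def by blast
  note I = A.IrrE[OF K x alg]
  have nil: "?p \<noteq> []" using A.pirreducible_degree[OF K I(1,2)] by auto
  have pA: "?p \<in> carrier (poly_ring A)" using A.carrier_polynomial_shell[OF subfieldE(1)[OF K] I(1)] .
  have hp: "map h ?p \<in> carrier ((h ` K)[X]\<^bsub>B\<^esub>)" using h.subfield_polynomial_hom[OF K B.one_not_zero I(1)] .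
  have hpB: "map h ?p \<in> carrier (poly_ring B)" using polynomial_hom[OF h A B pA] .
  have hnil: "map h ?p \<noteq> []" using nil by simp
  have ev: "B.eval (map h ?p) (h x) = \<zero>\<^bsub>B\<^esub>" using h.eval_hom[OF subfieldE(1)[OF K] x I(1)] I(4) by simp
  have le1: "B.alg_mult (map h ?p) y \<le> 1" if "y \<in> carrier B" for y using separable_alg_mult[OF A B h K x sep that] .
  have le1A: "A.alg_mult ?p y \<le> 1" if y: "y \<in> carrier A" for y
    using alg_mult_le_one_hom[OF A B h pA nil y le1] y by simp
  have splA: "A.splitted ?p" using norm I(1,2,4) x unfolding normal_extension_def by blast
  let ?RA = "{y \<in> carrier A. A.eval ?p y = \<zero>\<^bsub>A\<^esub>}" and ?RB = "{y \<in> carrier B. B.eval (map h ?p) y = \<zero>\<^bsub>B\<^esub>}"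
  have cA: "card ?RA = length ?p - 1" by (rule A.card_simple_roots(2)[OF pA nil splA le1A])
  have cB: "card ?RB = length (map h ?p) - 1" and fB: "finite ?RB"
    using B.card_simple_roots[OF hpB hnil spl[OF pA] le1] by blast+
  have inj: "inj_on h (carrier A)" by (rule non_trivial_field_hom_is_inj[OF h A B])
  have sub: "h ` ?RA \<subseteq> ?RB"
  proof
    fix z assume "z \<in> h ` ?RA"
    then obtain y where y: "y \<in> carrier A" "A.eval ?p y = \<zero>\<^bsub>A\<^esub>" "z = h y" by blast
    have "B.eval (map h ?p) z = \<zero>\<^bsub>B\<^esub>" unfolding y(3) using h.eval_hom[OF subfieldE(1)[OF K] y(1) I(1)] y(2) by simp
    then show "z \<in> ?RB" using y by simp
  qed
  have "inj_on h ?RA" using inj by (rule inj_on_subset) blast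
  then have "card (h ` ?RA) = card ?RB" using card_image[of h ?RA] cA cB by simp
  then have "h ` ?RA = ?RB" using card_subset_eq[OF fB sub] by blast
  then have "\<forall>y\<in>carrier B. B.eval (map h ?p) y = \<zero>\<^bsub>B\<^esub> \<longrightarrow> y \<in> h ` carrier A" by blast
  then show ?thesis unfolding B.split_separable_def
    using hp hnil ev spl[OF pA] le1 by blast
qed

lemma hom_generate_field:
  fixes A :: "('a, 'm) ring_scheme" and B :: "('c, 'n) ring_scheme"
  assumes A: "field A" and B: "field B" and h: "h \<in> ring_hom A B" and H: "H \<subseteq> carrier A"
  shows "generate_field B (h ` H) = h ` generate_field A H"
proof
  interpret A: field A by fact
  interpret B: field B by fact
  interpret h: ring_hom_ring A B h by (rule ring_hom_ringI2[OF A.is_ring B.is_ring h])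
  have hH: "h ` H \<subseteq> carrier B" using H by auto
  show "generate_field B (h ` H) \<subseteq> h ` generate_field A H"
    by (rule B.generate_field_min_subfield1[OF hH h.img_is_subfield(2)[OF A.generate_field_is_subfield[OF H] B.one_not_zero]])
      (auto intro: generate_field.incl)
  have inj: "inj_on h (carrier A)" by (rule non_trivial_field_hom_is_inj[OF h A B])
  have "h x \<in> generate_field B (h ` H)" if "x \<in> generate_field A H" for x
    using that
  proof (induction rule: generate_field.induct)
    case one
    then show ?case using generate_field.one[of B] h.hom_one by simp
  next
    case (incl x)
    then show ?case by (auto intro: generate_field.incl)
  next
    case (a_inv x)
    have "x \<in> carrier A" using A.generate_field_in_carrier[OF H a_inv(1)] .
    then show ?case using generate_field.a_inv[OF a_inv(2)] by simp
  next
    case (m_inv x)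
    have x: "x \<in> carrier A" using A.generate_field_in_carrier[OF H m_inv(1)] .
    note ix = A.nonzero_inv[OF x m_inv(2)]
    have "h x \<otimes>\<^bsub>B\<^esub> h (inv\<^bsub>A\<^esub> x) = \<one>\<^bsub>B\<^esub>" using h.hom_mult[OF x ix(1)] ix(3) h.hom_one by simp
    then have e: "inv\<^bsub>B\<^esub> (h x) = h (inv\<^bsub>A\<^esub> x)" using B.comm_inv_char x ix(1) h.hom_closed by blast
    have "h x \<noteq> \<zero>\<^bsub>B\<^esub>"
    proof
      assume "h x = \<zero>\<^bsub>B\<^esub>"
      then have "h x = h \<zero>\<^bsub>A\<^esub>" using h.hom_zero by simp
      then show False using inj x m_inv(2) by (meson A.zero_closed inj_onD)
    qed
    then show ?case using generate_field.m_inv[OF m_inv(3)] e by simp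
  next
    case (eng_add x y)
    have "x \<in> carrier A" "y \<in> carrier A" using A.generate_field_in_carrier[OF H] eng_add(1,2) by blast+
    then show ?case using generate_field.eng_add[OF eng_add(3,4)] by simp
  next
    case (eng_mult x y)
    have "x \<in> carrier A" "y \<in> carrier A" using A.generate_field_in_carrier[OF H] eng_mult(1,2) by blast+
    then show ?case using generate_field.eng_mult[OF eng_mult(3,4)] by simp
  qed
  then show "h ` generate_field A H \<subseteq> generate_field B (h ` H)" by blast
qed

lemma hom_transcendental:
  fixes A :: "('a, 'm) ring_scheme" and B :: "('c, 'n) ring_scheme"
  assumes A: "field A" and B: "field B" and h: "h \<in> ring_hom A B" and K: "subfield K A"
    and t: "t \<in> carrier A" "ring.transcendental A K t"
  shows "ring.transcendental B (h ` K) (h t)"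
proof (rule ccontr)
  interpret A: field A by fact
  interpret B: field B by fact
  interpret h: ring_hom_ring A B h by (rule ring_hom_ringI2[OF A.is_ring B.is_ring h])
  assume "\<not> B.transcendental (h ` K) (h t)"
  then have alg: "(B.algebraic over (h ` K)) (h t)" unfolding over_def .
  have hK: "subfield (h ` K) B" using h.img_is_subfield(2)[OF K B.one_not_zero] .
  have htB: "h t \<in> carrier B" using t by simp
  obtain p where p: "p \<in> carrier ((h ` K)[X]\<^bsub>B\<^esub>)" "p \<noteq> []" "B.eval p (h t) = \<zero>\<^bsub>B\<^esub>"
    using B.algebraicE[OF subfieldE(1)[OF hK] htB alg] by blast
  have pK: "set p \<subseteq> h ` K" and lc: "hd p \<noteq> \<zero>\<^bsub>B\<^esub>" using p unfolding univ_poly_carrier[symmetric] polynomial_def by auto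
  define q where "q = map (inv_into K h) p"
  have qK: "set q \<subseteq> K"
  proof
    fix x assume "x \<in> set q"
    then obtain b where "b \<in> set p" "x = inv_into K h b" unfolding q_def by auto
    then show "x \<in> K" using inv_into_into[of b h K] pK by blast
  qed
  have hq: "map h q = p" unfolding q_def map_map
  proof (rule map_idI)
    fix b assume "b \<in> set p"
    then have "b \<in> h ` K" using pK by blast
    then show "(h \<circ> inv_into K h) b = b" by (simp add: f_inv_into_f)
  qed
  have qA: "set q \<subseteq> carrier A" using qK subringE(1)[OF subfieldE(1)[OF K]] by blast
  have "hd q \<noteq> \<zero>\<^bsub>A\<^esub>"
  proof
    assume "hd q = \<zero>\<^bsub>A\<^esub>"
    then have "hd p = h \<zero>\<^bsub>A\<^esub>" using hq p(2) by (metis hd_map list.map_disc_iff)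
    then show False using lc h.hom_zero by simp
  qed
  then have qc: "q \<in> carrier (K[X]\<^bsub>A\<^esub>)" "q \<noteq> []" using qK p(2) unfolding univ_poly_carrier[symmetric] polynomial_def q_def by auto
  have evA: "A.eval q t \<in> carrier A" using A.eval_in_carrier[OF qA t(1)] .
  have "h (A.eval q t) = h \<zero>\<^bsub>A\<^esub>" using h.eval_hom'[OF t(1) qA] hq p(3) h.hom_zero by simp
  then have "A.eval q t = \<zero>\<^bsub>A\<^esub>" using non_trivial_field_hom_is_inj[OF h A B] evA by (meson A.zero_closed inj_onD)
  then have "(A.algebraic over K) t" using A.algebraicI[OF qc] by blast
  then show False using t(2) unfolding over_def by blast
qed

text \<open>If 1 + 1 = 0, then 2 annihilates 1 and no odd number does, so the greatest common
  divisor defining the characteristic is exactly 2.\<close>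

lemma field_char_not_two:
  assumes "field R" "field_char R \<noteq> 2"
  shows "\<one>\<^bsub>R\<^esub> \<oplus>\<^bsub>R\<^esub> \<one>\<^bsub>R\<^esub> \<noteq> \<zero>\<^bsub>R\<^esub>"
proof
  interpret field R by fact
  assume z: "\<one>\<^bsub>R\<^esub> \<oplus>\<^bsub>R\<^esub> \<one>\<^bsub>R\<^esub> = \<zero>\<^bsub>R\<^esub>"
  let ?S = "{n :: nat. add_pow R n \<one>\<^bsub>R\<^esub> = \<zero>\<^bsub>R\<^esub>}"
  have two: "2 \<in> ?S" using z by (simp add: numeral_2_eq_2)
  have "2 dvd n" if n: "n \<in> ?S" for n :: nat
  proof (rule ccontr)
    assume "\<not> 2 dvd n"
    then obtain m where m: "n = 2 * m + 1" by (metis oddE)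
    have "add_pow R n \<one>\<^bsub>R\<^esub> = add_pow R (2 * m) \<one>\<^bsub>R\<^esub> \<oplus>\<^bsub>R\<^esub> \<one>\<^bsub>R\<^esub>" unfolding m by simp
    also have "add_pow R (2 * m) \<one>\<^bsub>R\<^esub> = add_pow R m (add_pow R (2::nat) \<one>\<^bsub>R\<^esub>)"
      by (simp add: add.nat_pow_pow mult.commute)
    also have "\<dots> = \<zero>\<^bsub>R\<^esub>" using two by simp
    finally show False using n one_not_zero by simp
  qed
  then have "Gcd ?S = 2" using two by (intro dvd_antisym Gcd_greatest Gcd_dvd) auto
  then show False using assms(2) unfolding field_char_def by blast
qed

lemma pythagorean_one_plus_square:
  assumes "field R" "pythagorean R" "x \<in> carrier R"
  shows "\<exists>y\<in>carrier R. \<one>\<^bsub>R\<^esub> \<oplus>\<^bsub>R\<^esub> x \<otimes>\<^bsub>R\<^esub> x = y \<otimes>\<^bsub>R\<^esub> y"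
proof -
  interpret field R by fact
  let ?f = "\<lambda>i::nat. if i = 0 then \<one>\<^bsub>R\<^esub> else x"
  have "?f \<in> {..<2} \<rightarrow> carrier R" using assms(3) by simp
  then obtain y where y: "y \<in> carrier R" "(\<Oplus>\<^bsub>R\<^esub>i\<in>{..<2}. ?f i [^]\<^bsub>R\<^esub> (2::nat)) = y [^]\<^bsub>R\<^esub> (2::nat)"
    using assms(2) unfolding pythagorean_def is_square_in_def by blast
  have "{..<2::nat} = {0, 1}" by auto
  then have "(\<Oplus>\<^bsub>R\<^esub>i\<in>{..<2}. ?f i [^]\<^bsub>R\<^esub> (2::nat)) = \<one>\<^bsub>R\<^esub> \<oplus>\<^bsub>R\<^esub> x \<otimes>\<^bsub>R\<^esub> x"
    using assms(3) by (simp add: numeral_2_eq_2)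
  then show ?thesis using y by (auto simp: numeral_2_eq_2)
qed

theorem theorem5p3:
  fixes E0 :: "('a, 'm) ring_scheme" and E k :: "'a set"
  assumes "field E0" and "subfield E E0"
    and "field_char (E0\<lparr>carrier := E\<rparr>) \<noteq> 2"
    and "subfield k (E0\<lparr>carrier := E\<rparr>)"
    and "finitely_generated_over (E0\<lparr>carrier := E\<rparr>) k"
    and "transcendence_degree (E0\<lparr>carrier := E\<rparr>) k \<ge> 1"
    and "galois_extension E0 E"
    and "pythagorean E0 \<or> quadratically_closed E0"
  shows "hereditarily_non_pythagorean TYPE('b) E0"
  unfolding hereditarily_non_pythagorean_def
proof (intro allI impI notI, elim conjE)
  fix F :: "'b ring" and h
  assume F: "field F" and h: "h \<in> ring_hom E0 F"
    and fin: "ring.finite_dimension F (h ` carrier E0) (carrier F)"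
    and npi: "\<not> purely_inseparable_extension F (h ` carrier E0)"
    and pyth: "pythagorean F"
  interpret E0: field E0 by fact
  interpret F: field F by fact
  interpret h: ring_hom_ring E0 F h by (rule ring_hom_ringI2[OF E0.is_ring F.is_ring h])
  \<comment> \<open>\<open>i\<close> embeds \<open>F\<close> and \<open>e\<close> embeds
    \<open>E0\<close> into this closure, where all conjugates and the roots for extending
    homomorphisms are available.\<close>
  define L where "L = F.alg_closure"
  define i where "i = (ring.indexed_const F :: 'b \<Rightarrow> ('b list \<times> nat) multiset \<Rightarrow> 'b)"
  have L: "algebraic_closure L (i ` carrier F)" and i: "i \<in> ring_hom F L"
    unfolding L_def i_def using F.alg_closureE by blast+
  have FL: "field L" using L unfolding algebraic_closure_def by blast
  interpret L: field L by (rule FL)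
  interpret i: ring_hom_ring F L i by (rule ring_hom_ringI2[OF F.is_ring L.is_ring i])
  define e where "e = i \<circ> h"
  have e: "e \<in> ring_hom E0 L" unfolding e_def by (rule ring_hom_trans[OF h i])
  interpret e: ring_hom_ring E0 L e by (rule ring_hom_ringI2[OF E0.is_ring L.is_ring e])
  have split: "L.splitted (map i q)" if "q \<in> carrier (poly_ring F)" for q
    using algebraic_closure.roots_over_subfield[OF L]
      i.subfield_polynomial_hom[OF F.carrier_is_subfield L.one_not_zero that] by blast
  have split_e: "L.splitted (map e q)" if "q \<in> carrier (poly_ring E0)" for q
    using split[OF polynomial_hom[OF h \<open>field E0\<close> F that]] unfolding e_def by simp
  have inj_i: "inj_on i (carrier F)" by (rule non_trivial_field_hom_is_inj[OF i F FL])
  have inj_e: "inj_on e (carrier E0)" by (rule non_trivial_field_hom_is_inj[OF e \<open>field E0\<close> FL])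

  let ?H = "h ` carrier E0" and ?G = "e ` carrier E0"
  have iH: "i ` ?H = ?G" unfolding e_def by (simp add: image_comp)
  have H: "subfield ?H F" by (rule h.img_is_subfield(2)[OF E0.carrier_is_subfield F.one_not_zero])
  have G: "subfield ?G L" by (rule e.img_is_subfield(2)[OF E0.carrier_is_subfield L.one_not_zero])
  have "algebraic_extension F ?H"
    unfolding algebraic_extension_def
    using F.finite_dimension_imp_algebraic[OF H F.carrier_is_subring fin] unfolding over_def by blast
  \<comment> \<open>For an algebraic extension, failure of pure inseparability means a separable
    element outside the image of \<open>E0\<close>. Its image under \<open>i\<close> plays the part
    of \<alpha>.\<close>
  then obtain a where a: "a \<in> carrier F" "a \<notin> ?H" "separable_elem F ?H a"
    using npi unfolding purely_inseparable_extension_def by blast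
  have alg_a: "(F.algebraic over ?H) a" using a(3) unfolding separable_elem_def over_def by blast
  have "F.Irr ?H a \<in> carrier (poly_ring F)"
    using F.carrier_polynomial_shell[OF subfieldE(1)[OF H] F.IrrE(1)[OF H a(1) alg_a]] .
  then have sep_a: "L.split_separable ?G (carrier L) (i a)"
    using separable_split_separable[OF F FL i H a(1,3)] split unfolding iH by blast
  have ia: "i a \<in> carrier L" "i a \<notin> ?G"
  proof -
    show "i a \<in> carrier L" using a(1) by simp
    show "i a \<notin> ?G"
    proof
      assume "i a \<in> ?G"
      then obtain b where b: "b \<in> ?H" "i a = i b" unfolding iH[symmetric] by blast
      have "b \<in> carrier F" using b(1) h.hom_closed by blast
      then show False using inj_onD[OF inj_i b(2) a(1)] b(1) a(2) by blast
    qed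
  qed

  let ?E = "E0\<lparr>carrier := E\<rparr>"
  have FE: "field ?E" using E0.subfield_iff(2)[OF \<open>subfield E E0\<close>] .
  interpret RE: field ?E by (rule FE)
  have ER: "E \<subseteq> carrier E0" using subringE(1)[OF subfieldE(1)[OF \<open>subfield E E0\<close>]] .
  have eE: "e \<in> ring_hom ?E L"
    using e.induced_ring_hom[OF subfieldE(1)[OF \<open>subfield E E0\<close>]] unfolding ring_hom_ring_def ring_hom_ring_axioms_def by blast
  interpret eE: ring_hom_ring ?E L e by (rule ring_hom_ringI2[OF RE.is_ring L.is_ring eE])
  obtain S where S: "finite S" "S \<subseteq> carrier ?E" "carrier ?E = generate_field ?E (k \<union> S)"
    using assms(5) unfolding finitely_generated_over_def by blast
  obtain s where s: "s \<in> carrier ?E" "RE.transcendental k s"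
    using RE.transcendence_degree_transcendental[OF assms(4,6)] by blast
  have "\<exists>s\<in>generate_field ?E (k \<union> S). \<not> (RE.algebraic over k) s"
    using s unfolding S(3)[symmetric] over_def by blast
  \<comment> \<open>\<open>K\<close> and \<open>t\<close> are found with \<open>E\<close> regarded
    as a field of its own; \<open>e\<close> transports them and the finite dimension to
    \<open>L\<close>.\<close>
  then obtain K t where K: "subfield K ?E" "K \<subseteq> carrier ?E" and t: "t \<in> carrier ?E" "RE.transcendental K t"
    and fin_E: "RE.finite_dimension (generate_field ?E (insert t K)) (carrier ?E)"
    using RE.finite_over_rational_function_field[OF S(1) assms(4) S(2)] unfolding S(3)[symmetric] by blast
  have tK: "insert t K \<subseteq> carrier ?E" using t K by blast
  have cE: "carrier ?E = E" by simp
  let ?K = "e ` K" and ?M = "e ` E"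
  have K': "subfield ?K L" by (rule eE.img_is_subfield(2)[OF K(1) L.one_not_zero])
  have M: "subfield ?M L" by (rule e.img_is_subfield(2)[OF \<open>subfield E E0\<close> L.one_not_zero])
  have t': "e t \<in> carrier L" "L.transcendental ?K (e t)"
    using eE.hom_closed[OF t(1)] hom_transcendental[OF FE FL eE K(1) t] by blast+
  have KM: "?K \<subseteq> ?M" "e t \<in> ?M" using K(2) t(1) unfolding cE by blast+
  have "inj_on e (carrier ?E)" unfolding cE using inj_e ER by (rule inj_on_subset)
  then have fin_M: "L.finite_dimension (generate_field L (insert (e t) ?K)) ?M"
  proof -
    obtain n where n: "RE.dimension n (generate_field ?E (insert t K)) (carrier ?E)" using fin_E by blast
    have "L.dimension n (e ` generate_field ?E (insert t K)) (e ` carrier ?E)"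
      using eE.inj_hom_dimension[OF RE.generate_field_is_subfield[OF tK] L.one_not_zero \<open>inj_on e (carrier ?E)\<close> n] .
    then show ?thesis
      unfolding hom_generate_field[OF FE FL eE tK, symmetric] cE image_insert by (rule L.finite_dimensionI)
  qed
  have two: "\<one>\<^bsub>L\<^esub> \<oplus>\<^bsub>L\<^esub> \<one>\<^bsub>L\<^esub> \<noteq> \<zero>\<^bsub>L\<^esub>"
  proof
    assume z: "\<one>\<^bsub>L\<^esub> \<oplus>\<^bsub>L\<^esub> \<one>\<^bsub>L\<^esub> = \<zero>\<^bsub>L\<^esub>"
    have "e (\<one>\<^bsub>E0\<^esub> \<oplus>\<^bsub>E0\<^esub> \<one>\<^bsub>E0\<^esub>) = e \<zero>\<^bsub>E0\<^esub>" using z by simp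
    then have "\<one>\<^bsub>E0\<^esub> \<oplus>\<^bsub>E0\<^esub> \<one>\<^bsub>E0\<^esub> = \<zero>\<^bsub>E0\<^esub>" by (rule inj_onD[OF inj_e]) simp_all
    then show False using field_char_not_two[OF FE assms(3)] by simp
  qed
  have MG: "?M \<subseteq> ?G" using ER by blast
  have gal: "L.split_separable ?M ?G w" if w: "w \<in> ?G" for w
  proof -
    obtain x where "x \<in> carrier E0" "w = e x" using w by blast
    then show ?thesis using galois_split_separable[OF assms(7) FL e split_e] by blast
  qed

  let ?F = "i ` carrier F"
  have F': "subfield ?F L" by (rule i.img_is_subfield(2)[OF F.carrier_is_subfield L.one_not_zero])
  have fin_F: "L.finite_dimension ?G ?F"
  proof -
    obtain n where n: "F.dimension n ?H (carrier F)" using fin by blast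
    show ?thesis using i.inj_hom_dimension[OF H L.one_not_zero inj_i n] unfolding iH by (rule L.finite_dimensionI)
  qed
  have pyth_F: "\<exists>y\<in>?F. \<one>\<^bsub>L\<^esub> \<oplus>\<^bsub>L\<^esub> x \<otimes>\<^bsub>L\<^esub> x = y \<otimes>\<^bsub>L\<^esub> y" if x: "x \<in> ?F" for x
  proof -
    obtain b where b: "b \<in> carrier F" "x = i b" using x by blast
    obtain c where c: "c \<in> carrier F" "\<one>\<^bsub>F\<^esub> \<oplus>\<^bsub>F\<^esub> b \<otimes>\<^bsub>F\<^esub> b = c \<otimes>\<^bsub>F\<^esub> c"
      using pythagorean_one_plus_square[OF F pyth b(1)] by blast
    have "i (\<one>\<^bsub>F\<^esub> \<oplus>\<^bsub>F\<^esub> b \<otimes>\<^bsub>F\<^esub> b) = i (c \<otimes>\<^bsub>F\<^esub> c)" using c(2) by simp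
    then have "\<one>\<^bsub>L\<^esub> \<oplus>\<^bsub>L\<^esub> x \<otimes>\<^bsub>L\<^esub> x = i c \<otimes>\<^bsub>L\<^esub> i c" using b c(1) by simp
    then show ?thesis using c(1) by blast
  qed
  let ?N = "L.simple_extension ?G (i a)"
  have GR: "?G \<subseteq> carrier L" using subringE(1)[OF subfieldE(1)[OF G]] .
  have N: "subfield ?N L"
    using L.simple_extension_is_subfield[OF G ia(1)] L.split_separable_algebraic[OF sep_a] by blast
  have GN: "?G \<subseteq> ?N" using L.simple_extension_incl[OF GR ia(1)] .
  have GF: "?G \<subseteq> ?F" unfolding iH[symmetric] using h.hom_closed by blast
  have "i a \<in> ?F" using a(1) by blast
  then have NF: "?N \<subseteq> ?F" by (rule L.simple_extension_subring_incl[OF subfieldE(1)[OF F'] GF])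
  \<comment> \<open>\<open>F\<close> is finite over the image of \<open>E0\<close>, so the property
    of 1 + x^2 descends from \<open>F\<close> to the extension generated by \<alpha>, where it is
    contradictory.\<close>
  show False
    by (rule L.no_pythagorean_simple_extension[OF K' t' M KM fin_M two G MG gal ia sep_a
          L.pythagorean_descends[OF G F' fin_F two pyth_F N GN NF]])
qed

end
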